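(* Let $t > 0$ and $\theta, \varphi \in [0,\pi]$, and for $u,v\in[-1,1]$ write $$ q(u,v) := u \sin\frac{\theta}2\sin\frac{\varphi}2 + v \cos\frac{\theta}2\cos\frac{\varphi}2 . $$ Then, with all integrations taken over $(u,v)\in[-1,1]^2$: (i) If $\alpha,\beta \ge -1/2$, then $$ \frac{h_0^{\alpha,\beta}}{h_0^{\alpha+\beta+1/2}} \,G_t^{\alpha,\beta}(\cos\theta,\cos\varphi) = \iint G_{t/4}^{\alpha+\beta+1/2}\big( q(u,v), 1 \big) \, d\Pi_{\alpha}(u) \, d\Pi_{\beta}(v). $$ (ii) If $-1 < \beta < -1/2 \le \alpha$, then $$ \begin{aligned} \frac{h_0^{\alpha,\beta}}{h_0^{\alpha+\beta+1/2}}\, & G_t^{\alpha,\beta}(\cos\theta,\cos\varphi) \\ = \iint \Big\{ & -2(\alpha+\beta+3/2) e^{-t(\alpha+\beta+3/2)/2} \cos\frac{\theta}2\cos\frac{\varphi}2 \; G_{t/4}^{\alpha+\beta+3/2}\big(q(u,v),1\big) \, d\Pi_{\alpha}(u) \, \Pi_{\beta}(v)\, dv \\ & + G_{t/4}^{\alpha+\beta+1/2}\big(q(u,v),1\big) \, d\Pi_{\alpha}(u)\, d\Pi_{-1/2}(v) \Big\}. \end{aligned} $$ (iii) If $-1 < \alpha < -1/2 \le \beta$, then $$ \begin{aligned} \frac{h_0^{\alpha,\beta}}{h_0^{\alpha+\beta+1/2}}\, & G_t^{\alpha,\beta}(\cos\theta,\cos\varphi) \\ = \iint \Big\{ & -2(\alpha+\beta+3/2)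 e^{-t(\alpha+\beta+3/2)/2} \sin\frac{\theta}2\sin\frac{\varphi}2 \; G_{t/4}^{\alpha+\beta+3/2}\big(q(u,v),1\big) \, \Pi_{\alpha}(u)\, du \, d\Pi_{\beta}(v) \\ & + G_{t/4}^{\alpha+\beta+1/2}\big(q(u,v),1\big) \, d\Pi_{-1/2}(u)\, d\Pi_{\beta}(v) \Big\}. \end{aligned} $$ (iv) If $-1 < \alpha,\beta < -1/2$ and $\alpha+\beta > -3/2$, then $$ \begin{aligned} \frac{h_0^{\alpha,\beta}}{h_0^{\alpha+\beta+1/2}}\, & G_t^{\alpha,\beta}(\cos\theta,\cos\varphi) \\ = \iint \Big\{ & (\alpha+\beta+3/2)(\alpha+\beta+5/2) e^{-t(\alpha+\beta+2)} \sin\theta\sin\varphi \; G_{t/4}^{\alpha+\beta+5/2}\big(q(u,v),1\big) \, \Pi_{\alpha}(u)\, du \, \Pi_{\beta}(v)\, dv \\ & -2(\alpha+\beta+3/2) e^{-t(\alpha+\beta+3/2)/2} \sin\frac{\theta}2\sin\frac{\varphi}2 \; G_{t/4}^{\alpha+\beta+3/2}\big(q(u,v),1\big) \, \Pi_{\alpha}(u)\, du \, d\Pi_{-1/2}(v) \\ & -2(\alpha+\beta+3/2) e^{-t(\alpha+\beta+3/2)/2} \cos\frac{\theta}2\cos\frac{\varphi}2 \; G_{t/4}^{\alpha+\beta+3/2}\big(q(u,v),1\big) \, d\Pi_{-1/2}(u) \, \Pi_{\beta}(v)\, dv \\ & + G_{t/4}^{\alpha+\beta+1/2}\big(q(u,v),1\big)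 \, d\Pi_{-1/2}(u)\, d\Pi_{-1/2}(v) \Big\}. \end{aligned} $$ (v) If $-1 < \alpha,\beta < -1/2$ and $\alpha+\beta \le -3/2$, then $$ \begin{aligned} h_0^{\alpha,\beta} \mathfrak{C}_0^{\alpha,\beta} & G_t^{\alpha,\beta}(\cos\theta,\cos\varphi) \\ = \iint \Big\{ & (\alpha+\beta+5/2) e^{-t(\alpha+\beta+2)} \sin\theta\sin\varphi \; G_{t/4}^{\alpha+\beta+5/2}\big(q(u,v),1\big) \, \Pi_{\alpha}(u)\, du \, \Pi_{\beta}(v)\, dv \\ & -2 e^{-t(\alpha+\beta+3/2)/2} \sin\frac{\theta}2\sin\frac{\varphi}2 \; G_{t/4}^{\alpha+\beta+3/2}\big(q(u,v),1\big) \, \Pi_{\alpha}(u)\, du \, d\Pi_{-1/2}(v) \\ & -2 e^{-t(\alpha+\beta+3/2)/2} \cos\frac{\theta}2\cos\frac{\varphi}2 \; G_{t/4}^{\alpha+\beta+3/2}\big(q(u,v),1\big) \, d\Pi_{-1/2}(u) \, \Pi_{\beta}(v)\, dv \\ & + H_{t/4}^{\alpha+\beta+1/2}\big(q(u,v)\big) \, d\Pi_{-1/2}(u)\, d\Pi_{-1/2}(v) \Big\}. \end{aligned} $$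
   Context: Jacobi polynomials, for arbitrary parameters, are $$ P_n^{\alpha,\beta}(x) = \frac{1}{n!}\sum_{k=0}^n \binom{n}{k} (n+\alpha+\beta+1)_k\, (\alpha+k+1)_{n-k}\, \Big(\frac{x-1}2\Big)^k, \qquad n\ge 0, $$ with $(a)_0=1$, $(a)_k=a(a+1)\cdots(a+k-1)$ for $k\ge 1$. For $\alpha,\beta>-1$, $$ h_n^{\alpha,\beta} = \frac{2^{\alpha+\beta+1} \Gamma(n+\alpha+1)\Gamma(n+\beta+1)}{(2n+\alpha+\beta+1)\Gamma(n+\alpha+\beta+1)\Gamma(n+1)}, \qquad n\ge 0, $$ where for $n=0$ the product $(2n+\alpha+\beta+1)\Gamma(n+\alpha+\beta+1)$ is replaced by $\Gamma(\alpha+\beta+2)$. The Jacobi heat kernel for $\alpha,\beta>-1$ is $$ G_t^{\alpha,\beta}(x,y) := \sum_{n=0}^{\infty} e^{-t n(n+\alpha+\beta+1)} \frac{P_n^{\alpha,\beta}(x) P_n^{\alpha,\beta}(y)}{h_n^{\alpha,\beta}}, \qquad x,y \in [-1,1],\ t > 0. $$ A single upper index means two equal parameters: $P_n^\lambda:=P_n^{\lambda,\lambda}$, $h_n^\lambda:=h_n^{\lambda,\lambda}$, $G_t^\lambda:=G_t^{\lambda,\lambda}$. For $\alpha,\beta>-1$ put $$ \mathfrak{C}_0^{\alpha,\beta} = \frac{\Gamma(\alpha+\beta+2)}{\sqrt{\pi}\,\Gamma(\alpha+\beta+5/2)}. $$ For $-3/2<\lambda\le -1$, $$ H_t^{\lambda}(x)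 := \sum_{n=0}^{\infty} e^{-t 2n(2n+2\lambda+1)} \,\mathfrak{D}_{2n}^{\lambda} \,P_{2n}^{\lambda}(x), \qquad x \in [-1,1],\ t >0, $$ where, for $\lambda>-3/2$, $$ \mathfrak{D}_{2n}^{\lambda} = \frac{(4n+2\lambda+1)\Gamma(2n+2\lambda+1)}{2^{2\lambda+1}\Gamma(\lambda+2)\Gamma(2n+\lambda+1)} \ (n\ge 1), \qquad \mathfrak{D}_0^\lambda = \frac{\Gamma(\lambda+3/2)}{\sqrt{\pi}\,\Gamma(\lambda+2)}. $$ For $\alpha>-1$, $\alpha\ne -1/2$, $$ \Pi_{\alpha}(u) = \frac{\Gamma(\alpha+1)}{\sqrt{\pi}\, \Gamma(\alpha+1/2)} \int_0^{u} (1-w^2)^{\alpha-1/2}\, dw, \qquad -1<u<1 . $$ For $\alpha>-1/2$, $d\Pi_\alpha$ is the probability measure on $[-1,1]$ with density $\Pi_\alpha'$; $d\Pi_{-1/2}:=\frac12(\delta_{-1}+\delta_1)$, with $\delta_{\pm1}$ the unit point mass at $\pm1$. For $\alpha\in(-1,-1/2)$ the function $\Pi_\alpha$ is integrable on $[-1,1]$, and $\Pi_\alpha(u)\,du$ denotes the corresponding signed measure. *)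

theory Defs
  imports "HOL-Analysis.Analysis"
begin

definition jacobi_P :: "real \<Rightarrow> real \<Rightarrow> nat \<Rightarrow> real \<Rightarrow> real" where
  "jacobi_P \<alpha> \<beta> n x =
     1 / fact n * (\<Sum>k\<le>n. real (n choose k) * pochhammer (real n + \<alpha> + \<beta> + 1) k
       * pochhammer (\<alpha> + real k + 1) (n - k) * ((x - 1) / 2) ^ k)"

(* At n = 0 the factor (2n+\<alpha>+\<beta>+1) \<Gamma>(n+\<alpha>+\<beta>+1) is replaced by \<Gamma>(\<alpha>+\<beta>+2), which also
   covers \<alpha>+\<beta> = -1; \<Gamma>(n+1) = 1 there. *)
definition jacobi_h :: "real \<Rightarrow> real \<Rightarrow> nat \<Rightarrow> real" where
  "jacobi_h \<alpha> \<beta> n =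
     2 powr (\<alpha> + \<beta> + 1) * Gamma (real n + \<alpha> + 1) * Gamma (real n + \<beta> + 1)
     / ((if n = 0 then Gamma (\<alpha> + \<beta> + 2)
         else (2 * real n + \<alpha> + \<beta> + 1) * Gamma (real n + \<alpha> + \<beta> + 1))
        * Gamma (real n + 1))"

definition jacobi_heat :: "real \<Rightarrow> real \<Rightarrow> real \<Rightarrow> real \<Rightarrow> real \<Rightarrow> real" where
  "jacobi_heat \<alpha> \<beta> t x y =
     (\<Sum>n. exp (- t * (real n * (real n + \<alpha> + \<beta> + 1)))
        * (jacobi_P \<alpha> \<beta> n x * jacobi_P \<alpha> \<beta> n y / jacobi_h \<alpha> \<beta> n))"

abbreviation ultra_P :: "real \<Rightarrow> nat \<Rightarrow> real \<Rightarrow> real" where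
  "ultra_P a \<equiv> jacobi_P a a"

abbreviation ultra_h :: "real \<Rightarrow> nat \<Rightarrow> real" where
  "ultra_h a \<equiv> jacobi_h a a"

abbreviation ultra_heat :: "real \<Rightarrow> real \<Rightarrow> real \<Rightarrow> real \<Rightarrow> real" where
  "ultra_heat a \<equiv> jacobi_heat a a"

definition const_C0 :: "real \<Rightarrow> real \<Rightarrow> real" where
  "const_C0 \<alpha> \<beta> = Gamma (\<alpha> + \<beta> + 2) / (sqrt pi * Gamma (\<alpha> + \<beta> + 5/2))"

(* The coefficient with index 2n is coeff_D a n. *)
definition coeff_D :: "real \<Rightarrow> nat \<Rightarrow> real" where
  "coeff_D a n =
     (if n = 0 then Gamma (a + 3/2) / (sqrt pi * Gamma (a + 2))
      else (4 * real n + 2 * a + 1) * Gamma (2 * real n + 2 * a + 1)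
           / (2 powr (2 * a + 1) * Gamma (a + 2) * Gamma (2 * real n + a + 1)))"

definition heat_H :: "real \<Rightarrow> real \<Rightarrow> real \<Rightarrow> real" where
  "heat_H a t x =
     (\<Sum>n. exp (- t * (2 * real n * (2 * real n + 2 * a + 1)))
        * coeff_D a n * ultra_P a (2 * n) x)"

(* The integral is oriented, so that the function is odd. It is meant for -1 < u < 1; for
   \<alpha> < -1/2 the integral diverges at u = -1 and u = 1, two points of Lebesgue measure zero. *)
definition Pi_fun :: "real \<Rightarrow> real \<Rightarrow> real" where
  "Pi_fun \<alpha> u =
     Gamma (\<alpha> + 1) / (sqrt pi * Gamma (\<alpha> + 1/2))
       * (LBINT w=ereal 0..ereal u. (1 - w\<^sup>2) powr (\<alpha> - 1/2))"

(* The measure d\<Pi> for \<alpha> \<ge> -1/2, as a Borel measure on the real line carried by [-1,1]. *)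
definition Pi_measure :: "real \<Rightarrow> real measure" where
  "Pi_measure \<alpha> =
     (if \<alpha> = -1/2 then distr (point_measure {-1, 1} (\<lambda>_. ennreal (1/2))) borel (\<lambda>x. x)
      else density lborel (\<lambda>u. indicator {-1<..<1} u * ennreal (deriv (Pi_fun \<alpha>) u)))"

definition square_integral ::
    "real measure \<Rightarrow> real measure \<Rightarrow> (real \<Rightarrow> real \<Rightarrow> real) \<Rightarrow> real" where
  "square_integral \<mu> \<nu> F =
     set_lebesgue_integral (\<mu> \<Otimes>\<^sub>M \<nu>) ({-1..1} \<times> {-1..1}) (\<lambda>(u, v). F u v)"

definition q_arg :: "real \<Rightarrow> real \<Rightarrow> real \<Rightarrow> real \<Rightarrow> real" where
  "q_arg \<theta> \<phi> u v = u * sin (\<theta>/2) * sin (\<phi>/2) + v * cos (\<theta>/2) * cos (\<phi>/2)"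

end

theory Submission
  imports Defs
begin

text \<open>
  Put \<open>\<lambda> = \<alpha> + \<beta> + 1/2\<close>. The representation rests on a product formula of Dijksma-Koornwinder
  type: \<open>P\<^sub>n\<^sup>\<alpha>\<^sup>,\<^sup>\<beta>(cos \<theta>) P\<^sub>n\<^sup>\<alpha>\<^sup>,\<^sup>\<beta>(cos \<phi>)\<close> is an explicit multiple of the mean of
  \<open>P\<^sub>2\<^sub>n\<^sup>\<lambda>(q(u,v))\<close> with respect to \<open>d\<Pi>\<^sub>\<alpha>(u) d\<Pi>\<^sub>\<beta>(v)\<close>. The eigenvalues match, because
  \<open>n (n + \<alpha> + \<beta> + 1)\<close> is a quarter of \<open>2n (2n + 2\<lambda> + 1)\<close>; hence the time \<open>t/4\<close>. The mean of
  \<open>P\<^sub>k\<^sup>\<lambda>(q(u,v))\<close> vanishes for odd \<open>k\<close> by the symmetry \<open>(u,v) \<mapsto> (-u,-v)\<close>. So the theorem is an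
  identity between the terms of two series, together with an interchange of sum and integral.

  For fixed \<open>n\<close> the measures enter only through finitely many moments. Those of \<open>d\<Pi>\<^sub>\<alpha>\<close> are
  \<open>(1/2)\<^sub>i / (\<alpha> + 1)\<^sub>i\<close> in degree \<open>2i\<close> and \<open>0\<close> in odd degree, and these numbers make sense for
  every \<open>\<alpha> > -1\<close>. The product formula is therefore proved as an algebraic statement about moment
  sequences, for all \<open>\<alpha>, \<beta> > -1\<close> at once (\<open>jacobi_product_formula\<close>). A quadratic transformation
  (\<open>ultra_poly_even\<close>) writes \<open>P\<^sub>2\<^sub>n\<^sup>\<lambda>(x)\<close> as a terminating hypergeometric series in \<open>x\<^sup>2\<close>; taking
  moments turns it into a terminating Appell series \<open>F\<^sub>4\<close>, and this factors into two Jacobi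
  polynomials (\<open>appell_product\<close>). The factorisation and the quadratic transformation hold
  because both sides are polynomial solutions of the same Jacobi equation, and such a solution is
  determined by its leading coefficient (\<open>jacobi_eigen_proportional\<close>).

  For \<open>-1 < \<alpha> < -1/2\<close> the sequence above is no longer that of a positive measure on \<open>[-1, 1]\<close>, but it equals
  \<open>\<delta>(j) - j \<kappa>(j - 1)\<close>, where \<open>\<delta>\<close> and \<open>\<kappa>\<close> are the moments of \<open>d\<Pi>\<^sub>-\<^sub>1\<^sub>/\<^sub>2\<close> and of \<open>\<Pi>\<^sub>\<alpha>(u) du\<close>
  (\<open>has_moments_Pi_fun\<close>, \<open>pi_moment_split\<close>). The factor \<open>j\<close> is a derivative of the integrand, and
  differentiation raises the parameter of ultraspherical polynomials by one; a split in each of the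
  two variables gives the two or four terms of the formulas.

  Finally, \<open>D\<^sub>2\<^sub>n\<^sup>\<lambda>\<close> is the coefficient of \<open>P\<^sub>2\<^sub>n\<^sup>\<lambda>\<close> in the series of \<open>G\<^sup>\<lambda>(\<cdot>, 1)\<close> divided by
  \<open>\<lambda> + 1\<close>, continued to \<open>\<lambda> > -3/2\<close>. All five cases are one computation with the
  coefficients \<open>D\<^sub>2\<^sub>n\<^sup>\<lambda>\<close> (\<open>jacobi_heat_eq_moment_series\<close>); when \<open>\<lambda> > -1\<close> the factor \<open>\<lambda> + 1\<close> is put
  back, which turns \<open>H\<^sup>\<lambda>\<close> into \<open>G\<^sup>\<lambda>(\<cdot>, 1)\<close>.
\<close>

section \<open>The Jacobi differential equation\<close>

text \<open>
  The differential operator that has \<open>P\<^sub>n\<^sup>\<alpha>\<^sup>,\<^sup>\<beta>\<close> as an eigenfunction, with eigenvalue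
  \<open>- n (n + \<alpha> + \<beta> + 1)\<close>.
\<close>
definition jacobi_op :: "real \<Rightarrow> real \<Rightarrow> real poly \<Rightarrow> real poly" where
  "jacobi_op \<alpha> \<beta> p =
     [:1, 0, -1:] * pderiv (pderiv p) + [:\<beta> - \<alpha>, - (\<alpha> + \<beta> + 2):] * pderiv p"

lemma coeff_jacobi_op:
  "coeff (jacobi_op \<alpha> \<beta> p) j =
     (real j + 2) * (real j + 1) * coeff p (j + 2) + (\<beta> - \<alpha>) * (real j + 1) * coeff p (j + 1)
     - real j * (real j + \<alpha> + \<beta> + 1) * coeff p j"
  by (cases j; cases "j - 1")
     (auto simp: jacobi_op_def coeff_pderiv coeff_pCons algebra_simps of_nat_Suc split: nat.splits)

lemma jacobi_op_add: "jacobi_op \<alpha> \<beta> (p + q) = jacobi_op \<alpha> \<beta> p + jacobi_op \<alpha> \<beta> q"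
  unfolding jacobi_op_def pderiv_add distrib_left by (simp only: add_ac)

lemma jacobi_op_smult: "jacobi_op \<alpha> \<beta> (smult c p) = smult c (jacobi_op \<alpha> \<beta> p)"
  by (simp add: jacobi_op_def pderiv_smult smult_add_right)

lemma jacobi_op_sum: "jacobi_op \<alpha> \<beta> (\<Sum>i\<in>I. f i) = (\<Sum>i\<in>I. jacobi_op \<alpha> \<beta> (f i))"
proof (induction I rule: infinite_finite_induct)
  case (insert i I)
  then show ?case by (simp add: jacobi_op_add)
qed (simp_all add: jacobi_op_def)

definition jacobi_eigen :: "real \<Rightarrow> real \<Rightarrow> nat \<Rightarrow> real poly \<Rightarrow> bool" where
  "jacobi_eigen \<alpha> \<beta> n p \<longleftrightarrow>
     degree p \<le> n \<and> jacobi_op \<alpha> \<beta> p = smult (- (real n * (real n + \<alpha> + \<beta> + 1))) p"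

lemma jacobi_eigen_smult: "jacobi_eigen \<alpha> \<beta> n p \<Longrightarrow> jacobi_eigen \<alpha> \<beta> n (smult c p)"
  by (auto simp: jacobi_eigen_def jacobi_op_smult mult_ac degree_smult_eq)

text \<open>
  The coefficient of \<open>x\<^sup>j\<close> in the equation has the factor \<open>(n - j) (n + j + \<alpha> + \<beta> + 1)\<close> in front of
  \<open>coeff p j\<close> and otherwise involves only higher coefficients, so a vanishing top coefficient
  forces all others to vanish. Normalisation by the top coefficient, rather than by the value at
  \<open>1\<close>, also covers the ultraspherical parameters in \<open>(-3/2, -1]\<close>, where the value at \<open>1\<close> can be \<open>0\<close>.
\<close>
lemma jacobi_eigen_zero_if_coeff_zero:
  assumes "jacobi_eigen \<alpha> \<beta> n p" "coeff p n = 0" "\<And>j. j < n \<Longrightarrow> real n + real j + \<alpha> + \<beta> + 1 \<noteq> 0"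
  shows "p = 0"
proof -
  have high: "coeff p j = 0" if "j \<ge> n" for j
    using assms(1,2) that by (cases "j = n") (auto simp: jacobi_eigen_def intro: coeff_eq_0)
  have low: "coeff p (n - d) = 0" if "d \<le> n" for d
    using that
  proof (induction d rule: less_induct)
    case (less d)
    show ?case
    proof (cases "d = 0")
      case True
      then show ?thesis using assms(2) by simp
    next
      case False
      define j where "j = n - d"
      have jn: "j < n" using False less.prems by (simp add: j_def)
      have c1: "coeff p (j + 1) = 0"
        using less.IH[of "d - 1"] False less.prems by (simp add: j_def Suc_diff_le)
      have c2: "coeff p (j + 2) = 0"
      proof (cases "d = 1")
        case True
        then show ?thesis using high[of "j + 2"] less.prems by (simp add: j_def)
      next
        case False
        have "n - (d - 2) = j + 2" using False \<open>d \<noteq> 0\<close> less.prems by (auto simp: j_def)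
        then show ?thesis using less.IH[of "d - 2"] \<open>d \<noteq> 0\<close> less.prems by simp
      qed
      have "coeff (jacobi_op \<alpha> \<beta> p) j = - (real n * (real n + \<alpha> + \<beta> + 1)) * coeff p j"
        using assms(1) by (simp add: jacobi_eigen_def)
      then have "(real n - real j) * (real n + real j + \<alpha> + \<beta> + 1) * coeff p j = 0"
        unfolding coeff_jacobi_op c1 c2 by (simp add: algebra_simps)
      then show ?thesis using assms(3)[OF jn] jn by (simp add: j_def)
    qed
  qed
  have "coeff p j = 0" for j
    using low[of "n - j"] high[of j] by (cases "j \<le> n") auto
  then show ?thesis by (simp add: poly_eq_iff)
qed

lemma jacobi_eigen_proportional:
  assumes "jacobi_eigen \<alpha> \<beta> n p" "jacobi_eigen \<alpha> \<beta> n q"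
    and "\<And>j. j < n \<Longrightarrow> real n + real j + \<alpha> + \<beta> + 1 \<noteq> 0"
  shows "smult (coeff q n) p = smult (coeff p n) q"
proof -
  let ?r = "smult (coeff q n) p - smult (coeff p n) q"
  have "jacobi_eigen \<alpha> \<beta> n ?r"
    using jacobi_eigen_smult[OF assms(1), of "coeff q n"]
      jacobi_eigen_smult[OF assms(2), of "- coeff p n"] jacobi_op_add[of \<alpha> \<beta> "smult (coeff q n) p" "smult (- coeff p n) q"]
    by (auto simp: jacobi_eigen_def degree_diff_le smult_add_right smult_diff_right jacobi_op_smult)
  then have "?r = 0" by (rule jacobi_eigen_zero_if_coeff_zero) (use assms(3) in auto)
  then show ?thesis by simp
qed

abbreviation minus_half :: "real poly" where "minus_half \<equiv> [:1/2, - (1/2):]"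
abbreviation plus_half :: "real poly" where "plus_half \<equiv> [:1/2, 1/2:]"

lemma poly_pderiv_half_powers:
  "poly (pderiv (minus_half ^ i * plus_half ^ k)) x
     = - (real i / 2) * poly (minus_half ^ (i - 1) * plus_half ^ k) x
       + real k / 2 * poly (minus_half ^ i * plus_half ^ (k - 1)) x"
proof -
  have "pderiv (minus_half ^ i * plus_half ^ k)
    = minus_half ^ i * pderiv (plus_half ^ k) + plus_half ^ k * pderiv (minus_half ^ i)"
    by (rule pderiv_mult)
  then show ?thesis by (simp add: pderiv_power pderiv_pCons)
qed

lemma pderiv_half_powers:
  "pderiv (minus_half ^ i * plus_half ^ k)
     = smult (- (real i / 2)) (minus_half ^ (i - 1) * plus_half ^ k)
       + smult (real k / 2) (minus_half ^ i * plus_half ^ (k - 1))"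
  unfolding poly_eq_poly_eq_iff[symmetric] 
  by (rule ext) (simp only: poly_pderiv_half_powers poly_add poly_smult)

text \<open>
  In the family \<open>((1 - x)/2)\<^sup>i ((1 + x)/2)\<^sup>k\<close> the operator moves one unit between \<open>i\<close> and \<open>k\<close>, so
  the eigenvalue equation becomes a three-term relation for coefficients. The
  expansions of the Jacobi and of the Appell polynomials both live in this family.
\<close>
lemma jacobi_op_half_powers:
  "jacobi_op \<alpha> \<beta> (minus_half ^ i * plus_half ^ k)
     = smult (real i * (real i + \<alpha>)) (minus_half ^ (i - 1) * plus_half ^ (k + 1))
       + smult (real k * (real k + \<beta>)) (minus_half ^ (i + 1) * plus_half ^ (k - 1))
       - smult (2 * real i * real k + (\<alpha> + 1) * real k + (\<beta> + 1) * real i)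
           (minus_half ^ i * plus_half ^ k)"
proof -
  have "poly (jacobi_op \<alpha> \<beta> (minus_half ^ i * plus_half ^ k)) x =
    poly (smult (real i * (real i + \<alpha>)) (minus_half ^ (i - 1) * plus_half ^ (k + 1))
       + smult (real k * (real k + \<beta>)) (minus_half ^ (i + 1) * plus_half ^ (k - 1))
       - smult (2 * real i * real k + (\<alpha> + 1) * real k + (\<beta> + 1) * real i)
           (minus_half ^ i * plus_half ^ k)) x" for x
  proof -
    define a where "a = poly minus_half x"
    define b where "b = poly plus_half x"
    have x: "x = b - a" and ab: "a + b = 1" by (simp_all add: a_def b_def field_simps)
    have x1: "1 - x * x = 4 * a * b" "(\<beta> - \<alpha>) - (\<alpha> + \<beta> + 2) * x = (2 * \<beta> + 2) * a - (2 * \<alpha> + 2) * b"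
      using ab unfolding x by algebra+
    have 1: "poly (pderiv (minus_half ^ i * plus_half ^ k)) x
       = - (real i / 2) * (a ^ (i - 1) * b ^ k) + real k / 2 * (a ^ i * b ^ (k - 1))"
      unfolding pderiv_half_powers by (simp add: a_def b_def)
    have 2: "poly (pderiv (pderiv (minus_half ^ i * plus_half ^ k))) x
       = - (real i / 2) * (- (real (i - 1) / 2) * (a ^ (i - 1 - 1) * b ^ k) + real k / 2 * (a ^ (i - 1) * b ^ (k - 1)))
         + real k / 2 * (- (real i / 2) * (a ^ (i - 1) * b ^ (k - 1)) + real (k - 1) / 2 * (a ^ i * b ^ (k - 1 - 1)))"
      unfolding pderiv_half_powers pderiv_add pderiv_smult by (simp add: a_def b_def)
    have i1: "real i * (a ^ (i - 1) * a) = real i * a ^ i" by (cases i) auto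
    have k1: "real k * (b ^ (k - 1) * b) = real k * b ^ k" by (cases k) auto
    have i2: "real i * real (i - 1) * (a ^ (i - 1 - 1) * a) = real i * (real i - 1) * a ^ (i - 1)"
      by (cases i; cases "i - 1") auto
    have k2: "real k * real (k - 1) * (b ^ (k - 1 - 1) * b) = real k * (real k - 1) * b ^ (k - 1)"
      by (cases k; cases "k - 1") auto
    have "poly (jacobi_op \<alpha> \<beta> (minus_half ^ i * plus_half ^ k)) x
       = (1 - x * x) * poly (pderiv (pderiv (minus_half ^ i * plus_half ^ k))) x
         + ((\<beta> - \<alpha>) - (\<alpha> + \<beta> + 2) * x) * poly (pderiv (minus_half ^ i * plus_half ^ k)) x"
      by (simp add: jacobi_op_def algebra_simps)
    also have "\<dots> = real i * real (i - 1) * (a ^ (i - 1 - 1) * a) * b ^ k * b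
        + real k * real (k - 1) * (b ^ (k - 1 - 1) * b) * a ^ i * a
        - 2 * (real i * (a ^ (i - 1) * a)) * (real k * (b ^ (k - 1) * b))
        - (\<beta> + 1) * (real i * (a ^ (i - 1) * a)) * b ^ k
        + (\<beta> + 1) * real k * a ^ i * a * b ^ (k - 1)
        + (\<alpha> + 1) * real i * b ^ k * b * a ^ (i - 1)
        - (\<alpha> + 1) * (real k * (b ^ (k - 1) * b)) * a ^ i"
      unfolding x1 1 2 by (simp add: field_simps)
    also have "\<dots> = real i * (real i + \<alpha>) * (a ^ (i - 1) * b ^ (k + 1))
      + real k * (real k + \<beta>) * (a ^ (i + 1) * b ^ (k - 1))
      - (2 * real i * real k + (\<alpha> + 1) * real k + (\<beta> + 1) * real i) * (a ^ i * b ^ k)"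
      unfolding i1 k1 i2 k2 by (simp add: algebra_simps)
    finally show ?thesis
      by (simp only: poly_add poly_diff poly_smult poly_mult poly_power a_def b_def)
  qed
  then show ?thesis unfolding poly_eq_poly_eq_iff[symmetric] by blast
qed

definition jacobi_poly :: "real \<Rightarrow> real \<Rightarrow> nat \<Rightarrow> real poly" where
  "jacobi_poly \<alpha> \<beta> n = smult (1 / fact n)
     (\<Sum>k\<le>n. smult (real (n choose k) * pochhammer (real n + \<alpha> + \<beta> + 1) k
       * pochhammer (\<alpha> + real k + 1) (n - k) * (-1) ^ k) (minus_half ^ k))"

lemma poly_jacobi_poly: "poly (jacobi_poly \<alpha> \<beta> n) x = jacobi_P \<alpha> \<beta> n x"
proof -
  have "((x - 1) / 2) ^ k = (-1) ^ k * (1 / 2 - x / 2) ^ k" for k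
    by (subst power_mult_distrib[symmetric]) (simp add: field_simps)
  then show ?thesis
    by (simp add: jacobi_poly_def jacobi_P_def poly_sum mult.assoc)
qed

lemma degree_jacobi_poly_le: "degree (jacobi_poly \<alpha> \<beta> n) \<le> n"
proof -
  have "degree (minus_half ^ k) \<le> k" for k
    using degree_power_le[of minus_half k] by simp
  then have "degree (minus_half ^ k) \<le> n" if "k \<le> n" for k
    using that le_trans by blast
  then show ?thesis unfolding jacobi_poly_def
    by (intro order.trans[OF degree_smult_le] degree_sum_le) (auto intro: order.trans[OF degree_smult_le])
qed

lemma coeff_jacobi_poly_top:
  "coeff (jacobi_poly \<alpha> \<beta> n) n = pochhammer (real n + \<alpha> + \<beta> + 1) n / (fact n * 2 ^ n)"
proof -
  have small: "coeff (minus_half ^ k) n = 0" if "k < n" for k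
    using degree_power_le[of minus_half k] that by (intro coeff_eq_0) simp
  have lc: "coeff (minus_half ^ n) n = (-1/2) ^ n"
    using lead_coeff_power[of minus_half n] by (simp add: degree_power_eq)
  have sgn: "(-1) ^ n * (-1/2) ^ n = (1/2 :: real) ^ n"
    unfolding power_mult_distrib[symmetric] by simp
  have "coeff (jacobi_poly \<alpha> \<beta> n) n = 1 / fact n *
     (\<Sum>k\<le>n. (real (n choose k) * pochhammer (real n + \<alpha> + \<beta> + 1) k
       * pochhammer (\<alpha> + real k + 1) (n - k) * (-1) ^ k) * coeff (minus_half ^ k) n)"
    by (simp add: jacobi_poly_def coeff_sum)
  also have "\<dots> = 1 / fact n *
     (\<Sum>k\<in>{n}. (real (n choose k) * pochhammer (real n + \<alpha> + \<beta> + 1) k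
       * pochhammer (\<alpha> + real k + 1) (n - k) * (-1) ^ k) * coeff (minus_half ^ k) n)"
    by (intro arg_cong2[where f="(*)"] refl sum.mono_neutral_right)
      (auto simp: small simp del: mult_eq_0_iff)
  also have "\<dots> = pochhammer (real n + \<alpha> + \<beta> + 1) n / (fact n * 2 ^ n)"
    using sgn by (simp add: lc mult.assoc power_one_over)
  finally show ?thesis .
qed

lemma smult_sum_right: "smult c (\<Sum>i\<in>I. f i) = (\<Sum>i\<in>I. smult c (f i))"
  by (induction I rule: infinite_finite_induct) (simp_all add: smult_add_right)

lemma sum_shift_zero:
  fixes f :: "nat \<Rightarrow> 'a::comm_monoid_add"
  assumes "f 0 = 0" "f (Suc n) = 0"
  shows "(\<Sum>i\<le>n. f i) = (\<Sum>i\<le>n. f (Suc i))"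
  using sum.atMost_Suc[of f n] sum.atMost_Suc_shift[of f n] assms by simp

text \<open>
  With \<open>k = 0\<close> in the family above, the equation reduces to the ratio of
  consecutive coefficients of the hypergeometric expansion.
\<close>
lemma jacobi_eigen_jacobi_poly: "jacobi_eigen \<alpha> \<beta> n (jacobi_poly \<alpha> \<beta> n)"
proof -
  define b where "b = real n + \<alpha> + \<beta> + 1"
  define c where "c k = real (n choose k) * pochhammer b k
       * pochhammer (\<alpha> + real k + 1) (n - k) * (-1) ^ k" for k
  define M where "M k = minus_half ^ k" for k
  have J: "jacobi_poly \<alpha> \<beta> n = smult (1 / fact n) (\<Sum>k\<le>n. smult (c k) (M k))"
    by (simp add: jacobi_poly_def c_def b_def M_def)
  have cSuc: "c (Suc k) * (real (Suc k) * (real (Suc k) + \<alpha>)) = c k * ((real k - real n) * (real k + b))"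
    if "k \<le> n" for k
  proof (cases "k = n")
    case True
    then show ?thesis by (simp add: c_def)
  next
    case False
    then have kn: "k < n" using that by simp
    have 1: "real (n choose Suc k) * real (Suc k) = real (n choose k) * (real n - real k)"
      using binomial_absorb_comp[of n k] binomial_absorption[of k n] kn
      by (metis (no_types) Suc_times_binomial_add add.commute binomial_absorption le_add_diff_inverse2 less_imp_le mult.commute of_nat_diff of_nat_mult that)
    have 2: "pochhammer (\<alpha> + real k + 1) (n - k)
        = (real (Suc k) + \<alpha>) * pochhammer (\<alpha> + real (Suc k) + 1) (n - Suc k)"
      using pochhammer_rec[of "\<alpha> + real k + 1" "n - Suc k"] kn by (simp add: Suc_diff_Suc add_ac)
    have "c (Suc k) * (real (Suc k) * (real (Suc k) + \<alpha>)) =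
        (real (n choose Suc k) * real (Suc k)) * pochhammer b (Suc k)
       * ((real (Suc k) + \<alpha>) * pochhammer (\<alpha> + real (Suc k) + 1) (n - Suc k)) * (-1) ^ Suc k"
      by (simp add: c_def)
    also have "\<dots> = c k * ((real k - real n) * (real k + b))"
      unfolding 1 2[symmetric] by (simp add: c_def pochhammer_Suc algebra_simps)
    finally show ?thesis .
  qed
  have op: "jacobi_op \<alpha> \<beta> (M k) = smult (real k * (real k + \<alpha>)) (M (k - 1))
      - smult ((real k - real n) * (real k + b) + real n * b) (M k)" for k
  proof -
    have split: "smult (real k) (M (k - 1) * plus_half) = smult (real k) (M (k - 1)) - smult (real k) (M k)"
    proof (cases k)
      case (Suc j)
      have pm: "plus_half = 1 - minus_half" by (simp add: one_pCons)
      show ?thesis unfolding Suc M_def by (subst pm) (simp add: algebra_simps smult_diff_right)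
    qed simp
    have e: "(real k - real n) * (real k + b) + real n * b = real k * (real k + \<alpha>) + (\<beta> + 1) * real k"
      by (simp add: b_def algebra_simps)
    have "jacobi_op \<alpha> \<beta> (M k) = smult (real k + \<alpha>) (smult (real k) (M (k - 1) * plus_half))
      - smult ((\<beta> + 1) * real k) (M k)"
      using jacobi_op_half_powers[of \<alpha> \<beta> k 0] by (simp add: M_def mult_ac)
    also have "\<dots> = smult (real k * (real k + \<alpha>)) (M (k - 1))
      - smult ((real k - real n) * (real k + b) + real n * b) (M k)"
      unfolding split e by (simp add: smult_diff_right smult_add_left mult_ac)
    finally show ?thesis .
  qed
  have "jacobi_op \<alpha> \<beta> (\<Sum>k\<le>n. smult (c k) (M k)) =
     (\<Sum>k\<le>n. smult (c k * (real k * (real k + \<alpha>))) (M (k - 1)))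
     - (\<Sum>k\<le>n. smult (c k * ((real k - real n) * (real k + b) + real n * b)) (M k))"
    by (simp add: jacobi_op_sum jacobi_op_smult op smult_diff_right sum_subtractf)
  also have "(\<Sum>k\<le>n. smult (c k * (real k * (real k + \<alpha>))) (M (k - 1)))
     = (\<Sum>k\<le>n. smult (c (Suc k) * (real (Suc k) * (real (Suc k) + \<alpha>))) (M (Suc k - 1)))"
    by (rule sum_shift_zero) (simp_all add: c_def)
  also have "\<dots> = (\<Sum>k\<le>n. smult (c k * ((real k - real n) * (real k + b))) (M k))"
    by (intro sum.cong refl) (simp only: cSuc diff_Suc_1 atMost_iff)
  also have "\<dots> - (\<Sum>k\<le>n. smult (c k * ((real k - real n) * (real k + b) + real n * b)) (M k))
     = smult (- (real n * b)) (\<Sum>k\<le>n. smult (c k) (M k))"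
    unfolding sum_subtractf[symmetric] smult_sum_right
    by (intro sum.cong refl)
      (simp only: smult_diff_left[symmetric] smult_smult, simp add: algebra_simps)
  finally have "jacobi_op \<alpha> \<beta> (\<Sum>k\<le>n. smult (c k) (M k))
    = smult (- (real n * b)) (\<Sum>k\<le>n. smult (c k) (M k))" .
  moreover have "real n * b = real n * (real n + \<alpha> + \<beta> + 1)" by (simp add: b_def)
  ultimately show ?thesis
    unfolding jacobi_eigen_def J jacobi_op_smult
    using degree_jacobi_poly_le[of \<alpha> \<beta> n] by (simp only: J smult_smult mult.commute simp_thms)
qed

section \<open>Reflection and the Appell polynomials\<close>

lemma jacobi_P_one: "jacobi_P \<alpha> \<beta> n 1 = pochhammer (\<alpha> + 1) n / fact n"
proof -
  have "(\<Sum>k\<le>n. real (n choose k) * pochhammer (real n + \<alpha> + \<beta> + 1) k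
      * pochhammer (\<alpha> + real k + 1) (n - k) * ((1 - 1) / 2) ^ k)
    = (\<Sum>k\<in>{0}. real (n choose k) * pochhammer (real n + \<alpha> + \<beta> + 1) k
      * pochhammer (\<alpha> + real k + 1) (n - k) * ((1 - 1) / 2) ^ k)"
    by (rule sum.mono_neutral_right) auto
  then show ?thesis by (simp add: jacobi_P_def)
qed

lemma jacobi_eigen_reflect:
  assumes "jacobi_eigen \<alpha> \<beta> n p"
  shows "jacobi_eigen \<beta> \<alpha> n (pcompose p [:0, -1:])"
proof -
  have "degree (pcompose p [:0, -1:]) \<le> n"
    using assms degree_pcompose_le[of p "[:0, -1:]"] by (simp add: jacobi_eigen_def)
  moreover have "coeff (jacobi_op \<beta> \<alpha> (pcompose p [:0, -1:])) j
    = - (real n * (real n + \<beta> + \<alpha> + 1)) * coeff (pcompose p [:0, -1:]) j" for j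
  proof -
    have "coeff (jacobi_op \<alpha> \<beta> p) j = - (real n * (real n + \<alpha> + \<beta> + 1)) * coeff p j"
      using assms by (simp add: jacobi_eigen_def)
    then have "(-1) ^ j * coeff (jacobi_op \<alpha> \<beta> p) j
        = (-1) ^ j * (- (real n * (real n + \<alpha> + \<beta> + 1)) * coeff p j)" by simp
    then show ?thesis
      unfolding coeff_jacobi_op coeff_pcompose_linear by (simp add: algebra_simps)
  qed
  ultimately show ?thesis by (simp add: jacobi_eigen_def poly_eq_iff)
qed

text \<open>
  The reflection \<open>x \<mapsto> -x\<close> exchanges \<open>\<alpha>\<close> and \<open>\<beta>\<close> in the equation, so both sides solve the same
  equation and have the same leading coefficient.
\<close>
lemma jacobi_poly_reflect:
  assumes "\<And>j. j < n \<Longrightarrow> real n + real j + \<alpha> + \<beta> + 1 \<noteq> 0"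
  shows "pcompose (jacobi_poly \<beta> \<alpha> n) [:0, -1:] = smult ((-1) ^ n) (jacobi_poly \<alpha> \<beta> n)"
proof -
  let ?q = "pcompose (jacobi_poly \<beta> \<alpha> n) [:0, -1:]"
  let ?c = "pochhammer (real n + \<alpha> + \<beta> + 1) n / (fact n * 2 ^ n)"
  have c: "coeff ?q n = (-1) ^ n * ?c"
    by (simp add: coeff_pcompose_linear coeff_jacobi_poly_top add_ac)
  have nz: "?c \<noteq> 0"
    using assms by (fastforce simp: pochhammer_eq_0_iff)
  have "jacobi_eigen \<alpha> \<beta> n ?q"
    by (intro jacobi_eigen_reflect jacobi_eigen_jacobi_poly)
  then have "smult ((-1) ^ n * ?c) (jacobi_poly \<alpha> \<beta> n) = smult ?c ?q"
    using jacobi_eigen_proportional[OF jacobi_eigen_jacobi_poly, of \<alpha> \<beta> n ?q] assms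
    by (simp add: c coeff_jacobi_poly_top)
  then have "smult ?c (smult ((-1) ^ n) (jacobi_poly \<alpha> \<beta> n)) = smult ?c ?q"
    by (simp add: mult.commute)
  then show ?thesis using nz by (metis smult_cancel)
qed

lemma jacobi_P_reflect:
  assumes "\<alpha> > -1" "\<beta> > -1"
  shows "jacobi_P \<beta> \<alpha> n (- x) = (-1) ^ n * jacobi_P \<alpha> \<beta> n x"
proof -
  have "poly (pcompose (jacobi_poly \<beta> \<alpha> n) [:0, -1:]) x = poly (smult ((-1) ^ n) (jacobi_poly \<alpha> \<beta> n)) x"
    by (subst jacobi_poly_reflect) (use assms in auto)
  then show ?thesis by (simp add: poly_pcompose poly_jacobi_poly)
qed

text \<open>
  The exception \<open>n = 1\<close> comes from \<open>a = -1\<close>, where \<open>n + j + 2a + 1\<close> vanishes at \<open>n = 1\<close>,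
  \<open>j = 0\<close> and the leading coefficient of \<open>P\<^sub>1\<close> is \<open>0\<close>.
\<close>
lemma coeff_ultra_poly_parity:
  assumes "a > -3/2" "n \<noteq> 1 \<or> a > -1" "odd (n + j)"
  shows "coeff (jacobi_poly a a n) j = 0"
proof -
  have "real n + real i + a + a + 1 \<noteq> 0" if "i < n" for i
    using assms that by (cases "n = 1") auto
  then have "pcompose (jacobi_poly a a n) [:0, -1:] = smult ((-1) ^ n) (jacobi_poly a a n)"
    by (rule jacobi_poly_reflect)
  then have "(-1) ^ j * coeff (jacobi_poly a a n) j = (-1) ^ n * coeff (jacobi_poly a a n) j"
    by (metis coeff_pcompose_linear coeff_smult)
  then show ?thesis using assms(3) by (cases "even j") auto
qed

text \<open>
  The coefficient of \<open>X\<^sup>i Y\<^sup>k\<close> in Appell's series \<open>F\<^sub>4(-n, n + \<alpha> + \<beta> + 1; \<alpha> + 1, \<beta> + 1; X, Y)\<close>.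
\<close>
definition appell_coeff :: "real \<Rightarrow> real \<Rightarrow> nat \<Rightarrow> nat \<Rightarrow> nat \<Rightarrow> real" where
  "appell_coeff \<alpha> \<beta> n i k =
     pochhammer (- real n) (i + k) * pochhammer (real n + \<alpha> + \<beta> + 1) (i + k)
     / (fact i * fact k * pochhammer (\<alpha> + 1) i * pochhammer (\<beta> + 1) k)"

lemma appell_coeff_eq_0: "i + k > n \<Longrightarrow> appell_coeff \<alpha> \<beta> n i k = 0"
  by (simp add: appell_coeff_def pochhammer_of_nat_eq_0_lemma)

lemma appell_coeff_Suc:
  assumes "\<alpha> > -1"
  shows "appell_coeff \<alpha> \<beta> n (Suc i) k * (real (Suc i) * (real (Suc i) + \<alpha>))
    = appell_coeff \<alpha> \<beta> n i k
      * ((real (i + k) - real n) * (real (i + k) + real n + \<alpha> + \<beta> + 1))"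
proof -
  define R where "R = real (Suc i) * (real (Suc i) + \<alpha>)"
  define D where "D i = fact i * fact k * pochhammer (\<alpha> + 1) i * pochhammer (\<beta> + 1) k" for i
  define N where "N i = pochhammer (- real n) (i + k) * pochhammer (real n + \<alpha> + \<beta> + 1) (i + k)" for i
  have "pochhammer (\<alpha> + 1) i > 0" "\<alpha> + 1 + real i > 0"
    using assms by (auto intro!: pochhammer_pos)
  then have "R / D (Suc i) = 1 / D i"
    by (simp add: R_def D_def pochhammer_Suc divide_simps del: of_nat_Suc)
  then have 1: "N (Suc i) / D (Suc i) * R = N (Suc i) / D i"
    by (metis mult.right_neutral times_divide_eq_left times_divide_eq_right)
  have 2: "N (Suc i) = N i * ((real (i + k) - real n) * (real (i + k) + real n + \<alpha> + \<beta> + 1))"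
    by (simp add: N_def pochhammer_Suc algebra_simps)
  have "appell_coeff \<alpha> \<beta> n j k = N j / D j" for j
    by (simp add: appell_coeff_def N_def D_def)
  then show ?thesis using 1 unfolding R_def[symmetric] by (simp add: 2)
qed

lemma appell_coeff_commute: "appell_coeff \<alpha> \<beta> n i k = appell_coeff \<beta> \<alpha> n k i"
  by (simp add: appell_coeff_def add_ac mult_ac)

text \<open>
  The series \<open>F\<^sub>4\<close> at \<open>X = (1 - x)(1 - y)/4\<close> and \<open>Y = (1 + x)(1 + y)/4\<close>, as a polynomial in \<open>x\<close>.
\<close>
definition appell_poly :: "real \<Rightarrow> real \<Rightarrow> nat \<Rightarrow> real \<Rightarrow> real poly" where
  "appell_poly \<alpha> \<beta> n y = (\<Sum>i\<le>n. \<Sum>k\<le>n.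
     smult (appell_coeff \<alpha> \<beta> n i k * ((1 - y) / 2) ^ i * ((1 + y) / 2) ^ k)
       (minus_half ^ i * plus_half ^ k))"

lemma degree_appell_poly_le: "degree (appell_poly \<alpha> \<beta> n y) \<le> n"
proof -
  have "degree (smult (appell_coeff \<alpha> \<beta> n i k * ((1 - y) / 2) ^ i * ((1 + y) / 2) ^ k)
       (minus_half ^ i * plus_half ^ k)) \<le> n" for i k
  proof (cases "i + k \<le> n")
    case True
    have "degree (minus_half ^ i * plus_half ^ k) \<le> i + k"
      using degree_mult_le[of "minus_half ^ i" "plus_half ^ k"]
        degree_power_le[of minus_half i] degree_power_le[of plus_half k] by simp
    then show ?thesis using True order.trans[OF degree_smult_le] by fastforce
  qed (simp add: appell_coeff_eq_0)
  then show ?thesis unfolding appell_poly_def by (intro degree_sum_le) auto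
qed

text \<open>
  With \<open>A = (1 - y)/2\<close>, \<open>B = (1 + y)/2\<close> and \<open>X\<close>, \<open>Z\<close> the analogous functions of \<open>x\<close>, the two
  neighbour terms of the operator carry the weights \<open>A Z\<close> and \<open>B X\<close>. Their sum is
  \<open>1 - A X - B Z\<close>, and multiplication by \<open>A X\<close> or \<open>B Z\<close> is again an index shift. After the
  shifts every term has the same monomial, and the coefficients collapse to the eigenvalue
  because \<open>(\<alpha> + 1) + (\<beta> + 1) = -n + (n + \<alpha> + \<beta> + 1) + 1\<close>.
\<close>
lemma jacobi_eigen_appell_poly:
  assumes "\<alpha> > -1" "\<beta> > -1"
  shows "jacobi_eigen \<alpha> \<beta> n (appell_poly \<alpha> \<beta> n y)"
proof -
  define C where "C = appell_coeff \<alpha> \<beta> n"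
  define e where "e j = (real j - real n) * (real j + real n + \<alpha> + \<beta> + 1)" for j
  define A B where "A = (1 - y) / 2" and "B = (1 + y) / 2"
  have AB: "B = 1 - A" by (simp add: A_def B_def field_simps)
  have Ci: "C (Suc i) k * (real (Suc i) * (real (Suc i) + \<alpha>)) = C i k * e (i + k)" for i k
    unfolding C_def e_def using assms by (intro appell_coeff_Suc)
  have Ck: "C i (Suc k) * (real (Suc k) * (real (Suc k) + \<beta>)) = C i k * e (i + k)" for i k
    using appell_coeff_Suc[OF assms(2), of \<alpha> n k i]
    by (simp add: C_def e_def appell_coeff_commute[of \<alpha> \<beta>] add_ac)
  have C0: "C (Suc n) k = 0" "C k (Suc n) = 0" for k by (auto simp: C_def appell_coeff_eq_0)
  have "poly (jacobi_op \<alpha> \<beta> (appell_poly \<alpha> \<beta> n y)) x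
     = poly (smult (- (real n * (real n + \<alpha> + \<beta> + 1))) (appell_poly \<alpha> \<beta> n y)) x" for x
  proof -
    define X where "X = poly minus_half x"
    define Z where "Z = poly plus_half x"
    have XZ: "Z = 1 - X" by (simp add: X_def Z_def field_simps)
    define g where "g i k = A ^ i * B ^ k * (X ^ i * Z ^ k)" for i k
    have gi: "A ^ Suc i * B ^ k * (X ^ (Suc i - 1) * Z ^ (k + 1)) = A * Z * g i k" for i k
      by (simp add: g_def)
    have gk: "A ^ i * B ^ Suc k * (X ^ (i + 1) * Z ^ (Suc k - 1)) = B * X * g i k" for i k
      by (simp add: g_def)
    have gi': "g (Suc i) k = A * X * g i k" for i k by (simp add: g_def)
    have gk': "g i (Suc k) = B * Z * g i k" for i k by (simp add: g_def)
    have "poly (jacobi_op \<alpha> \<beta> (appell_poly \<alpha> \<beta> n y)) x =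
      (\<Sum>i\<le>n. \<Sum>k\<le>n. C i k * A ^ i * B ^ k *
         (real i * (real i + \<alpha>) * (X ^ (i - 1) * Z ^ (k + 1))
          + real k * (real k + \<beta>) * (X ^ (i + 1) * Z ^ (k - 1))
          - (2 * real i * real k + (\<alpha> + 1) * real k + (\<beta> + 1) * real i) * (X ^ i * Z ^ k)))"
      unfolding appell_poly_def jacobi_op_sum jacobi_op_smult jacobi_op_half_powers poly_sum
        poly_smult poly_add poly_diff poly_mult poly_power X_def[symmetric] Z_def[symmetric]
        A_def[symmetric] B_def[symmetric] C_def[symmetric] by (rule refl)
    also have "\<dots> = (\<Sum>i\<le>n. \<Sum>k\<le>n. C i k * (real i * (real i + \<alpha>)) * (A ^ i * B ^ k * (X ^ (i - 1) * Z ^ (k + 1))))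
      + (\<Sum>i\<le>n. \<Sum>k\<le>n. C i k * (real k * (real k + \<beta>)) * (A ^ i * B ^ k * (X ^ (i + 1) * Z ^ (k - 1))))
      - (\<Sum>i\<le>n. \<Sum>k\<le>n. C i k * (2 * real i * real k + (\<alpha> + 1) * real k + (\<beta> + 1) * real i) * g i k)"
      unfolding sum.distrib[symmetric] sum_subtractf[symmetric]
      by (intro sum.cong refl) (simp add: g_def algebra_simps)
    also have "(\<Sum>i\<le>n. \<Sum>k\<le>n. C i k * (real i * (real i + \<alpha>)) * (A ^ i * B ^ k * (X ^ (i - 1) * Z ^ (k + 1))))
      = (\<Sum>i\<le>n. \<Sum>k\<le>n. C (Suc i) k * (real (Suc i) * (real (Suc i) + \<alpha>)) * (A ^ Suc i * B ^ k * (X ^ (Suc i - 1) * Z ^ (k + 1))))"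
      by (rule sum_shift_zero) (simp_all add: C0)
    also have "\<dots> = (\<Sum>i\<le>n. \<Sum>k\<le>n. C i k * e (i + k) * (A * Z * g i k))"
      unfolding Ci gi by (rule refl)
    also have "(\<Sum>i\<le>n. \<Sum>k\<le>n. C i k * (real k * (real k + \<beta>)) * (A ^ i * B ^ k * (X ^ (i + 1) * Z ^ (k - 1))))
      = (\<Sum>i\<le>n. \<Sum>k\<le>n. C i (Suc k) * (real (Suc k) * (real (Suc k) + \<beta>)) * (A ^ i * B ^ Suc k * (X ^ (i + 1) * Z ^ (Suc k - 1))))"
      by (rule sum.cong[OF refl], rule sum_shift_zero) (simp_all add: C0)
    also have "\<dots> = (\<Sum>i\<le>n. \<Sum>k\<le>n. C i k * e (i + k) * (B * X * g i k))"
      unfolding Ck gk by (rule refl)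
    also have "(\<Sum>i\<le>n. \<Sum>k\<le>n. C i k * e (i + k) * (A * Z * g i k))
        + (\<Sum>i\<le>n. \<Sum>k\<le>n. C i k * e (i + k) * (B * X * g i k))
       = (\<Sum>i\<le>n. \<Sum>k\<le>n. C i k * e (i + k) * g i k)
        - (\<Sum>i\<le>n. \<Sum>k\<le>n. C i k * e (i + k) * (A * X * g i k))
        - (\<Sum>i\<le>n. \<Sum>k\<le>n. C i k * e (i + k) * (B * Z * g i k))"
      unfolding sum.distrib[symmetric] sum_subtractf[symmetric]
      by (intro sum.cong refl) (simp add: AB XZ algebra_simps)
    also have "(\<Sum>i\<le>n. \<Sum>k\<le>n. C i k * e (i + k) * (A * X * g i k))
      = (\<Sum>i\<le>n. \<Sum>k\<le>n. C (Suc i) k * (real (Suc i) * (real (Suc i) + \<alpha>)) * g (Suc i) k)"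
      unfolding Ci gi' by (rule refl)
    also have "\<dots> = (\<Sum>i\<le>n. \<Sum>k\<le>n. C i k * (real i * (real i + \<alpha>)) * g i k)"
      by (rule sum_shift_zero[symmetric]) (simp_all add: C0)
    also have "(\<Sum>i\<le>n. \<Sum>k\<le>n. C i k * e (i + k) * (B * Z * g i k))
      = (\<Sum>i\<le>n. \<Sum>k\<le>n. C i (Suc k) * (real (Suc k) * (real (Suc k) + \<beta>)) * g i (Suc k))"
      unfolding Ck gk' by (rule refl)
    also have "\<dots> = (\<Sum>i\<le>n. \<Sum>k\<le>n. C i k * (real k * (real k + \<beta>)) * g i k)"
      by (rule sum.cong[OF refl], rule sum_shift_zero[symmetric]) (simp_all add: C0)
    also have "(\<Sum>i\<le>n. \<Sum>k\<le>n. C i k * e (i + k) * g i k)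
      - (\<Sum>i\<le>n. \<Sum>k\<le>n. C i k * (real i * (real i + \<alpha>)) * g i k)
      - (\<Sum>i\<le>n. \<Sum>k\<le>n. C i k * (real k * (real k + \<beta>)) * g i k)
      - (\<Sum>i\<le>n. \<Sum>k\<le>n. C i k * (2 * real i * real k + (\<alpha> + 1) * real k + (\<beta> + 1) * real i) * g i k)
      = (\<Sum>i\<le>n. \<Sum>k\<le>n. - (real n * (real n + \<alpha> + \<beta> + 1)) * (C i k * g i k))"
      unfolding sum_subtractf[symmetric]
      by (intro sum.cong refl) (simp add: e_def algebra_simps)
    also have "\<dots> = poly (smult (- (real n * (real n + \<alpha> + \<beta> + 1))) (appell_poly \<alpha> \<beta> n y)) x"
      unfolding appell_poly_def poly_smult poly_sum poly_mult poly_power X_def[symmetric] Z_def[symmetric]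
        A_def[symmetric] B_def[symmetric] C_def[symmetric] sum_distrib_left g_def
      by (simp add: mult_ac)
    finally show ?thesis .
  qed
  then show ?thesis
    using degree_appell_poly_le[of \<alpha> \<beta> n y]
    by (simp only: jacobi_eigen_def simp_thms poly_eq_poly_eq_iff[symmetric] fun_eq_iff)
qed

lemma jacobi_P_hypergeometric:
  assumes "\<alpha> > -1"
  shows "jacobi_P \<alpha> \<beta> n (- x) = pochhammer (\<alpha> + 1) n / fact n *
     (\<Sum>k\<le>n. pochhammer (- real n) k * pochhammer (real n + \<alpha> + \<beta> + 1) k
       / (fact k * pochhammer (\<alpha> + 1) k) * ((1 + x) / 2) ^ k)"
proof -
  have "real (n choose k) * pochhammer (real n + \<alpha> + \<beta> + 1) k
       * pochhammer (\<alpha> + real k + 1) (n - k) * ((- x - 1) / 2) ^ k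
     = pochhammer (\<alpha> + 1) n * (pochhammer (- real n) k * pochhammer (real n + \<alpha> + \<beta> + 1) k
       / (fact k * pochhammer (\<alpha> + 1) k) * ((1 + x) / 2) ^ k)" if "k \<le> n" for k
  proof -
    have "pochhammer (\<alpha> + 1) n = pochhammer (\<alpha> + 1) k * pochhammer (\<alpha> + real k + 1) (n - k)"
      using pochhammer_product[OF that, of "\<alpha> + 1"] by (simp add: add_ac)
    moreover have "pochhammer (\<alpha> + 1) k > 0" using assms by (intro pochhammer_pos) simp
    moreover have "real (n choose k) * (-1) ^ k = pochhammer (- real n) k / fact k"
    proof -
      have "real n gchoose k = (-1) ^ k * pochhammer (- real n) k / fact k"
        by (rule gbinomial_pochhammer)
      then show ?thesis by (simp add: binomial_gbinomial)
    qed
    moreover have "((- x - 1) / 2) ^ k = (-1) ^ k * ((1 + x) / 2) ^ k"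
      by (subst power_mult_distrib[symmetric], rule arg_cong[where f="\<lambda>z. z ^ k"]) (simp add: field_simps)
    ultimately show ?thesis
      by (simp add: field_simps)
  qed
  then show ?thesis
    by (simp add: jacobi_P_def sum_distrib_left)
qed

text \<open>
  The factorisation of \<open>F\<^sub>4\<close> due to Watson and Bailey, in the terminating case. As a
  function of \<open>x\<close> the left side solves the Jacobi equation, so it is a multiple of
  \<open>P\<^sub>n(x)\<close>. The multiple is found at \<open>x = 1\<close>, where only the terms with \<open>i = 0\<close>
  survive and form the hypergeometric expansion of \<open>P\<^sub>n(y)\<close> at the other endpoint.
\<close>
theorem appell_product:
  assumes "\<alpha> > -1" "\<beta> > -1"
  shows "poly (appell_poly \<alpha> \<beta> n y) x = (-1) ^ n * (fact n)\<^sup>2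
     / (pochhammer (\<alpha> + 1) n * pochhammer (\<beta> + 1) n) * (jacobi_P \<alpha> \<beta> n x * jacobi_P \<alpha> \<beta> n y)"
proof -
  let ?F = "appell_poly \<alpha> \<beta> n y" and ?P = "jacobi_poly \<alpha> \<beta> n"
  have pa: "pochhammer (\<alpha> + 1) n > 0" and pb: "pochhammer (\<beta> + 1) n > 0"
    using assms by (auto intro!: pochhammer_pos)
  have nz: "coeff ?P n \<noteq> 0"
    using assms by (auto simp: coeff_jacobi_poly_top pochhammer_eq_0_iff)
  have proportional: "smult (coeff ?F n) ?P = smult (coeff ?P n) ?F"
    by (rule jacobi_eigen_proportional[OF jacobi_eigen_jacobi_poly jacobi_eigen_appell_poly[OF assms]])
       (use assms in auto)
  have ev: "coeff ?F n * jacobi_P \<alpha> \<beta> n z = coeff ?P n * poly ?F z" for z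
    using arg_cong[OF proportional, of "\<lambda>p. poly p z"] by (simp add: poly_jacobi_poly)
  have F1: "poly ?F 1 = (\<Sum>k\<le>n. appell_coeff \<alpha> \<beta> n 0 k * ((1 + y) / 2) ^ k)"
  proof -
    have "poly ?F 1 = (\<Sum>i\<le>n. \<Sum>k\<le>n. appell_coeff \<alpha> \<beta> n i k * ((1 - y) / 2) ^ i * ((1 + y) / 2) ^ k * 0 ^ i)"
      by (simp add: appell_poly_def poly_sum)
    also have "\<dots> = (\<Sum>i\<in>{0}. \<Sum>k\<le>n. appell_coeff \<alpha> \<beta> n i k * ((1 - y) / 2) ^ i * ((1 + y) / 2) ^ k * 0 ^ i)"
      by (rule sum.mono_neutral_right) (auto simp: power_0_left)
    finally show ?thesis by simp
  qed
  have "jacobi_P \<beta> \<alpha> n (- y) = pochhammer (\<beta> + 1) n / fact n * poly ?F 1"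
    unfolding F1 jacobi_P_hypergeometric[OF assms(2)]
    by (intro arg_cong2[where f="(*)"] refl sum.cong) (simp add: appell_coeff_def add_ac mult_ac)
  then have "poly ?F 1 = fact n / pochhammer (\<beta> + 1) n * ((-1) ^ n * jacobi_P \<alpha> \<beta> n y)"
    using pb by (simp add: jacobi_P_reflect assms field_simps)
  moreover have "jacobi_P \<alpha> \<beta> n 1 * (coeff ?P n * poly ?F x) = jacobi_P \<alpha> \<beta> n x * (coeff ?P n * poly ?F 1)"
    unfolding ev[symmetric] by simp
  ultimately show ?thesis
    using nz pa pb by (simp add: jacobi_P_one field_simps power2_eq_square)
qed

section \<open>The product formula for moment functionals\<close>

lemma pderiv_sum_poly: "pderiv (\<Sum>i\<in>I. f i) = (\<Sum>i\<in>I. pderiv (f i :: real poly))"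
  by (induction I rule: infinite_finite_induct) (simp_all add: pderiv_add)

lemma pderiv_jacobi_poly:
  "pderiv (jacobi_poly \<alpha> \<beta> (Suc n))
     = smult ((real n + \<alpha> + \<beta> + 2) / 2) (jacobi_poly (\<alpha> + 1) (\<beta> + 1) n)"
proof -
  define c where "c k = real (Suc n choose k) * pochhammer (real (Suc n) + \<alpha> + \<beta> + 1) k
       * pochhammer (\<alpha> + real k + 1) (Suc n - k) * (-1) ^ k" for k
  define d where "d k = real (n choose k) * pochhammer (real n + (\<alpha> + 1) + (\<beta> + 1) + 1) k
       * pochhammer ((\<alpha> + 1) + real k + 1) (n - k) * (-1) ^ k" for k
  have cd: "- (c (Suc k) * (real (Suc k) / 2)) = real (Suc n) * ((real n + \<alpha> + \<beta> + 2) / 2) * d k" for k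
  proof -
    have 1: "real (Suc n choose Suc k) * real (Suc k) = real (Suc n) * real (n choose k)"
      using Suc_times_binomial_eq[of n k] by (metis of_nat_mult)
    have 2: "pochhammer (real (Suc n) + \<alpha> + \<beta> + 1) (Suc k)
      = (real n + \<alpha> + \<beta> + 2) * pochhammer (real n + (\<alpha> + 1) + (\<beta> + 1) + 1) k"
      by (simp add: pochhammer_rec add_ac)
    have 3: "pochhammer (\<alpha> + real (Suc k) + 1) (Suc n - Suc k) = pochhammer ((\<alpha> + 1) + real k + 1) (n - k)"
      by (simp add: add_ac)
    have "- (c (Suc k) * (real (Suc k) / 2)) = (real (Suc n choose Suc k) * real (Suc k))
        * pochhammer (real (Suc n) + \<alpha> + \<beta> + 1) (Suc k)
        * pochhammer (\<alpha> + real (Suc k) + 1) (Suc n - Suc k) * (-1) ^ k / 2"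
      by (simp add: c_def)
    then show ?thesis unfolding 1 2 3 by (simp add: d_def)
  qed
  have dM: "pderiv (minus_half ^ k) = smult (- (real k / 2)) (minus_half ^ (k - 1))" for k
    using pderiv_half_powers[of k 0] by simp
  have "pderiv (\<Sum>k\<le>Suc n. smult (c k) (minus_half ^ k))
      = (\<Sum>k\<le>Suc n. smult (- (c k * (real k / 2))) (minus_half ^ (k - 1)))"
    unfolding pderiv_sum_poly pderiv_smult dM by simp
  also have "\<dots> = (\<Sum>k\<le>n. smult (- (c (Suc k) * (real (Suc k) / 2))) (minus_half ^ (Suc k - 1)))"
    by (subst sum.atMost_Suc_shift) simp
  also have "\<dots> = smult (real (Suc n) * ((real n + \<alpha> + \<beta> + 2) / 2)) (\<Sum>k\<le>n. smult (d k) (minus_half ^ k))"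
    unfolding cd by (simp only: smult_sum_right smult_smult diff_Suc_1)
  finally have H: "pderiv (\<Sum>k\<le>Suc n. smult (c k) (minus_half ^ k))
     = smult (real (Suc n) * ((real n + \<alpha> + \<beta> + 2) / 2)) (\<Sum>k\<le>n. smult (d k) (minus_half ^ k))" .
  have "1 / fact (Suc n) * (real (Suc n) * ((real n + \<alpha> + \<beta> + 2) / 2))
      = (real n + \<alpha> + \<beta> + 2) / 2 * (1 / fact n)"
    by (simp add: field_simps del: of_nat_Suc)
  then show ?thesis
    unfolding jacobi_poly_def pderiv_smult c_def[symmetric] d_def[symmetric] H smult_smult
    by (rule arg_cong)
qed

text \<open>
  The coefficient of \<open>z\<^sup>j\<close> in the hypergeometric polynomial with upper parameters \<open>-n\<close>,
  \<open>n + a + 1/2\<close> and lower parameter \<open>1/2\<close>.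
\<close>
definition even_coeff :: "real \<Rightarrow> nat \<Rightarrow> nat \<Rightarrow> real" where
  "even_coeff a n j = pochhammer (- real n) j * pochhammer (real n + a + 1/2) j
     / (pochhammer (1/2) j * fact j)"

lemma even_coeff_Suc:
  "4 * (real j + 1) * (real j + 1/2) * even_coeff a n (Suc j)
     = 4 * (real j - real n) * (real n + real j + a + 1/2) * even_coeff a n j"
proof -
  have "pochhammer (1/2 :: real) j > 0" by (intro pochhammer_pos) simp
  then show ?thesis
    by (simp add: even_coeff_def pochhammer_Suc divide_simps) (simp add: algebra_simps)
qed

text \<open>
  The quadratic transformation of ultraspherical polynomials of even degree. The right
  side satisfies the equation in the variable \<open>x\<close> by the ratio of consecutive coefficients;
  the constant is the quotient of the leading coefficients, simplified by the duplication formula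
  for rising factorials.
\<close>
lemma ultra_poly_even:
  assumes "a > -3/2"
  shows "jacobi_poly a a (2 * n) =
     smult ((-1) ^ n * pochhammer (real n + a + 1) n / (4 ^ n * fact n))
       (\<Sum>j\<le>n. monom (even_coeff a n j) (2 * j))"
proof -
  define E where "E = (\<Sum>j\<le>n. monom (even_coeff a n j) (2 * j))"
  have e0: "even_coeff a n j = 0" if "j > n" for j
    using that by (simp add: even_coeff_def pochhammer_of_nat_eq_0_lemma)
  have E_even: "coeff E (2 * j) = even_coeff a n j" for j
    by (cases "j \<le> n") (simp_all add: E_def coeff_sum coeff_monom e0)
  have E_odd: "coeff E (Suc (2 * j)) = 0" for j
    by (simp add: E_def coeff_sum coeff_monom) (intro sum.neutral, presburger)
  have deg: "degree E \<le> 2 * n"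
    unfolding E_def by (intro degree_sum_le) (auto intro: order.trans[OF degree_monom_le])
  have "coeff (jacobi_op a a E) m = - (real (2 * n) * (real (2 * n) + a + a + 1)) * coeff E m" for m
  proof (cases "even m")
    case True
    then obtain j where m: "m = 2 * j" by (elim evenE)
    have e: "coeff E (m + 2) = even_coeff a n (Suc j)" "coeff E m = even_coeff a n j"
      using E_even[of "Suc j"] E_even[of j] by (simp_all add: m)
    show ?thesis
      using even_coeff_Suc[of j a n] unfolding coeff_jacobi_op e by (simp add: m algebra_simps)
  next
    case False
    then obtain j where m: "m = Suc (2 * j)" by (elim oddE) simp
    show ?thesis using E_odd[of j] E_odd[of "Suc j"] by (simp add: coeff_jacobi_op m)
  qed
  then have eig: "jacobi_eigen a a (2 * n) E"
    using deg by (simp add: jacobi_eigen_def poly_eq_iff)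
  \<comment> \<open>The extreme case is \<open>n = 1\<close>, \<open>j = 0\<close>, with the value \<open>2a + 3\<close>.\<close>
  have nz: "real (2 * n) + real j + a + a + 1 \<noteq> 0" if "j < 2 * n" for j
    using that assms by (cases "n = 1") auto
  define Q where "Q = pochhammer (real n + a + 1/2) n"
  have "Q > 0"
    unfolding Q_def using assms by (cases n) (auto intro!: pochhammer_pos)
  have p: "pochhammer (1/2 :: real) n > 0" by (intro pochhammer_pos) simp
  have e: "even_coeff a n n = (-1) ^ n * Q / pochhammer (1/2) n"
    by (simp add: even_coeff_def pochhammer_same Q_def)
  have c: "coeff (jacobi_poly a a (2 * n)) (2 * n) =
    Q * pochhammer (real n + a + 1) n / (4 ^ n * fact n * pochhammer (1/2) n)"
  proof -
    have "pochhammer (real (2 * n) + a + a + 1) (2 * n) =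
        4 ^ n * pochhammer (real n + a + 1/2) n * pochhammer (real n + a + 1) n"
    proof -
      have "2 * (real n + a + 1/2) = real (2 * n) + a + a + 1" "real n + a + 1/2 + 1/2 = real n + a + 1"
        and "real (2 ^ (2 * n)) = 4 ^ n"
        by (simp_all add: power_mult)
      then show ?thesis using pochhammer_double[of "real n + a + 1/2" n] by metis
    qed
    then show ?thesis
      unfolding coeff_jacobi_poly_top fact_double Q_def by (simp add: power_mult)
  qed
  have "((-1) ^ n * pochhammer (real n + a + 1) n / (4 ^ n * fact n)) * even_coeff a n n
    = ((-1) ^ n * (-1) ^ n) * (Q * pochhammer (real n + a + 1) n / (4 ^ n * fact n * pochhammer (1/2) n))"
    unfolding e by (simp only: times_divide_eq_left times_divide_eq_right divide_divide_eq_left mult_ac)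
  also have "\<dots> = coeff (jacobi_poly a a (2 * n)) (2 * n)"
    by (simp add: c flip: power_add)
  finally have "coeff (jacobi_poly a a (2 * n)) (2 * n)
       = ((-1) ^ n * pochhammer (real n + a + 1) n / (4 ^ n * fact n)) * even_coeff a n n" ..
  moreover have "even_coeff a n n \<noteq> 0"
    using \<open>Q > 0\<close> p by (simp add: e)
  moreover have "smult (even_coeff a n n) (jacobi_poly a a (2 * n))
    = smult (coeff (jacobi_poly a a (2 * n)) (2 * n)) E"
    using jacobi_eigen_proportional[OF jacobi_eigen_jacobi_poly eig nz] E_even[of n] by simp
  ultimately have "smult (even_coeff a n n) (jacobi_poly a a (2 * n)) = smult (even_coeff a n n)
    (smult ((-1) ^ n * pochhammer (real n + a + 1) n / (4 ^ n * fact n)) E)"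
    by (simp only: smult_smult mult.commute)
  then show ?thesis
    using \<open>even_coeff a n n \<noteq> 0\<close> unfolding E_def by (metis smult_cancel)
qed

text \<open>
  If \<open>m1\<close> and \<open>m2\<close> are the moment sequences of two signed measures, this is the integral of
  \<open>(A u + B v)\<^sup>j\<close> with respect to their product.
\<close>
definition bimoment :: "(nat \<Rightarrow> real) \<Rightarrow> (nat \<Rightarrow> real) \<Rightarrow> real \<Rightarrow> real \<Rightarrow> nat \<Rightarrow> real" where
  "bimoment m1 m2 A B j = (\<Sum>i\<le>j. real (j choose i) * A ^ i * B ^ (j - i) * m1 i * m2 (j - i))"

definition poly_moment :: "(nat \<Rightarrow> real) \<Rightarrow> (nat \<Rightarrow> real) \<Rightarrow> real \<Rightarrow> real \<Rightarrow> real poly \<Rightarrow> real" where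
  "poly_moment m1 m2 A B p = (\<Sum>j\<le>degree p. coeff p j * bimoment m1 m2 A B j)"

lemma poly_moment_altdef:
  assumes "degree p \<le> N"
  shows "poly_moment m1 m2 A B p = (\<Sum>j\<le>N. coeff p j * bimoment m1 m2 A B j)"
  unfolding poly_moment_def
  by (rule sum.mono_neutral_left) (use assms in \<open>auto intro: coeff_eq_0\<close>)

lemma poly_moment_smult: "poly_moment m1 m2 A B (smult c p) = c * poly_moment m1 m2 A B p"
  using poly_moment_altdef[of "smult c p" "degree p"]
  by (simp add: poly_moment_def[of _ _ _ _ p] sum_distrib_left mult_ac)

lemma poly_moment_0 [simp]: "poly_moment m1 m2 A B 0 = 0"
  by (simp add: poly_moment_def)

lemma bimoment_commute: "bimoment m1 m2 A B j = bimoment m2 m1 B A j"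
  unfolding bimoment_def atMost_atLeast0
  by (subst sum.atLeastAtMost_rev)
     (intro sum.cong refl, auto simp: binomial_symmetric[symmetric] mult_ac)

lemma poly_moment_commute: "poly_moment m1 m2 A B p = poly_moment m2 m1 B A p"
  by (simp add: poly_moment_def bimoment_commute[of m1 m2])

lemma poly_moment_eq_0:
  assumes "\<And>i k. even (i + k) \<longleftrightarrow> b \<Longrightarrow> m1 i * m2 k = 0"
    and "\<And>j. (even j \<longleftrightarrow> \<not> b) \<Longrightarrow> coeff p j = 0"
  shows "poly_moment m1 m2 A B p = 0"
  unfolding poly_moment_def
proof (rule sum.neutral, rule ballI)
  fix j
  show "coeff p j * bimoment m1 m2 A B j = 0"
  proof (cases "even j \<longleftrightarrow> b")
    case True
    then have "bimoment m1 m2 A B j = 0"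
      unfolding bimoment_def
    proof (intro sum.neutral ballI)
      fix i assume "i \<in> {..j}"
      then have "m1 i * m2 (j - i) = 0" using assms(1)[of i "j - i"] True by simp
      then show "real (j choose i) * A ^ i * B ^ (j - i) * m1 i * m2 (j - i) = 0" by auto
    qed
    then show ?thesis by simp
  next
    case False
    then show ?thesis using assms(2)[of j] by auto
  qed
qed

text \<open>
  The moments of \<open>d\<Pi>\<^sub>\<alpha>\<close> when \<open>\<alpha> \<ge> -1/2\<close>; the formula is kept as the definition for all \<open>\<alpha> > -1\<close>.
\<close>
definition pi_moment :: "real \<Rightarrow> nat \<Rightarrow> real" where
  "pi_moment \<alpha> j = (if even j then pochhammer (1/2) (j div 2) / pochhammer (\<alpha> + 1) (j div 2) else 0)"

lemma sum_even:
  fixes f :: "nat \<Rightarrow> 'a::comm_monoid_add"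
  assumes "\<And>j. odd j \<Longrightarrow> f j = 0"
  shows "(\<Sum>m\<le>2 * n. f m) = (\<Sum>j\<le>n. f (2 * j))"
  by (induction n) (use assms in simp_all)

text \<open>
  From \<open>(2j)! = 4\<^sup>j (1/2)\<^sub>j j!\<close>. This is what makes the factor \<open>(1/2)\<^sub>j\<close> of the even
  moments cancel against the denominator of the quadratic transformation.
\<close>
lemma choose_double:
  assumes "i \<le> j"
  shows "real ((2 * j) choose (2 * i)) * pochhammer (1/2) i * pochhammer (1/2) (j - i)
    = real (j choose i) * pochhammer (1/2) j"
proof -
  have p: "pochhammer (1/2 :: real) k > 0" for k by (intro pochhammer_pos) simp
  have 1: "real ((2 * j) choose (2 * i)) = fact (2 * j) / (fact (2 * i) * fact (2 * (j - i)))"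
    using binomial_fact[of "2 * i" "2 * j", where 'a = real] assms by (simp add: diff_mult_distrib2)
  have 2: "real (j choose i) = fact j / (fact i * fact (j - i))"
    using binomial_fact[OF assms, where 'a = real] .
  have 3: "(2::real) ^ (2 * j) = 2 ^ (2 * i) * 2 ^ (2 * (j - i))"
    using assms by (simp add: power_add[symmetric] diff_mult_distrib2)
  show ?thesis
    using p[of i] p[of "j - i"]
    unfolding 1 2 fact_double[of j] fact_double[of i] fact_double[of "j - i"] 3
    by (simp add: divide_simps)
qed

lemma bimoment_pi_moment:
  "bimoment (pi_moment \<alpha>) (pi_moment \<beta>) A B (2 * j) = pochhammer (1/2) j *
     (\<Sum>i\<le>j. real (j choose i) * (A\<^sup>2) ^ i * (B\<^sup>2) ^ (j - i)
        / (pochhammer (\<alpha> + 1) i * pochhammer (\<beta> + 1) (j - i)))"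
proof -
  have "bimoment (pi_moment \<alpha>) (pi_moment \<beta>) A B (2 * j) = (\<Sum>i\<le>j. real ((2 * j) choose (2 * i))
      * A ^ (2 * i) * B ^ (2 * j - 2 * i) * pi_moment \<alpha> (2 * i) * pi_moment \<beta> (2 * j - 2 * i))"
    unfolding bimoment_def by (rule sum_even) (simp add: pi_moment_def)
  also have "\<dots> = (\<Sum>i\<le>j. (real ((2 * j) choose (2 * i)) * pochhammer (1/2) i * pochhammer (1/2) (j - i))
      * (A\<^sup>2) ^ i * (B\<^sup>2) ^ (j - i) / (pochhammer (\<alpha> + 1) i * pochhammer (\<beta> + 1) (j - i)))"
    unfolding diff_mult_distrib2[symmetric] by (simp add: pi_moment_def power_mult[symmetric] mult_ac)
  also have "\<dots> = (\<Sum>i\<le>j. (real (j choose i) * pochhammer (1/2) j)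
      * (A\<^sup>2) ^ i * (B\<^sup>2) ^ (j - i) / (pochhammer (\<alpha> + 1) i * pochhammer (\<beta> + 1) (j - i)))"
    by (intro sum.cong refl) (simp only: choose_double atMost_iff)
  finally show ?thesis by (simp add: sum_distrib_left mult_ac)
qed

text \<open>
  Taking moments in the quadratic transformation gives the Appell polynomial, and that is a
  product. The hypotheses on \<open>A\<close> and \<open>B\<close> are those satisfied by
  \<open>sin (\<theta>/2) sin (\<phi>/2)\<close> and \<open>cos (\<theta>/2) cos (\<phi>/2)\<close>.
\<close>
theorem jacobi_product_formula:
  assumes "\<alpha> > -1" "\<beta> > -1"
    and A: "A\<^sup>2 = (1 - x) / 2 * ((1 - y) / 2)" and B: "B\<^sup>2 = (1 + x) / 2 * ((1 + y) / 2)"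
  shows "poly_moment (pi_moment \<alpha>) (pi_moment \<beta>) A B (jacobi_poly (\<alpha> + \<beta> + 1/2) (\<alpha> + \<beta> + 1/2) (2 * n))
    = pochhammer (real n + \<alpha> + \<beta> + 3/2) n * fact n
      / (4 ^ n * pochhammer (\<alpha> + 1) n * pochhammer (\<beta> + 1) n)
      * (jacobi_P \<alpha> \<beta> n x * jacobi_P \<alpha> \<beta> n y)"
proof -
  let ?a = "\<alpha> + \<beta> + 1/2"
  define E where "E = (\<Sum>j\<le>n. monom (even_coeff ?a n j) (2 * j))"
  have deg: "degree E \<le> 2 * n"
    unfolding E_def by (intro degree_sum_le) (auto intro: order.trans[OF degree_monom_le])
  have E_even: "coeff E (2 * j) = even_coeff ?a n j" if "j \<le> n" for j
    using that by (simp add: E_def coeff_sum coeff_monom)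
  have E_odd: "coeff E j = 0" if "odd j" for j
    using that by (simp add: E_def coeff_sum coeff_monom) (intro sum.neutral, auto)
  define h where "h i k = appell_coeff \<alpha> \<beta> n i k * (A\<^sup>2) ^ i * (B\<^sup>2) ^ k" for i k
  have "poly_moment (pi_moment \<alpha>) (pi_moment \<beta>) A B E
      = (\<Sum>j\<le>n. coeff E (2 * j) * bimoment (pi_moment \<alpha>) (pi_moment \<beta>) A B (2 * j))"
    unfolding poly_moment_altdef[OF deg] by (rule sum_even) (simp add: E_odd)
  also have "\<dots> = (\<Sum>j\<le>n. \<Sum>i\<le>j. h i (j - i))"
  proof (intro sum.cong refl)
    fix j assume "j \<in> {..n}"
    then have jn: "j \<le> n" by simp
    have p: "pochhammer (1/2 :: real) j > 0" by (intro pochhammer_pos) simp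
    have "real (j choose i) = fact j / (fact i * fact (j - i))" if "i \<le> j" for i
      using binomial_fact[OF that, where 'a = real] .
    moreover have ar: "real n + ?a + 1/2 = real n + \<alpha> + \<beta> + 1" by simp
    ultimately have "even_coeff ?a n j * pochhammer (1/2) j * real (j choose i)
        / (pochhammer (\<alpha> + 1) i * pochhammer (\<beta> + 1) (j - i)) = appell_coeff \<alpha> \<beta> n i (j - i)" if "i \<le> j" for i
      using that p unfolding even_coeff_def appell_coeff_def ar by (simp add: divide_simps)
    then have "h i (j - i) = even_coeff ?a n j * pochhammer (1/2) j * real (j choose i)
        / (pochhammer (\<alpha> + 1) i * pochhammer (\<beta> + 1) (j - i)) * (A\<^sup>2) ^ i * (B\<^sup>2) ^ (j - i)" if "i \<le> j" for i
      using that by (simp only: h_def)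
    then show "coeff E (2 * j) * bimoment (pi_moment \<alpha>) (pi_moment \<beta>) A B (2 * j) = (\<Sum>i\<le>j. h i (j - i))"
      unfolding E_even[OF jn] bimoment_pi_moment by (simp add: sum_distrib_left mult_ac)
  qed
  also have "\<dots> = (\<Sum>(i, k)\<in>{(i, k). i + k \<le> n}. h i k)"
    by (rule sum.triangle_reindex_eq[symmetric])
  also have "\<dots> = (\<Sum>(i, k)\<in>{..n} \<times> {..n}. h i k)"
  proof (rule sum.mono_neutral_left)
    have "h i k = 0" if "\<not> i + k \<le> n" for i k using that by (simp add: h_def appell_coeff_eq_0)
    then show "\<forall>z\<in>{..n} \<times> {..n} - {(i, k). i + k \<le> n}. (case z of (i, k) \<Rightarrow> h i k) = 0" by auto
  qed auto
  also have "\<dots> = (\<Sum>i\<le>n. \<Sum>k\<le>n. h i k)"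
    by (rule sum.cartesian_product[symmetric])
  also have "\<dots> = poly (appell_poly \<alpha> \<beta> n y) x"
  proof -
    have X: "poly minus_half x = (1 - x) / 2" "poly plus_half x = (1 + x) / 2"
      by (simp_all add: field_simps)
    have AB: "(A\<^sup>2) ^ i = ((1 - x) / 2) ^ i * ((1 - y) / 2) ^ i"
      "(B\<^sup>2) ^ i = ((1 + x) / 2) ^ i * ((1 + y) / 2) ^ i" for i
      unfolding A B by (rule power_mult_distrib)+
    show ?thesis
      unfolding appell_poly_def poly_sum poly_smult poly_mult poly_power X h_def AB
      by (simp only: mult_ac)
  qed
  also have "\<dots> = (-1) ^ n * (fact n)\<^sup>2
     / (pochhammer (\<alpha> + 1) n * pochhammer (\<beta> + 1) n) * (jacobi_P \<alpha> \<beta> n x * jacobi_P \<alpha> \<beta> n y)"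
    by (rule appell_product[OF assms(1,2)])
  finally have *: "poly_moment (pi_moment \<alpha>) (pi_moment \<beta>) A B E = (-1) ^ n * (fact n)\<^sup>2
     / (pochhammer (\<alpha> + 1) n * pochhammer (\<beta> + 1) n) * (jacobi_P \<alpha> \<beta> n x * jacobi_P \<alpha> \<beta> n y)" .
  have J: "jacobi_poly ?a ?a (2 * n) = smult ((-1) ^ n * pochhammer (real n + ?a + 1) n / (4 ^ n * fact n)) E"
    unfolding E_def by (rule ultra_poly_even) (use assms in simp)
  have sg: "(-1) ^ n * ((-1) ^ n :: real) = 1" by (simp flip: power_add)
  have "poly_moment (pi_moment \<alpha>) (pi_moment \<beta>) A B (jacobi_poly ?a ?a (2 * n))
     = ((-1) ^ n * (-1) ^ n) * pochhammer (real n + ?a + 1) n / (4 ^ n * fact n) * (fact n)\<^sup>2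
     / (pochhammer (\<alpha> + 1) n * pochhammer (\<beta> + 1) n) * (jacobi_P \<alpha> \<beta> n x * jacobi_P \<alpha> \<beta> n y)"
    unfolding J poly_moment_smult * by simp
  then show ?thesis unfolding sg by (simp add: power2_eq_square add_ac)
qed

lemma poly_moment_diff_right:
  "poly_moment m1 (\<lambda>j. m2 j - m3 j) A B p = poly_moment m1 m2 A B p - poly_moment m1 m3 A B p"
proof -
  have "bimoment m1 (\<lambda>j. m2 j - m3 j) A B j = bimoment m1 m2 A B j - bimoment m1 m3 A B j" for j
    by (simp add: bimoment_def sum_subtractf[symmetric] right_diff_distrib)
  then show ?thesis by (simp add: poly_moment_def sum_subtractf right_diff_distrib)
qed

text \<open>
  If \<open>k\<close> is the moment sequence of \<open>\<nu>\<close>, then \<open>j k(j - 1)\<close> is that of the functional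
  \<open>f \<mapsto> \<integral> f' d\<nu>\<close>; the factor \<open>B\<close> is the inner derivative of \<open>p(A u + B v)\<close> in \<open>v\<close>.
\<close>
lemma poly_moment_pderiv_right:
  "poly_moment m1 (\<lambda>j. real j * k (j - 1)) A B p = B * poly_moment m1 k A B (pderiv p)"
proof -
  let ?D = "\<lambda>j. real j * k (j - 1)"
  have bi: "bimoment m1 ?D A B (Suc j) = B * real (Suc j) * bimoment m1 k A B j" for j
  proof -
    have "bimoment m1 ?D A B (Suc j) = (\<Sum>i\<le>j. real (Suc j choose i) * A ^ i * B ^ (Suc j - i) * m1 i * ?D (Suc j - i))"
      by (simp add: bimoment_def)
    also have "\<dots> = (\<Sum>i\<le>j. B * real (Suc j) * (real (j choose i) * A ^ i * B ^ (j - i) * m1 i * k (j - i)))"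
    proof (intro sum.cong refl)
      fix i assume "i \<in> {..j}"
      then have ij: "i \<le> j" by simp
      then have "(Suc j choose i) * (Suc j - i) = Suc j * (j choose i)"
        using binomial_absorb_comp[of "Suc j" i] by (simp add: mult.commute)
      then have "real (Suc j choose i) * real (Suc j - i) = real (Suc j) * real (j choose i)"
        by (metis of_nat_mult)
      then have "real (Suc j choose i) * real (Suc j - i) * (A ^ i * B ^ Suc (j - i) * m1 i * k (j - i))
         = real (Suc j) * real (j choose i) * (A ^ i * B ^ Suc (j - i) * m1 i * k (j - i))" by simp
      then show "real (Suc j choose i) * A ^ i * B ^ (Suc j - i) * m1 i * ?D (Suc j - i)
         = B * real (Suc j) * (real (j choose i) * A ^ i * B ^ (j - i) * m1 i * k (j - i))"
        using ij by (simp add: Suc_diff_le mult_ac del: of_nat_Suc)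
    qed
    finally show ?thesis by (simp only: bimoment_def sum_distrib_left)
  qed
  have d: "degree (pderiv p) \<le> degree p" by (simp add: degree_pderiv)
  have "poly_moment m1 ?D A B p = (\<Sum>j\<le>Suc (degree p). coeff p j * bimoment m1 ?D A B j)"
    by (rule poly_moment_altdef) simp
  also have "\<dots> = (\<Sum>j\<le>degree p. coeff p (Suc j) * bimoment m1 ?D A B (Suc j))"
    by (subst sum.atMost_Suc_shift) (simp add: bimoment_def)
  also have "\<dots> = B * poly_moment m1 k A B (pderiv p)"
    unfolding poly_moment_altdef[OF d] bi coeff_pderiv sum_distrib_left by (simp add: mult_ac)
  finally show ?thesis .
qed

lemma poly_moment_split_right:
  assumes "\<And>j. m2 j = d j - real j * k (j - 1)"
  shows "poly_moment m1 m2 A B p = poly_moment m1 d A B p - B * poly_moment m1 k A B (pderiv p)"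
proof -
  have "m2 = (\<lambda>j. d j - real j * k (j - 1))" using assms by blast
  then show ?thesis by (simp only: poly_moment_diff_right poly_moment_pderiv_right)
qed

lemma poly_moment_split_left:
  assumes "\<And>j. m1 j = d j - real j * k (j - 1)"
  shows "poly_moment m1 m2 A B p = poly_moment d m2 A B p - A * poly_moment k m2 A B (pderiv p)"
  using poly_moment_split_right[of m1 d k m2 B A p] assms
  by (simp add: poly_moment_commute[of _ m2])

section \<open>Normalising constants\<close>

lemma Gamma_add_one: "(z::real) > 0 \<Longrightarrow> Gamma (z + 1) = z * Gamma z"
  by (rule Gamma_plus1) (auto dest: nonpos_Ints_nonpos)

lemma pochhammer_Gamma_real: "(z::real) > 0 \<Longrightarrow> pochhammer z n = Gamma (real n + z) / Gamma z"
  using pochhammer_Gamma[of z n] nonpos_Ints_nonpos[of z] by (force simp: add.commute)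

lemma two_powr_step: "2 powr (2 * (a + 1) + 1) = 4 * 2 powr (2 * a + 1 :: real)"
proof -
  have "2 * (a + 1) + 1 = (2 * a + 1) + 2" by simp
  then have "2 powr (2 * (a + 1) + 1) = 2 powr (2 * a + 1) * 2 powr (2 :: real)"
    by (simp only: powr_add)
  then show ?thesis by simp
qed

text \<open>
  Legendre's duplication formula, transferred from the complex Gamma function.
\<close>
lemma Gamma_duplication_real:
  fixes z :: real
  assumes "z > 0"
  shows "2 powr (2 * z - 1) * (Gamma z * Gamma (z + 1/2)) = sqrt pi * Gamma (2 * z)"
proof -
  have "complex_of_real (Gamma z * Gamma (z + 1/2)) = Gamma (complex_of_real z) * Gamma (complex_of_real z + 1/2)"
    by (simp flip: Gamma_complex_of_real)
  also have "\<dots> = exp ((1 - 2 * complex_of_real z) * of_real (ln 2)) * of_real (sqrt pi) * Gamma (2 * complex_of_real z)"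
  proof (rule Gamma_legendre_duplication)
    show "complex_of_real z \<notin> \<int>\<^sub>\<le>\<^sub>0" using assms by (auto simp: of_real_in_nonpos_Ints_iff dest: nonpos_Ints_nonpos)
    have "complex_of_real (z + 1/2) \<notin> \<int>\<^sub>\<le>\<^sub>0"
      using assms unfolding of_real_in_nonpos_Ints_iff by (auto dest: nonpos_Ints_nonpos)
    then show "complex_of_real z + 1/2 \<notin> \<int>\<^sub>\<le>\<^sub>0" by simp
  qed
  also have "\<dots> = complex_of_real (exp ((1 - 2 * z) * ln 2) * sqrt pi * Gamma (2 * z))"
  proof -
    have "exp ((1 - 2 * complex_of_real z) * of_real (ln 2)) = complex_of_real (exp ((1 - 2 * z) * ln 2))"
      by (simp flip: exp_of_real)
    then show ?thesis by (simp flip: Gamma_complex_of_real)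
  qed
  finally have "Gamma z * Gamma (z + 1/2) = exp ((1 - 2 * z) * ln 2) * sqrt pi * Gamma (2 * z)"
    by (simp only: of_real_eq_iff)
  moreover have "2 powr (2 * z - 1) * exp ((1 - 2 * z) * ln 2) = 1"
    by (simp add: powr_def flip: exp_add) (simp add: algebra_simps)
  ultimately show ?thesis by (metis mult.assoc mult.left_neutral)
qed

text \<open>
  The coefficient of \<open>P\<^sub>m\<close> in the series of \<open>G(\<cdot>, 1)\<close>, without its exponential factor.
\<close>
definition heat_coeff :: "real \<Rightarrow> nat \<Rightarrow> real" where
  "heat_coeff a m = ultra_P a m 1 / ultra_h a m"

text \<open>
  For \<open>m = 0\<close> this rests on \<open>\<Gamma>(2a + 2) = (2a + 1) \<Gamma>(2a + 1)\<close>, which is where \<open>a > -1/2\<close> enters.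
\<close>
lemma heat_coeff_eq:
  assumes "a > -1" "m > 0 \<or> a > -1/2"
  shows "heat_coeff a m = (2 * real m + 2 * a + 1) * Gamma (real m + 2 * a + 1)
     / (2 powr (2 * a + 1) * Gamma (a + 1) * Gamma (real m + a + 1))"
proof -
  have G: "Gamma (a + 1) > 0" "Gamma (real m + a + 1) > 0"
    using assms by (auto intro!: Gamma_real_pos)
  have p: "pochhammer (a + 1) m = Gamma (real m + a + 1) / Gamma (a + 1)"
    using pochhammer_Gamma_real[of "a + 1" m] assms by (simp add: add_ac)
  have f: "Gamma (real m + 1) = fact m" using Gamma_fact[of m, where 'a = real] by (simp add: add.commute)
  have d: "(if m = 0 then Gamma (a + a + 2) else (2 * real m + a + a + 1) * Gamma (real m + a + a + 1))
      = (2 * real m + 2 * a + 1) * Gamma (real m + 2 * a + 1)"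
    using Gamma_add_one[of "2 * a + 1"] assms by (auto simp: algebra_simps)
  have s: "a + a + 1 = 2 * a + 1" by simp
  show ?thesis
    unfolding heat_coeff_def jacobi_P_one jacobi_h_def p f d s
    using G by (simp add: divide_simps)
qed

text \<open>
  The link between \<open>G\<^sup>a(\<cdot>, 1)\<close> and \<open>H\<^sup>a\<close>: the even part of the former is \<open>a + 1\<close> times the latter.
\<close>
lemma heat_coeff_even:
  assumes "a > -1"
  shows "heat_coeff a (2 * n) = (a + 1) * coeff_D a n"
proof -
  have G: "Gamma (a + 1) > 0" "Gamma (a + 3/2) > 0" "Gamma (2 * a + 2) > 0"
    using assms by (auto intro!: Gamma_real_pos)
  have G2: "Gamma (a + 2) = (a + 1) * Gamma (a + 1)"
    using Gamma_add_one[of "a + 1"] assms by (simp add: add_ac)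
  show ?thesis
  proof (cases "n = 0")
    case True
    have "2 powr (2 * a + 1) * (Gamma (a + 1) * Gamma (a + 3/2)) = sqrt pi * Gamma (2 * a + 2)"
      using Gamma_duplication_real[of "a + 1"] assms by (simp add: algebra_simps)
    then have k: "Gamma (2 * a + 2) = 2 powr (2 * a + 1) * (Gamma (a + 1) * Gamma (a + 3/2)) / sqrt pi"
      by (simp add: divide_simps mult_ac)
    have s: "a + a + 1 = 2 * a + 1" "a + a + 2 = 2 * a + 2" by simp_all
    have "heat_coeff a 0 = Gamma (2 * a + 2) / (2 powr (2 * a + 1) * Gamma (a + 1) * Gamma (a + 1))"
      unfolding s[symmetric] by (simp add: heat_coeff_def jacobi_P_one jacobi_h_def)
    also have "\<dots> = Gamma (a + 3/2) / (sqrt pi * Gamma (a + 1))"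
      unfolding k using G by simp
    finally show ?thesis
      using True assms by (simp add: coeff_D_def G2)
  next
    case False
    show ?thesis
      unfolding coeff_D_def G2 using assms False
      by (subst heat_coeff_eq) (auto simp: divide_simps)
  qed
qed

text \<open>
  Together with the derivative formula for Jacobi polynomials: differentiating the
  term \<open>D\<^sub>2\<^sub>n\<^sub>+\<^sub>2 P\<^sub>2\<^sub>n\<^sub>+\<^sub>2\<close> gives twice the corresponding term of \<open>G\<^sup>a\<^sup>+\<^sup>1(\<cdot>, 1)\<close>, without a singular
  factor at \<open>a = -1\<close>.
\<close>
lemma coeff_D_odd:
  assumes "a > -3/2"
  shows "coeff_D a (Suc n) * ((real (2 * n + 1) + 2 * a + 2) / 2) = 2 * heat_coeff (a + 1) (2 * n + 1)"
proof -
  let ?m = "real (2 * n + 1)"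
  have s: "2 * real (Suc n) + 2 * a + 1 = ?m + 2 * a + 2"
    "4 * real (Suc n) + 2 * a + 1 = 2 * ?m + 2 * (a + 1) + 1"
    "2 * real (Suc n) + a + 1 = ?m + (a + 1) + 1"
    "a + 2 = a + 1 + 1"
    by simp_all
  have G: "Gamma (?m + 2 * (a + 1) + 1) = (?m + 2 * a + 2) * Gamma (?m + 2 * a + 2)"
    using Gamma_add_one[of "?m + 2 * a + 2"] assms by (simp add: add_ac)
  have 1: "coeff_D a (Suc n) = (2 * ?m + 2 * (a + 1) + 1) * Gamma (?m + 2 * a + 2)
      / (2 powr (2 * a + 1) * Gamma (a + 1 + 1) * Gamma (?m + (a + 1) + 1))"
    unfolding coeff_D_def s by simp
  have 2: "heat_coeff (a + 1) (2 * n + 1) = (2 * ?m + 2 * (a + 1) + 1) * ((?m + 2 * a + 2) * Gamma (?m + 2 * a + 2))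
      / (4 * 2 powr (2 * a + 1) * Gamma (a + 1 + 1) * Gamma (?m + (a + 1) + 1))"
    using assms heat_coeff_eq[of "a + 1" "2 * n + 1"] unfolding G two_powr_step by simp
  show ?thesis unfolding 1 2 by (simp add: mult_ac del: of_nat_Suc of_nat_add of_nat_mult)
qed

lemma heat_coeff_Suc:
  assumes "a > -1"
  shows "heat_coeff a (Suc m) * ((real m + 2 * a + 2) / 2) = 2 * (a + 1) * heat_coeff (a + 1) m"
proof -
  have s: "real (Suc m) + 2 * a + 1 = real m + 2 * a + 2"
    "2 * real (Suc m) + 2 * a + 1 = 2 * real m + 2 * (a + 1) + 1"
    "real m + 2 * (a + 1) + 1 = real m + 2 * a + 2 + 1"
    "real (Suc m) + a + 1 = real m + (a + 1) + 1"
    by simp_all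
  have G: "Gamma (real m + 2 * a + 2 + 1) = (real m + 2 * a + 2) * Gamma (real m + 2 * a + 2)"
    "Gamma (a + 1 + 1) = (a + 1) * Gamma (a + 1)"
    using Gamma_add_one[of "real m + 2 * a + 2"] Gamma_add_one[of "a + 1"] assms by simp_all
  have "2 powr (2 * (a + 1) + 1) = 4 * 2 powr (2 * a + 1)"
    by (rule two_powr_step)
  note P = this
  have cancel: "2 * c * (x / (4 * p * (c * g) * h)) = x / (2 * p * g * h)" if "c \<noteq> 0" for c x p g h :: real
    using that by simp
  have 1: "heat_coeff a (Suc m) = (2 * real m + 2 * (a + 1) + 1) * Gamma (real m + 2 * a + 2)
      / (2 powr (2 * a + 1) * Gamma (a + 1) * Gamma (real m + (a + 1) + 1))"
    using assms heat_coeff_eq[of a "Suc m"] unfolding s by simp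
  have 2: "heat_coeff (a + 1) m = (2 * real m + 2 * (a + 1) + 1) * ((real m + 2 * a + 2) * Gamma (real m + 2 * a + 2))
      / (4 * 2 powr (2 * a + 1) * ((a + 1) * Gamma (a + 1)) * Gamma (real m + (a + 1) + 1))"
    using assms heat_coeff_eq[of "a + 1" m] unfolding s G P by simp
  show ?thesis
    unfolding 2 by (subst cancel) (use assms in \<open>simp_all add: 1 mult_ac\<close>)
qed

text \<open>
  The right side is \<open>D\<^sub>2\<^sub>n\<close> times the constant of the product formula. The Gamma factors
  with argument \<open>2n + \<dots>\<close> cancel through the duplication formula. The case \<open>n = 0\<close> is separate, since there
  \<open>\<alpha> + \<beta> = -1\<close> would be singular in the generic formula.
\<close>
lemma jacobi_h_ratio:
  assumes "\<alpha> > -1" "\<beta> > -1"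
  shows "jacobi_h \<alpha> \<beta> 0 * const_C0 \<alpha> \<beta> / jacobi_h \<alpha> \<beta> n = coeff_D (\<alpha> + \<beta> + 1/2) n *
    (pochhammer (real n + \<alpha> + \<beta> + 3/2) n * fact n
      / (4 ^ n * pochhammer (\<alpha> + 1) n * pochhammer (\<beta> + 1) n))"
proof (cases "n = 0")
  case True
  have "jacobi_h \<alpha> \<beta> 0 > 0"
    using assms unfolding jacobi_h_def by (intro divide_pos_pos mult_pos_pos) (auto intro!: Gamma_real_pos)
  then show ?thesis by (simp add: True coeff_D_def const_C0_def add_ac)
next
  case False
  define s where "s = \<alpha> + \<beta>"
  have s: "s > -2" "real n \<ge> 1" using assms False by (simp_all add: s_def)
  have G: "Gamma (\<alpha> + 1) > 0" "Gamma (\<beta> + 1) > 0" "Gamma (s + 2) > 0"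
     "Gamma (real n + \<alpha> + 1) > 0" "Gamma (real n + \<beta> + 1) > 0" "Gamma (real n + s + 1) > 0"
     "Gamma (real n + s + 3/2) > 0" "pochhammer (real n + s + 3/2) n > 0" "2 * real n + s + 1 > 0"
    using assms s by (auto intro!: Gamma_real_pos pochhammer_pos)
  have f: "Gamma (real n + 1) = fact n" using Gamma_fact[of n, where 'a = real] by (simp add: add.commute)
  have h0: "jacobi_h \<alpha> \<beta> 0 = 2 powr (s + 1) * Gamma (\<alpha> + 1) * Gamma (\<beta> + 1) / Gamma (s + 2)"
    by (simp add: jacobi_h_def s_def)
  have hn: "jacobi_h \<alpha> \<beta> n = 2 powr (s + 1) * Gamma (real n + \<alpha> + 1) * Gamma (real n + \<beta> + 1)
      / ((2 * real n + s + 1) * Gamma (real n + s + 1) * fact n)"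
    using False f by (simp add: jacobi_h_def s_def add_ac)
  have pa: "pochhammer (\<alpha> + 1) n = Gamma (real n + \<alpha> + 1) / Gamma (\<alpha> + 1)"
    using pochhammer_Gamma_real[of "\<alpha> + 1" n] assms by (simp add: add_ac)
  have pb: "pochhammer (\<beta> + 1) n = Gamma (real n + \<beta> + 1) / Gamma (\<beta> + 1)"
    using pochhammer_Gamma_real[of "\<beta> + 1" n] assms by (simp add: add_ac)
  have g: "Gamma (2 * real n + s + 3/2) = pochhammer (real n + s + 3/2) n * Gamma (real n + s + 3/2)"
  proof -
    have "real n + (real n + s + 3/2) = 2 * real n + s + 3/2" by simp
    moreover have "Gamma (real n + s + 3/2) \<noteq> 0" using G by simp
    ultimately show ?thesis
      using pochhammer_Gamma_real[of "real n + s + 3/2" n] s by (simp only: nonzero_eq_divide_eq) simp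
  qed
  have dup: "Gamma (2 * real n + 2 * s + 2)
     = 4 ^ n * 2 powr (2 * s + 1) * (Gamma (real n + s + 1) * Gamma (real n + s + 3/2)) / sqrt pi"
  proof -
    have "2 powr (2 * (real n + s + 1) - 1) = 2 powr (2 * real n) * 2 powr (2 * s + 1)"
      by (simp flip: powr_add add: algebra_simps)
    also have "2 powr (2 * real n) = (4 :: real) ^ n"
    proof -
      have "2 powr (2 * real n) = (2 powr 2) powr real n" by (rule powr_powr[symmetric])
      then show ?thesis by (simp add: powr_realpow)
    qed
    finally show ?thesis
      using Gamma_duplication_real[of "real n + s + 1"] s by (simp add: field_simps)
  qed
  have D: "coeff_D (\<alpha> + \<beta> + 1/2) n = 2 * (2 * real n + s + 1) * Gamma (2 * real n + 2 * s + 2)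
     / (2 powr (2 * s + 2) * Gamma (s + 5/2) * Gamma (2 * real n + s + 3/2))"
  proof -
    have e: "4 * real n + 2 * (\<alpha> + \<beta> + 1/2) + 1 = 2 * (2 * real n + s + 1)"
      "2 * real n + 2 * (\<alpha> + \<beta> + 1/2) + 1 = 2 * real n + 2 * s + 2"
      "2 * (\<alpha> + \<beta> + 1/2) + 1 = 2 * s + 2" "\<alpha> + \<beta> + 1/2 + 2 = s + 5/2"
      "2 * real n + (\<alpha> + \<beta> + 1/2) + 1 = 2 * real n + s + 3/2"
      by (simp_all add: s_def)
    show ?thesis using False unfolding coeff_D_def e by simp
  qed
  have w: "2 powr (2 * s + 2) = 2 * 2 powr (2 * s + 1)"
  proof -
    have "2 * s + 2 = (2 * s + 1) + 1" by simp
    then have "2 powr (2 * s + 2) = 2 powr (2 * s + 1) * 2 powr (1 :: real)"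
      by (simp only: powr_add)
    then show ?thesis by simp
  qed
  have C: "const_C0 \<alpha> \<beta> = Gamma (s + 2) / (sqrt pi * Gamma (s + 5/2))"
    by (simp add: const_C0_def s_def)
  have ps: "real n + \<alpha> + \<beta> + 3/2 = real n + s + 3/2" by (simp add: s_def)
  show ?thesis
    unfolding h0 hn pa pb D g dup w C ps
    using G by (simp add: divide_simps)
qed

lemma inverse_ultra_h_0:
  assumes "\<alpha> + \<beta> + 1/2 > -1"
  shows "1 / ultra_h (\<alpha> + \<beta> + 1/2) 0 = (\<alpha> + \<beta> + 3/2) * const_C0 \<alpha> \<beta>"
proof -
  have "heat_coeff (\<alpha> + \<beta> + 1/2) (2 * 0) = (\<alpha> + \<beta> + 1/2 + 1) * coeff_D (\<alpha> + \<beta> + 1/2) 0"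
    using assms by (rule heat_coeff_even)
  then show ?thesis by (simp add: heat_coeff_def jacobi_P_one coeff_D_def const_C0_def add_ac)
qed

text \<open>
  The identity holds between individual terms, by \<open>jacobi_h_ratio\<close> and
  \<open>jacobi_product_formula\<close>. Convergence is taken over from the moment series.
\<close>
theorem jacobi_heat_eq_moment_series:
  assumes "\<alpha> > -1" "\<beta> > -1"
    and "A\<^sup>2 = (1 - x) / 2 * ((1 - y) / 2)" "B\<^sup>2 = (1 + x) / 2 * ((1 + y) / 2)"
  defines "a \<equiv> \<alpha> + \<beta> + 1/2"
  assumes sums: "(\<lambda>n. exp (- (t/4) * (2 * real n * (2 * real n + 2 * a + 1))) * coeff_D a n
       * poly_moment (pi_moment \<alpha>) (pi_moment \<beta>) A B (jacobi_poly a a (2 * n))) sums S"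
  shows "jacobi_h \<alpha> \<beta> 0 * const_C0 \<alpha> \<beta> * jacobi_heat \<alpha> \<beta> t x y = S"
proof -
  define K where "K = jacobi_h \<alpha> \<beta> 0 * const_C0 \<alpha> \<beta>"
  define f where "f n = exp (- t * (real n * (real n + \<alpha> + \<beta> + 1)))
        * (jacobi_P \<alpha> \<beta> n x * jacobi_P \<alpha> \<beta> n y / jacobi_h \<alpha> \<beta> n)" for n
  have "K > 0"
    using assms(1,2) unfolding K_def jacobi_h_def const_C0_def
    by (intro mult_pos_pos divide_pos_pos) (auto intro!: Gamma_real_pos)
  have "exp (- (t/4) * (2 * real n * (2 * real n + 2 * a + 1))) * coeff_D a n
       * poly_moment (pi_moment \<alpha>) (pi_moment \<beta>) A B (jacobi_poly a a (2 * n)) = K * f n" for n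
  proof -
    have e: "- (t/4) * (2 * real n * (2 * real n + 2 * a + 1)) = - t * (real n * (real n + \<alpha> + \<beta> + 1))"
      by (simp add: a_def field_simps)
    have "K * f n = exp (- t * (real n * (real n + \<alpha> + \<beta> + 1))) * (K / jacobi_h \<alpha> \<beta> n)
        * (jacobi_P \<alpha> \<beta> n x * jacobi_P \<alpha> \<beta> n y)"
      by (simp add: f_def)
    then show ?thesis
      unfolding e unfolding K_def jacobi_h_ratio[OF assms(1,2)] a_def jacobi_product_formula[OF assms(1-4)]
      by (simp only: mult_ac)
  qed
  then have "(\<lambda>n. inverse K * (K * f n)) sums (inverse K * S)"
    using sums_mult[OF sums, of "inverse K"] by simp
  moreover have "inverse K * (K * f n) = f n" for n
    using \<open>K > 0\<close> by simp
  ultimately have "f sums (inverse K * S)" by simp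
  then have "suminf f = inverse K * S" by (rule sums_unique[symmetric])
  moreover have "jacobi_heat \<alpha> \<beta> t x y = suminf f"
    unfolding jacobi_heat_def f_def by (rule refl)
  ultimately show ?thesis
    using \<open>K > 0\<close> unfolding K_def[symmetric] by simp
qed

section \<open>Convergence and termwise integration\<close>

lemma abs_pochhammer_le: "\<bar>pochhammer z k\<bar> \<le> (\<bar>z\<bar> + real k) ^ k"
proof -
  have "\<bar>pochhammer z k\<bar> = (\<Prod>i<k. \<bar>z + real i\<bar>)"
    by (simp add: pochhammer_prod abs_prod lessThan_atLeast0)
  also have "\<dots> \<le> (\<Prod>i<k. \<bar>z\<bar> + real k)"
    by (intro prod_mono) auto
  finally show ?thesis by simp
qed

text \<open>
  A crude bound of size \<open>n\<^sup>n\<close> up to exponential factors, which suffices against \<open>exp (-\<tau> n\<^sup>2)\<close>.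
\<close>
lemma abs_jacobi_P_le:
  assumes "\<bar>x\<bar> \<le> 1"
  shows "\<bar>jacobi_P \<alpha> \<beta> n x\<bar> \<le> (2 * (2 * real n + (\<bar>\<alpha>\<bar> + \<bar>\<beta>\<bar> + 1))) ^ n"
proof -
  define R where "R = 2 * real n + (\<bar>\<alpha>\<bar> + \<bar>\<beta>\<bar> + 1)"
  have summand: "\<bar>real (n choose k) * pochhammer (real n + \<alpha> + \<beta> + 1) k
       * pochhammer (\<alpha> + real k + 1) (n - k) * ((x - 1) / 2) ^ k\<bar> \<le> real (n choose k) * R ^ n"
    if "k \<le> n" for k
  proof -
    have "\<bar>pochhammer (real n + \<alpha> + \<beta> + 1) k\<bar> \<le> (\<bar>real n + \<alpha> + \<beta> + 1\<bar> + real k) ^ k"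
      by (rule abs_pochhammer_le)
    also have "\<dots> \<le> R ^ k" using that by (intro power_mono) (auto simp: R_def)
    finally have 1: "\<bar>pochhammer (real n + \<alpha> + \<beta> + 1) k\<bar> \<le> R ^ k" .
    have "\<bar>pochhammer (\<alpha> + real k + 1) (n - k)\<bar> \<le> (\<bar>\<alpha> + real k + 1\<bar> + real (n - k)) ^ (n - k)"
      by (rule abs_pochhammer_le)
    also have "\<dots> \<le> R ^ (n - k)" using that by (intro power_mono) (auto simp: R_def of_nat_diff)
    finally have 2: "\<bar>pochhammer (\<alpha> + real k + 1) (n - k)\<bar> \<le> R ^ (n - k)" .
    have 3: "\<bar>((x - 1) / 2) ^ k\<bar> \<le> 1"
      unfolding power_abs using assms by (intro power_le_one) auto
    have R: "R \<ge> 0" by (simp add: R_def)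
    have "\<bar>pochhammer (real n + \<alpha> + \<beta> + 1) k\<bar> * \<bar>pochhammer (\<alpha> + real k + 1) (n - k)\<bar> * \<bar>((x - 1) / 2) ^ k\<bar>
       \<le> R ^ k * R ^ (n - k) * 1"
      using 1 2 3 R by (intro mult_mono) auto
    also have "\<dots> = R ^ n" using that by (simp flip: power_add)
    finally show ?thesis
      by (simp add: abs_mult mult.assoc mult_left_mono)
  qed
  have "\<bar>jacobi_P \<alpha> \<beta> n x\<bar> \<le> 1 / fact n * (\<Sum>k\<le>n. real (n choose k) * R ^ n)"
    unfolding jacobi_P_def abs_mult
    by (intro mult_mono order.trans[OF sum_abs] sum_mono summand) (auto intro: sum_nonneg)
  also have "(\<Sum>k\<le>n. real (n choose k) * R ^ n) = 2 ^ n * R ^ n"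
    by (simp flip: sum_distrib_right of_nat_sum add: choose_row_sum)
  also have "1 / fact n * (2 ^ n * R ^ n) \<le> 1 * (2 ^ n * R ^ n)"
    by (intro mult_right_mono) (auto simp: R_def divide_le_eq fact_ge_1)
  finally show ?thesis unfolding R_def[symmetric] power_mult_distrib by simp
qed

lemma heat_coeff_pos:
  assumes "a > -1" "m > 0 \<or> a > -1/2"
  shows "heat_coeff a m > 0"
  unfolding heat_coeff_eq[OF assms] using assms
  by (intro divide_pos_pos mult_pos_pos Gamma_real_pos) auto

text \<open>
  The quotient of consecutive coefficients is a product of two rational functions of \<open>m\<close>, bounded by
  \<open>3\<close> and by \<open>2\<close>.
\<close>
lemma heat_coeff_Suc_le:
  assumes "a > -1" "m \<ge> 1"
  shows "heat_coeff a (Suc m) \<le> 6 * heat_coeff a m"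
proof -
  have m: "real m \<ge> 1" using assms by simp
  define r where "r = (2 * real m + 2 * a + 3) / (2 * real m + 2 * a + 1) * ((real m + 2 * a + 1) / (real m + a + 1))"
  have r: "r \<le> 3 * 2"
    unfolding r_def using assms m by (intro mult_mono) (auto simp: divide_simps)
  have pos: "2 * real m + 2 * a + 1 > 0" "real m + 2 * a + 1 > 0" "real m + a + 1 > 0"
    using assms m by auto
  have G: "Gamma (real m + 2 * a + 1 + 1) = (real m + 2 * a + 1) * Gamma (real m + 2 * a + 1)"
    "Gamma (real m + a + 1 + 1) = (real m + a + 1) * Gamma (real m + a + 1)"
    using pos by (intro Gamma_add_one; simp)+
  have "heat_coeff a (Suc m) = (2 * real m + 2 * a + 3) * Gamma (real m + 2 * a + 1 + 1)
     / (2 powr (2 * a + 1) * Gamma (a + 1) * Gamma (real m + a + 1 + 1))"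
    using assms by (subst heat_coeff_eq) (auto simp: add_ac)
  also have "\<dots> = r * heat_coeff a m"
    unfolding G r_def using assms pos by (subst heat_coeff_eq) (auto simp: divide_simps)
  also have "\<dots> \<le> 6 * heat_coeff a m"
    using r heat_coeff_pos[of a m] assms by (intro mult_right_mono) auto
  finally show ?thesis .
qed

lemma heat_coeff_le:
  assumes "a > -1"
  shows "\<exists>C\<ge>0. \<forall>m. \<bar>heat_coeff a m\<bar> \<le> C * 6 ^ m"
proof -
  define C where "C = \<bar>heat_coeff a 0\<bar> + \<bar>heat_coeff a 1\<bar>"
  have C_Suc: "\<bar>heat_coeff a (Suc m)\<bar> \<le> C * 6 ^ m" for m
  proof (induction m)
    case (Suc m)
    have "\<bar>heat_coeff a (Suc (Suc m))\<bar> = heat_coeff a (Suc (Suc m))"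
      using heat_coeff_pos[of a "Suc (Suc m)"] assms by simp
    also have "\<dots> \<le> 6 * heat_coeff a (Suc m)"
      using assms by (intro heat_coeff_Suc_le) auto
    finally show ?case using Suc by simp
  qed (simp add: C_def)
  have "\<bar>heat_coeff a m\<bar> \<le> C * 6 ^ m" for m
  proof (cases m)
    case (Suc k)
    have "C * 6 ^ k \<le> C * 6 ^ Suc k" by (intro mult_left_mono) (auto simp: C_def)
    then show ?thesis using C_Suc[of k] unfolding Suc by linarith
  qed (simp add: C_def)
  then show ?thesis by (intro exI[of _ C]) (auto simp: C_def)
qed

text \<open>
  The coefficients are compared with those for the parameter \<open>a + 1 > -1/2\<close> through
  \<open>coeff_D_odd\<close>, where the factor on the left is at least \<open>(2a + 3)/2\<close>.
\<close>
lemma coeff_D_le: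
  assumes "a > -3/2"
  shows "\<exists>C\<ge>0. \<forall>n. \<bar>coeff_D a n\<bar> \<le> C * 6 ^ (2 * n)"
proof -
  obtain C where C: "C \<ge> 0" "\<And>m. \<bar>heat_coeff (a + 1) m\<bar> \<le> C * 6 ^ m"
    using heat_coeff_le[of "a + 1"] assms by force
  define C' where "C' = \<bar>coeff_D a 0\<bar> + 4 * C / (2 * a + 3)"
  have a: "2 * a + 3 > 0" using assms by simp
  have "\<bar>coeff_D a n\<bar> \<le> C' * 6 ^ (2 * n)" for n
  proof (cases n)
    case 0
    then show ?thesis using a C by (simp add: C'_def)
  next
    case (Suc k)
    have pos: "2 * a + 3 \<le> real (2 * k + 1) + 2 * a + 2" by simp
    have "\<bar>coeff_D a n\<bar> * ((real (2 * k + 1) + 2 * a + 2) / 2) = 2 * \<bar>heat_coeff (a + 1) (2 * k + 1)\<bar>"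
      using arg_cong[OF coeff_D_odd[OF assms, of k], of abs] a by (simp add: Suc abs_mult)
    moreover have "\<bar>coeff_D a n\<bar> * ((2 * a + 3) / 2) \<le> \<bar>coeff_D a n\<bar> * ((real (2 * k + 1) + 2 * a + 2) / 2)"
      using pos by (intro mult_left_mono) auto
    ultimately have "\<bar>coeff_D a n\<bar> * ((2 * a + 3) / 2) \<le> 2 * (C * 6 ^ (2 * k + 1))"
      using C(2)[of "2 * k + 1"] by linarith
    then have "\<bar>coeff_D a n\<bar> \<le> 4 * C / (2 * a + 3) * 6 ^ (2 * k + 1)"
      using a by (simp add: field_simps)
    also have "\<dots> \<le> C' * 6 ^ (2 * n)"
      using a C(1) unfolding C'_def Suc by (intro mult_mono power_increasing) auto
    finally show ?thesis .
  qed
  moreover have "C' \<ge> 0" using a C(1) by (simp add: C'_def)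
  ultimately show ?thesis by blast
qed

text \<open>
  The \<open>m\<close>-th term is the \<open>m\<close>-th power of a null sequence.
\<close>
lemma summable_heat_majorant:
  fixes \<tau> c q L :: real
  assumes "\<tau> > 0" "q \<ge> 0" "L \<ge> 0"
  shows "summable (\<lambda>m. exp (- \<tau> * (real m * (real m + c))) * (q * (2 * real m + L)) ^ m)"
proof -
  define x where "x = exp (- \<tau>)"
  have x: "norm x < 1" using assms by (simp add: x_def)
  have "(\<lambda>m. exp (- \<tau> * c) * q * 2 * (real m * x ^ m) + exp (- \<tau> * c) * q * L * x ^ m) \<longlonglongrightarrow>
     exp (- \<tau> * c) * q * 2 * 0 + exp (- \<tau> * c) * q * L * 0"
    using x by (intro tendsto_intros powser_times_n_limit_0 LIMSEQ_power_zero)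
  moreover have "exp (- \<tau> * c) * q * 2 * (real m * x ^ m) + exp (- \<tau> * c) * q * L * x ^ m
     = exp (- \<tau> * (real m + c)) * (q * (2 * real m + L))" for m
  proof -
    have "exp (- \<tau> * (real m + c)) = exp (- \<tau> * c) * x ^ m"
      by (simp add: x_def algebra_simps flip: exp_of_nat_mult exp_add)
    then show ?thesis by (simp add: algebra_simps)
  qed
  ultimately have lim: "(\<lambda>m. exp (- \<tau> * (real m + c)) * (q * (2 * real m + L))) \<longlonglongrightarrow> 0"
    by simp
  have "eventually (\<lambda>m. exp (- \<tau> * (real m + c)) * (q * (2 * real m + L)) < 1/2) sequentially"
    using lim by (rule order_tendstoD) simp
  then have "eventually (\<lambda>m. norm (exp (- \<tau> * (real m * (real m + c))) * (q * (2 * real m + L)) ^ m) \<le> (1/2) ^ m) sequentially"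
  proof eventually_elim
    case (elim m)
    have "exp (- \<tau> * (real m * (real m + c))) = exp (- \<tau> * (real m + c)) ^ m"
      by (simp add: algebra_simps flip: exp_of_nat_mult)
    then have "norm (exp (- \<tau> * (real m * (real m + c))) * (q * (2 * real m + L)) ^ m)
       = (exp (- \<tau> * (real m + c)) * (q * (2 * real m + L))) ^ m"
      using assms by (simp add: power_mult_distrib)
    also have "\<dots> \<le> (1/2) ^ m"
      using elim assms by (intro power_mono) auto
    finally show ?case .
  qed
  then show ?thesis by (rule summable_comparison_test_ev) (simp add: summable_geometric)
qed

lemma heat_series_dominated:
  assumes "\<tau> > 0" "a > -1"
  obtains c where "summable c" "\<And>m x. \<bar>x\<bar> \<le> 1 \<Longrightarrow>
    \<bar>exp (- \<tau> * (real m * (real m + 2 * a + 1))) * heat_coeff a m * poly (jacobi_poly a a m) x\<bar> \<le> c m"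
proof -
  obtain C where C: "C \<ge> 0" "\<And>m. \<bar>heat_coeff a m\<bar> \<le> C * 6 ^ m"
    using heat_coeff_le[OF assms(2)] by blast
  let ?L = "\<bar>a\<bar> + \<bar>a\<bar> + 1"
  let ?E = "\<lambda>m. exp (- \<tau> * (real m * (real m + (2 * a + 1))))"
  have "summable (\<lambda>m. C * (?E m * (12 * (2 * real m + ?L)) ^ m))"
    using assms by (intro summable_mult summable_heat_majorant) auto
  moreover have "\<bar>exp (- \<tau> * (real m * (real m + 2 * a + 1))) * heat_coeff a m * poly (jacobi_poly a a m) x\<bar>
      \<le> C * (?E m * (12 * (2 * real m + ?L)) ^ m)" if "\<bar>x\<bar> \<le> 1" for m x
  proof -
    have "\<bar>exp (- \<tau> * (real m * (real m + 2 * a + 1))) * heat_coeff a m * poly (jacobi_poly a a m) x\<bar>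
      = ?E m * (\<bar>heat_coeff a m\<bar> * \<bar>jacobi_P a a m x\<bar>)"
      by (simp add: abs_mult poly_jacobi_poly add_ac)
    also have "\<dots> \<le> ?E m * ((C * 6 ^ m) * (2 * (2 * real m + ?L)) ^ m)"
      using C that by (intro mult_left_mono mult_mono abs_jacobi_P_le) auto
    also have "\<dots> = C * (?E m * (6 ^ m * (2 * (2 * real m + ?L)) ^ m))" by simp
    also have "6 ^ m * (2 * (2 * real m + ?L)) ^ m = (12 * (2 * real m + ?L)) ^ m"
      by (simp flip: power_mult_distrib)
    finally show ?thesis .
  qed
  ultimately show ?thesis using that by blast
qed

lemma even_series_dominated:
  assumes "\<tau> > 0" "a > -3/2"
  obtains c where "summable c" "\<And>n x. \<bar>x\<bar> \<le> 1 \<Longrightarrow>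
    \<bar>exp (- \<tau> * (2 * real n * (2 * real n + 2 * a + 1))) * coeff_D a n * poly (jacobi_poly a a (2 * n)) x\<bar> \<le> c n"
proof -
  obtain C where C: "C \<ge> 0" "\<And>m. \<bar>coeff_D a m\<bar> \<le> C * 6 ^ (2 * m)"
    using coeff_D_le[OF assms(2)] by blast
  let ?L = "\<bar>a\<bar> + \<bar>a\<bar> + 1"
  let ?E = "\<lambda>m. exp (- \<tau> * (real m * (real m + (2 * a + 1))))"
  let ?f = "\<lambda>m. C * (?E m * (12 * (2 * real m + ?L)) ^ m)"
  have "summable ?f"
    using assms by (intro summable_mult summable_heat_majorant) auto
  then have "summable (?f \<circ> (\<lambda>n. 2 * n))"
    using C by (intro summable_reindex) (auto simp: inj_on_def)
  moreover have "\<bar>exp (- \<tau> * (2 * real n * (2 * real n + 2 * a + 1))) * coeff_D a n * poly (jacobi_poly a a (2 * n)) x\<bar>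
      \<le> (?f \<circ> (\<lambda>n. 2 * n)) n" if "\<bar>x\<bar> \<le> 1" for n x
  proof -
    let ?m = "2 * n"
    have "\<bar>exp (- \<tau> * (2 * real n * (2 * real n + 2 * a + 1))) * coeff_D a n * poly (jacobi_poly a a ?m) x\<bar>
      = ?E ?m * (\<bar>coeff_D a n\<bar> * \<bar>jacobi_P a a ?m x\<bar>)"
      by (simp add: abs_mult poly_jacobi_poly add_ac)
    also have "\<dots> \<le> ?E ?m * ((C * 6 ^ ?m) * (2 * (2 * real ?m + ?L)) ^ ?m)"
      using C that by (intro mult_left_mono mult_mono abs_jacobi_P_le) auto
    also have "\<dots> = C * (?E ?m * (6 ^ ?m * (2 * (2 * real ?m + ?L)) ^ ?m))" by simp
    also have "6 ^ ?m * (2 * (2 * real ?m + ?L)) ^ ?m = (12 * (2 * real ?m + ?L)) ^ ?m"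
      by (simp flip: power_mult_distrib)
    finally show ?thesis by simp
  qed
  ultimately show ?thesis using that by blast
qed

lemma integrable_if_has_bochner_integral: "has_bochner_integral M f x \<Longrightarrow> integrable M f"
  by (simp add: has_bochner_integral_iff)

text \<open>
  The signed measure with density \<open>w\<close> relative to \<open>\<mu>\<close> on \<open>[-1, 1]\<close> has moment sequence \<open>m\<close>. A
  base measure and a weight allow \<open>d\<Pi>\<^sub>\<alpha>\<close> (weight \<open>1\<close>) and \<open>\<Pi>\<^sub>\<alpha>(u) du\<close> (base measure \<open>lborel\<close>) to be
  treated alike.
\<close>
definition has_moments :: "real measure \<Rightarrow> (real \<Rightarrow> real) \<Rightarrow> (nat \<Rightarrow> real) \<Rightarrow> bool" where
  "has_moments \<mu> w m \<longleftrightarrow> sigma_finite_measure \<mu> \<and> sets \<mu> = sets borel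
     \<and> (\<forall>j. has_bochner_integral \<mu> (\<lambda>u. indicator {-1..1} u * (u ^ j * w u)) (m j))"

lemma has_bochner_integral_pair_mult:
  fixes f g :: "real \<Rightarrow> real"
  assumes "sigma_finite_measure M" "sigma_finite_measure N"
    and f: "has_bochner_integral M f a" and g: "has_bochner_integral N g b"
  shows "has_bochner_integral (M \<Otimes>\<^sub>M N) (\<lambda>(u, v). f u * g v) (a * b)"
proof -
  interpret pair_sigma_finite M N using assms(1,2) by (simp add: pair_sigma_finite_def)
  have i: "integrable M f" "integrable N g" "integral\<^sup>L M f = a" "integral\<^sup>L N g = b"
    using f g by (auto simp: has_bochner_integral_iff)
  note [measurable] = i(1)[THEN borel_measurable_integrable] i(2)[THEN borel_measurable_integrable]
  have int: "integrable (M \<Otimes>\<^sub>M N) (\<lambda>(u, v). f u * g v)"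
  proof (rule Fubini_integrable)
    show "integrable M (\<lambda>x. \<integral>y. norm (case (x, y) of (u, v) \<Rightarrow> f u * g v) \<partial>N)"
      using i by (simp add: abs_mult)
    show "AE x in M. integrable N (\<lambda>y. case (x, y) of (u, v) \<Rightarrow> f u * g v)"
      using i by simp
  qed simp
  then have "integral\<^sup>L (M \<Otimes>\<^sub>M N) (\<lambda>(u, v). f u * g v) = (\<integral>u. (\<integral>v. f u * g v \<partial>N) \<partial>M)"
    using integral_fst[OF int] by simp
  also have "\<dots> = a * b" using i by simp
  finally show ?thesis using int by (simp add: has_bochner_integral_iff)
qed

lemma has_bochner_integral_poly_moment:
  assumes "has_moments \<mu> w1 m1" "has_moments \<nu> w2 m2"
  shows "has_bochner_integral (\<mu> \<Otimes>\<^sub>M \<nu>)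
     (\<lambda>(u, v). indicator ({-1..1} \<times> {-1..1}) (u, v) * (poly p (A * u + B * v) * w1 u * w2 v))
     (poly_moment m1 m2 A B p)"
proof -
  let ?I = "indicator {-1..1::real} :: real \<Rightarrow> real"
  let ?g = "\<lambda>i k (u, v). (?I u * (u ^ i * w1 u)) * (?I v * (v ^ k * w2 v))"
  have g: "has_bochner_integral (\<mu> \<Otimes>\<^sub>M \<nu>) (?g i k) (m1 i * m2 k)" for i k
    using assms unfolding has_moments_def by (intro has_bochner_integral_pair_mult) auto
  have "has_bochner_integral (\<mu> \<Otimes>\<^sub>M \<nu>)
     (\<lambda>z. \<Sum>j\<le>degree p. coeff p j * (\<Sum>i\<le>j. (real (j choose i) * A ^ i * B ^ (j - i)) * ?g i (j - i) z))
     (\<Sum>j\<le>degree p. coeff p j * (\<Sum>i\<le>j. (real (j choose i) * A ^ i * B ^ (j - i)) * (m1 i * m2 (j - i))))"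
    by (intro has_bochner_integral_sum has_bochner_integral_mult_right g)
  moreover have "(\<lambda>z. \<Sum>j\<le>degree p. coeff p j * (\<Sum>i\<le>j. (real (j choose i) * A ^ i * B ^ (j - i)) * ?g i (j - i) z))
     = (\<lambda>(u, v). indicator ({-1..1} \<times> {-1..1}) (u, v) * (poly p (A * u + B * v) * w1 u * w2 v))"
  proof (rule ext)
    fix z :: "real \<times> real"
    obtain u v where z: "z = (u, v)" by force
    have "(\<Sum>i\<le>j. (real (j choose i) * A ^ i * B ^ (j - i)) * ?g i (j - i) (u, v))
      = (A * u + B * v) ^ j * (?I u * ?I v * w1 u * w2 v)" for j
      unfolding binomial_ring sum_distrib_right
      by (intro sum.cong refl) (simp add: power_mult_distrib mult_ac)
    then show "(\<Sum>j\<le>degree p. coeff p j * (\<Sum>i\<le>j. (real (j choose i) * A ^ i * B ^ (j - i)) * ?g i (j - i) z))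
      = (case z of (u, v) \<Rightarrow> indicator ({-1..1} \<times> {-1..1}) (u, v) * (poly p (A * u + B * v) * w1 u * w2 v))"
      unfolding z by (simp add: poly_altdef sum_distrib_left sum_distrib_right indicator_times mult_ac)
  qed
  ultimately show ?thesis
    by (simp add: poly_moment_def bimoment_def mult.assoc)
qed

text \<open>
  Since \<open>A u + B v\<close> stays in \<open>[-1, 1]\<close>, the terms are dominated by \<open>c n \<bar>w1 u w2 v\<bar>\<close>, which is
  integrable for each \<open>n\<close> and has summable integrals; so sum and integral may be interchanged.
\<close>
lemma square_integral_series:
  assumes m: "has_moments \<mu> w1 m1" "has_moments \<nu> w2 m2"
    and AB: "\<bar>A\<bar> + \<bar>B\<bar> \<le> 1"
    and c: "summable c" "\<And>n x. \<bar>x\<bar> \<le> 1 \<Longrightarrow> \<bar>b n * poly (p n) x\<bar> \<le> c n"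
  shows "(\<lambda>n. K * (b n * poly_moment m1 m2 A B (p n))) sums
     square_integral \<mu> \<nu> (\<lambda>u v. K * (\<Sum>n. b n * poly (p n) (A * u + B * v)) * w1 u * w2 v)"
proof -
  let ?I = "indicator ({-1..1} \<times> {-1..1}) :: real \<times> real \<Rightarrow> real"
  define f where "f n = (\<lambda>(u, v). b n * (?I (u, v) * (poly (p n) (A * u + B * v) * w1 u * w2 v)))" for n
  define W where "W = (\<lambda>(u, v). \<bar>?I (u, v) * (poly 1 (A * u + B * v) * w1 u * w2 v)\<bar>)"
  have f: "has_bochner_integral (\<mu> \<Otimes>\<^sub>M \<nu>) (f n) (b n * poly_moment m1 m2 A B (p n))" for n
    using has_bochner_integral_mult_right[OF has_bochner_integral_poly_moment[OF m, of "p n" A B], of "b n"]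
    by (simp add: f_def case_prod_beta')
  have W: "integrable (\<mu> \<Otimes>\<^sub>M \<nu>) W"
    using integrable_norm[OF has_bochner_integral_poly_moment[OF m, of 1 A B, THEN integrable_if_has_bochner_integral]]
    by (simp add: W_def case_prod_beta')
  have arg: "\<bar>A * u + B * v\<bar> \<le> 1" if "u \<in> {-1..1}" "v \<in> {-1..1}" for u v
  proof -
    have "\<bar>A * u + B * v\<bar> \<le> \<bar>A\<bar> * \<bar>u\<bar> + \<bar>B\<bar> * \<bar>v\<bar>"
      by (metis abs_mult abs_triangle_ineq)
    also have "\<dots> \<le> \<bar>A\<bar> * 1 + \<bar>B\<bar> * 1"
      using that by (intro add_mono mult_left_mono) auto
    finally show ?thesis using AB by simp
  qed
  have fW: "norm (f n z) \<le> c n * W z" for n z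
  proof (cases z)
    case (Pair u v)
    show ?thesis
    proof (cases "u \<in> {-1..1} \<and> v \<in> {-1..1}")
      case True
      then have "\<bar>b n * poly (p n) (A * u + B * v)\<bar> \<le> c n" using arg c(2) by blast
      then have "\<bar>b n * poly (p n) (A * u + B * v)\<bar> * \<bar>w1 u * w2 v\<bar> \<le> c n * \<bar>w1 u * w2 v\<bar>"
        by (rule mult_right_mono) simp
      then show ?thesis using True by (simp add: f_def W_def Pair abs_mult mult.assoc)
    qed (auto simp: f_def W_def Pair)
  qed
  have sm: "summable (\<lambda>n. norm (f n z))" for z
    by (rule summable_comparison_test[OF _ summable_mult2[OF c(1), of "W z"]]) (use fW in auto)
  have "(\<lambda>n. integral\<^sup>L (\<mu> \<Otimes>\<^sub>M \<nu>) (f n)) sums (\<integral>z. (\<Sum>n. f n z) \<partial>(\<mu> \<Otimes>\<^sub>M \<nu>))"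
  proof (rule sums_integral)
    show "integrable (\<mu> \<Otimes>\<^sub>M \<nu>) (f n)" for n
      using f by (simp add: has_bochner_integral_iff)
    show "AE z in \<mu> \<Otimes>\<^sub>M \<nu>. summable (\<lambda>n. norm (f n z))" using sm by simp
    show "summable (\<lambda>n. \<integral>z. norm (f n z) \<partial>(\<mu> \<Otimes>\<^sub>M \<nu>))"
    proof (rule summable_comparison_test[OF _ summable_mult2[OF c(1), of "integral\<^sup>L (\<mu> \<Otimes>\<^sub>M \<nu>) W"]], intro exI allI impI)
      fix n
      have "(\<integral>z. norm (f n z) \<partial>(\<mu> \<Otimes>\<^sub>M \<nu>)) \<le> (\<integral>z. c n * W z \<partial>(\<mu> \<Otimes>\<^sub>M \<nu>))"
        using f[of n] W fW by (intro integral_mono) (auto simp: has_bochner_integral_iff)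
      then show "norm (\<integral>z. norm (f n z) \<partial>(\<mu> \<Otimes>\<^sub>M \<nu>)) \<le> c n * integral\<^sup>L (\<mu> \<Otimes>\<^sub>M \<nu>) W"
        by (simp add: integral_nonneg_AE)
    qed
  qed
  then have "(\<lambda>n. K * (b n * poly_moment m1 m2 A B (p n))) sums (K * (\<integral>z. (\<Sum>n. f n z) \<partial>(\<mu> \<Otimes>\<^sub>M \<nu>)))"
    using f by (intro sums_mult) (simp add: has_bochner_integral_iff)
  moreover have "K * (\<integral>z. (\<Sum>n. f n z) \<partial>(\<mu> \<Otimes>\<^sub>M \<nu>)) =
     square_integral \<mu> \<nu> (\<lambda>u v. K * (\<Sum>n. b n * poly (p n) (A * u + B * v)) * w1 u * w2 v)"
    unfolding square_integral_def set_lebesgue_integral_def integral_mult_right_zero[symmetric]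
  proof (rule Bochner_Integration.integral_cong[OF refl], clarify)
    fix u v
    show "K * (\<Sum>n. f n (u, v)) = ?I (u, v) *\<^sub>R (K * (\<Sum>n. b n * poly (p n) (A * u + B * v)) * w1 u * w2 v)"
    proof (cases "u \<in> {-1..1} \<and> v \<in> {-1..1}")
      case True
      have "summable (\<lambda>n. b n * poly (p n) (A * u + B * v))"
        by (rule summable_comparison_test[OF _ c(1)]) (use c(2) arg True in auto)
      then have "(\<Sum>n. b n * poly (p n) (A * u + B * v)) * (w1 u * w2 v) = (\<Sum>n. f n (u, v))"
        using True by (subst suminf_mult2) (simp_all add: f_def mult_ac)
      then show ?thesis using True by (simp add: mult.assoc)
    qed (auto simp: f_def)
  qed
  ultimately show ?thesis by simp
qed

section \<open>Moments of the probability measures\<close>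

lemma one_diff_square_powr_Suc:
  assumes "\<bar>u\<bar> \<le> (1::real)"
  shows "(1 - u\<^sup>2) powr (b + 1) = (1 - u\<^sup>2) * (1 - u\<^sup>2) powr b"
proof (cases "1 - u\<^sup>2 = 0")
  case False
  moreover have "u\<^sup>2 \<le> 1" using assms by (simp add: abs_square_le_1)
  ultimately have "1 - u\<^sup>2 > 0" by simp
  then show ?thesis by (simp add: powr_add)
qed simp

lemma Beta_diff:
  fixes x y :: real
  assumes "x > 0" "y \<notin> \<int>\<^sub>\<le>\<^sub>0"
  shows "Beta x y - Beta (x + 1) y = Beta x (y + 1)"
proof -
  have "x \<notin> \<int>\<^sub>\<le>\<^sub>0" using assms nonpos_Ints_nonpos[of x] by force
  then show ?thesis using Beta_plus1_plus1[of x y] assms by simp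
qed

lemma has_bochner_integral_uminus_arg:
  fixes f :: "real \<Rightarrow> real"
  shows "has_bochner_integral lborel f x \<Longrightarrow> has_bochner_integral lborel (\<lambda>u. f (- u)) x"
  using lborel_has_bochner_integral_real_affine_iff[of "-1" f x 0] by simp

text \<open>
  The substitution \<open>u = 2 x - 1\<close> gives \<open>B(b + 1, b + 1)\<close>, and the duplication formula
  rewrites this as \<open>B(1/2, b + 1)\<close>.
\<close>
lemma has_bochner_integral_one_diff_square_powr:
  assumes "b > -1"
  shows "has_bochner_integral lborel (\<lambda>u::real. indicator {-1..1} u * (1 - u\<^sup>2) powr b) (Beta (1/2) (b + 1))"
proof -
  define g where "g t = (if t \<in> {0..1} then t powr b * (1 - t) powr b else 0)" for t :: real
  have gm: "g \<in> borel_measurable borel" unfolding g_def[abs_def] by measurable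
  have gn: "g t \<ge> 0" for t by (simp add: g_def)
  have "((\<lambda>t. t powr (b + 1 - 1) * (1 - t) powr (b + 1 - 1)) has_integral Beta (b + 1) (b + 1)) {0..1}"
    using assms by (intro has_integral_Beta_real) auto
  then have "((\<lambda>t. t powr b * (1 - t) powr b) has_integral Beta (b + 1) (b + 1)) {0..1}"
    by (simp only: add_diff_cancel_right')
  then have "(g has_integral Beta (b + 1) (b + 1)) UNIV"
    unfolding g_def[abs_def] has_integral_restrict_UNIV .
  then have "(\<integral>\<^sup>+t. ennreal (g t) \<partial>lborel) = ennreal (Beta (b + 1) (b + 1))"
    by (intro nn_integral_has_integral_lborel gm gn)
  moreover have Beta0: "Beta (b + 1) (b + 1) \<ge> 0"
    using assms by (auto simp: Beta_def intro!: divide_nonneg_nonneg mult_nonneg_nonneg less_imp_le[OF Gamma_real_pos])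
  ultimately have "has_bochner_integral lborel g (Beta (b + 1) (b + 1))"
    using gm gn by (intro has_bochner_integral_nn_integral) auto
  then have "has_bochner_integral lborel (\<lambda>t. 4 powr b * g t) (4 powr b * Beta (b + 1) (b + 1))"
    by (rule has_bochner_integral_mult_right)
  moreover have "4 powr b * Beta (b + 1) (b + 1) = Beta (1/2) (b + 1) /\<^sub>R \<bar>2\<bar>"
  proof -
    have G: "Gamma (b + 1) > 0" "Gamma (b + 3/2) > 0" "Gamma (2 * b + 2) > 0"
      using assms by (auto intro!: Gamma_real_pos)
    have "2 powr (2 * b + 1) * (Gamma (b + 1) * Gamma (b + 3/2)) = sqrt pi * Gamma (2 * b + 2)"
      using Gamma_duplication_real[of "b + 1"] assms by (simp add: algebra_simps)
    moreover have "2 powr (2 * b + 1) = 2 * 4 powr b"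
    proof -
      have "2 powr (2 * b) = (2 powr 2) powr b" by (rule powr_powr[symmetric])
      then show ?thesis by (simp add: powr_add)
    qed
    ultimately have dup: "Gamma (2 * b + 2) = 2 * 4 powr b * (Gamma (b + 1) * Gamma (b + 3/2)) / sqrt pi"
      by (simp add: divide_simps mult_ac)
    have e: "b + 1 + (b + 1) = 2 * b + 2" "1/2 + (b + 1) = b + 3/2" by simp_all
    show ?thesis
      unfolding Beta_def e dup Gamma_one_half_real using G by simp
  qed
  moreover have "4 powr b * g t = indicator {-1..1} (-1 + 2 * t) * (1 - (-1 + 2 * t)\<^sup>2) powr b" for t
  proof (cases "t \<in> {0..1}")
    case True
    have "1 - (-1 + 2 * t)\<^sup>2 = 4 * (t * (1 - t))" by (simp add: power2_eq_square algebra_simps)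
    then have "(1 - (-1 + 2 * t)\<^sup>2) powr b = 4 powr b * (t powr b * (1 - t) powr b)"
      using True by (simp add: powr_mult)
    moreover have "-1 + 2 * t \<in> {-1..1}" using True by auto
    ultimately show ?thesis using True by (simp add: g_def)
  qed (auto simp: g_def indicator_def)
  ultimately have "has_bochner_integral lborel
     (\<lambda>t. indicator {-1..1} (-1 + 2 * t) * (1 - (-1 + 2 * t)\<^sup>2) powr b) (Beta (1/2) (b + 1) /\<^sub>R \<bar>2\<bar>)"
    by simp
  then show ?thesis
    by (subst lborel_has_bochner_integral_real_affine_iff[where c = 2 and t = "-1"]) auto
qed

text \<open>
  Induction on \<open>i\<close> for all \<open>b\<close> simultaneously:
  \<open>u\<^sup>2 (1 - u\<^sup>2)\<^sup>b = (1 - u\<^sup>2)\<^sup>b - (1 - u\<^sup>2)\<^sup>b\<^sup>+\<^sup>1\<close> corresponds to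
  \<open>B(x + 1, y) = B(x, y) - B(x, y + 1)\<close>.
\<close>
lemma has_bochner_integral_even_moment:
  assumes "b > -1"
  shows "has_bochner_integral lborel (\<lambda>u::real. indicator {-1..1} u * (u ^ (2 * i) * (1 - u\<^sup>2) powr b))
    (Beta (real i + 1/2) (b + 1))"
  using assms
proof (induction i arbitrary: b)
  case 0
  then show ?case using has_bochner_integral_one_diff_square_powr[of b] by simp
next
  case (Suc i)
  have "b + 1 \<notin> \<int>\<^sub>\<le>\<^sub>0" using Suc.prems nonpos_Ints_nonpos[of "b + 1"] by force
  then have "Beta (real i + 1/2) (b + 1) - Beta (real i + 1/2) (b + 1 + 1) = Beta (real (Suc i) + 1/2) (b + 1)"
    using Beta_diff[of "real i + 1/2" "b + 1"] by (simp add: add_ac)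
  moreover have "has_bochner_integral lborel (\<lambda>u::real. indicator {-1..1} u * (u ^ (2 * i) * (1 - u\<^sup>2) powr b)
     - indicator {-1..1} u * (u ^ (2 * i) * (1 - u\<^sup>2) powr (b + 1)))
    (Beta (real i + 1/2) (b + 1) - Beta (real i + 1/2) (b + 1 + 1))"
    using Suc.prems by (intro has_bochner_integral_diff Suc.IH) auto
  moreover have "indicator {-1..1} u * (u ^ (2 * i) * (1 - u\<^sup>2) powr b)
     - indicator {-1..1} u * (u ^ (2 * i) * (1 - u\<^sup>2) powr (b + 1))
     = indicator {-1..1} u * (u ^ (2 * Suc i) * (1 - u\<^sup>2) powr b)" for u :: real
  proof (cases "u \<in> {-1..1}")
    case True
    then have "(1 - u\<^sup>2) powr (b + 1) = (1 - u\<^sup>2) * (1 - u\<^sup>2) powr b"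
      by (intro one_diff_square_powr_Suc) auto
    then have "u ^ (2 * i) * (1 - u\<^sup>2) powr b - u ^ (2 * i) * (1 - u\<^sup>2) powr (b + 1)
       = (u ^ (2 * i) * u\<^sup>2) * (1 - u\<^sup>2) powr b"
      by (simp only:) (simp add: algebra_simps)
    then show ?thesis using True by (simp add: power2_eq_square mult_ac)
  qed simp
  ultimately show ?case by simp
qed

lemma integrable_power_mult:
  assumes "integrable lborel (\<lambda>u::real. indicator S u * f u :: real)" "S \<subseteq> {-1..1}"
  shows "integrable lborel (\<lambda>u. indicator S u * (u ^ j * f u))"
proof -
  have "integrable lborel (\<lambda>u. (indicator {-1..1} u * u ^ j) * (indicator S u * f u))"
  proof (rule Bochner_Integration.integrable_bound[OF assms(1)])
    show "AE u in lborel. norm ((indicator {-1..1} u * u ^ j) * (indicator S u * f u)) \<le> norm (indicator S u * f u)"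
    proof (intro AE_I2)
      fix u :: real
      have "\<bar>indicator {-1..1} u * u ^ j\<bar> \<le> (1::real)"
        using power_le_one[of "\<bar>u\<bar>" j] by (auto simp: indicator_def power_abs)
      moreover have "\<bar>x * y\<bar> \<le> \<bar>y\<bar>" if "\<bar>x\<bar> \<le> 1" for x y :: real
        using that by (simp add: abs_mult mult_left_le_one_le)
      ultimately show "norm ((indicator {-1..1} u * u ^ j) * (indicator S u * f u)) \<le> norm (indicator S u * f u)"
        unfolding real_norm_def by blast
    qed
  qed (use assms(1)[THEN borel_measurable_integrable] in measurable)
  moreover have "(indicator {-1..1} u * u ^ j) * (indicator S u * f u) = indicator S u * (u ^ j * f u)" for u
    using assms(2) by (auto simp: indicator_def)
  ultimately show ?thesis by simp
qed

lemma has_bochner_integral_odd_zero: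
  fixes h :: "real \<Rightarrow> real"
  assumes "integrable lborel h" "\<And>u. h (- u) = - h u"
  shows "has_bochner_integral lborel h 0"
proof -
  have h: "has_bochner_integral lborel h (integral\<^sup>L lborel h)"
    using assms(1) by (simp add: has_bochner_integral_iff)
  then have "has_bochner_integral lborel (\<lambda>u. h (- u)) (integral\<^sup>L lborel h)"
    by (rule has_bochner_integral_uminus_arg)
  then have "integral\<^sup>L lborel h = - integral\<^sup>L lborel h"
    unfolding assms(2) by (simp add: has_bochner_integral_iff)
  then show ?thesis using h by simp
qed

text \<open>
  For \<open>\<alpha> < -1/2\<close> the second argument of the Beta function is negative and the left side no longer is
  an integral, but the identity persists; it is used in this range for the signed measures.
\<close>
lemma pi_moment_eq_Beta:
  assumes "\<alpha> > -1" "\<alpha> \<noteq> -1/2"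
  shows "Gamma (\<alpha> + 1) / (sqrt pi * Gamma (\<alpha> + 1/2)) * Beta (real i + 1/2) (\<alpha> + 1/2) = pi_moment \<alpha> (2 * i)"
proof -
  have "Gamma (\<alpha> + 1/2) \<noteq> 0"
  proof
    assume "Gamma (\<alpha> + 1/2) = 0"
    then have "\<alpha> + 1/2 \<in> \<int>\<^sub>\<le>\<^sub>0" by (simp add: Gamma_eq_zero_iff)
    then obtain n where "\<alpha> + 1/2 = - real n" by (elim nonpos_Ints_cases')
    then show False using assms by (cases n) auto
  qed
  moreover have "Gamma (\<alpha> + 1) > 0" "Gamma (real i + (\<alpha> + 1)) > 0"
    using assms by (auto intro!: Gamma_real_pos)
  moreover have "pochhammer (1/2 :: real) i = Gamma (real i + 1/2) / sqrt pi"
    using pochhammer_Gamma_real[of "1/2" i] by (simp add: Gamma_one_half_real)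
  moreover have "pochhammer (\<alpha> + 1) i = Gamma (real i + (\<alpha> + 1)) / Gamma (\<alpha> + 1)"
    using assms by (intro pochhammer_Gamma_real) simp
  moreover have "real i + 1/2 + (\<alpha> + 1/2) = real i + (\<alpha> + 1)" by simp
  ultimately show ?thesis
    by (simp only: pi_moment_def Beta_def) simp
qed

lemma deriv_Pi_fun:
  assumes "-1 < u" "u < 1"
  shows "deriv (Pi_fun \<alpha>) u = Gamma (\<alpha> + 1) / (sqrt pi * Gamma (\<alpha> + 1/2)) * (1 - u\<^sup>2) powr (\<alpha> - 1/2)"
proof -
  \<comment> \<open>The interval \<open>[-d, d]\<close> contains \<open>0\<close> and \<open>u\<close> and avoids the singularities at \<open>-1\<close> and \<open>1\<close>.\<close>
  define d where "d = (1 + \<bar>u\<bar>) / 2"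
  have d: "\<bar>u\<bar> < d" "d < 1" using assms by (auto simp: d_def)
  have "continuous_on {-d..d} (\<lambda>w. (1 - w\<^sup>2) powr (\<alpha> - 1/2))"
  proof (intro continuous_intros ballI)
    fix w assume "w \<in> {-d..d}"
    then have "\<bar>w\<bar> < 1" using d by auto
    then show "1 - w\<^sup>2 \<noteq> 0" by (auto simp: power2_eq_1_iff)
  qed
  then have "((\<lambda>x. LBINT w=ereal 0..ereal x. (1 - w\<^sup>2) powr (\<alpha> - 1/2)) has_vector_derivative
      (1 - u\<^sup>2) powr (\<alpha> - 1/2)) (at u within {-d..d})"
    using d by (intro interval_integral_FTC2) auto
  moreover have "at u within {-d..d} = at u"
    using d by (intro at_within_Icc_at) auto
  ultimately have "((\<lambda>x. LBINT w=ereal 0..ereal x. (1 - w\<^sup>2) powr (\<alpha> - 1/2)) has_real_derivative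
      (1 - u\<^sup>2) powr (\<alpha> - 1/2)) (at u)"
    by (simp add: has_real_derivative_iff_has_vector_derivative)
  then have "(Pi_fun \<alpha> has_real_derivative
     Gamma (\<alpha> + 1) / (sqrt pi * Gamma (\<alpha> + 1/2)) * (1 - u\<^sup>2) powr (\<alpha> - 1/2)) (at u)"
    unfolding Pi_fun_def by (rule DERIV_cmult)
  then show ?thesis by (rule DERIV_imp_deriv)
qed

text \<open>
  For \<open>\<alpha> > -1/2\<close> the even moments are normalised Beta values. For the two point masses at
  \<open>\<alpha> = -1/2\<close> they equal \<open>1 = (1/2)\<^sub>i / (1/2)\<^sub>i\<close>.
\<close>
lemma has_moments_Pi_measure:
  assumes "\<alpha> \<ge> -1/2"
  shows "has_moments (Pi_measure \<alpha>) (\<lambda>_. 1) (pi_moment \<alpha>)"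
proof (cases "\<alpha> = -1/2")
  case True
  let ?M = "point_measure {-1, 1::real} (\<lambda>_. ennreal (1/2))"
  have Pi: "Pi_measure \<alpha> = distr ?M borel (\<lambda>x. x)" using True by (simp add: Pi_measure_def)
  have meas: "(\<lambda>x. x) \<in> measurable ?M borel"
    by (auto simp: measurable_def space_point_measure sets_point_measure)
  have "has_bochner_integral (Pi_measure \<alpha>) (\<lambda>u. indicator {-1..1} u * (u ^ j * 1)) (pi_moment \<alpha> j)" for j
    unfolding Pi
  proof (rule has_bochner_integral_distr[OF _ meas])
    have "integral\<^sup>L ?M (\<lambda>u. indicator {-1..1} u * (u ^ j * 1)) = pi_moment \<alpha> j"
      using pochhammer_pos[of "1/2 :: real" "j div 2"]
      by (subst lebesgue_integral_point_measure_finite) (auto simp: pi_moment_def True minus_one_power_iff)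
    moreover have "integrable ?M (\<lambda>u. indicator {-1..1} u * (u ^ j * 1 :: real))"
      by (rule integrable_point_measure_finite) auto
    ultimately show "has_bochner_integral ?M (\<lambda>x. indicator {-1..1} x * (x ^ j * 1)) (pi_moment \<alpha> j)"
      by (simp add: has_bochner_integral_iff)
  qed measurable
  moreover have "finite_measure (Pi_measure \<alpha>)"
    unfolding Pi
  proof (rule finite_measure.finite_measure_distr[OF finite_measureI meas])
    have "emeasure ?M (space ?M) = (\<Sum>a\<in>{-1, 1::real}. ennreal (1/2))"
      unfolding space_point_measure by (rule emeasure_point_measure_finite) auto
    also have "\<dots> = ennreal (\<Sum>a\<in>{-1, 1::real}. 1/2)" by (rule sum_ennreal) simp
    finally show "emeasure ?M (space ?M) \<noteq> \<infinity>" by (simp only: infinity_ennreal_def ennreal_neq_top not_False_eq_True)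
  qed
  ultimately show ?thesis
    by (auto simp: has_moments_def Pi finite_measure_def)
next
  case False
  then have \<alpha>: "\<alpha> > -1/2" using assms by simp
  define c where "c = Gamma (\<alpha> + 1) / (sqrt pi * Gamma (\<alpha> + 1/2))"
  have c: "c > 0" using \<alpha> by (auto simp: c_def intro!: divide_pos_pos mult_pos_pos Gamma_real_pos)
  define \<rho> where "\<rho> u = c * (indicator {-1..1} u * (1 - u\<^sup>2) powr (\<alpha> - 1/2))" for u :: real
  have \<rho>: "\<rho> u \<ge> 0" for u using c by (simp add: \<rho>_def)
  have [measurable]: "\<rho> \<in> borel_measurable borel" by (simp add: \<rho>_def[abs_def])
  \<comment> \<open>At \<open>u = -1\<close> and \<open>u = 1\<close> both sides are \<open>0\<close>, because \<open>0 powr b = 0\<close> for every \<open>b\<close>.\<close>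
  have "indicator {-1<..<1} u * ennreal (deriv (Pi_fun \<alpha>) u) = ennreal (\<rho> u)" for u
    by (cases "u = -1 \<or> u = 1") (auto simp: \<rho>_def c_def deriv_Pi_fun indicator_def)
  then have Pi: "Pi_measure \<alpha> = density lborel (\<lambda>u. ennreal (\<rho> u))"
    using False by (simp add: Pi_measure_def)
  have int0: "integrable lborel (\<lambda>u::real. indicator {-1..1} u * (1 - u\<^sup>2) powr (\<alpha> - 1/2))"
    using has_bochner_integral_one_diff_square_powr[of "\<alpha> - 1/2"] \<alpha> by (simp add: has_bochner_integral_iff)
  have lb: "has_bochner_integral lborel (\<lambda>u. indicator {-1..1} u * (u ^ j * (1 - u\<^sup>2) powr (\<alpha> - 1/2)))
     (pi_moment \<alpha> j / c)" for j
  proof (cases "even j")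
    case True
    then obtain i where j: "j = 2 * i" by (elim evenE)
    have "c * Beta (real i + 1/2) (\<alpha> + 1/2) = pi_moment \<alpha> j"
      using pi_moment_eq_Beta[of \<alpha> i] \<alpha> by (simp add: c_def j)
    then have "Beta (real i + 1/2) (\<alpha> + 1/2) = pi_moment \<alpha> j / c"
      using c by (simp add: nonzero_eq_divide_eq mult.commute)
    moreover have "has_bochner_integral lborel (\<lambda>u. indicator {-1..1} u * (u ^ j * (1 - u\<^sup>2) powr (\<alpha> - 1/2)))
        (Beta (real i + 1/2) (\<alpha> - 1/2 + 1))"
      unfolding j using \<alpha> by (intro has_bochner_integral_even_moment) simp
    moreover have "\<alpha> - 1/2 + 1 = \<alpha> + 1/2" by simp
    ultimately show ?thesis by (simp only:)
  next
    case False
    then have "has_bochner_integral lborel (\<lambda>u. indicator {-1..1} u * (u ^ j * (1 - u\<^sup>2) powr (\<alpha> - 1/2))) 0"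
      using integrable_power_mult[OF int0, of j]
      by (intro has_bochner_integral_odd_zero) (auto simp: indicator_def)
    then show ?thesis using False by (simp add: pi_moment_def)
  qed
  have "has_bochner_integral (Pi_measure \<alpha>) (\<lambda>u. indicator {-1..1} u * (u ^ j * 1)) (pi_moment \<alpha> j)" for j
    unfolding Pi
  proof (rule has_bochner_integral_density)
    have "has_bochner_integral lborel (\<lambda>u. c * (indicator {-1..1} u * (u ^ j * (1 - u\<^sup>2) powr (\<alpha> - 1/2))))
      (c * (pi_moment \<alpha> j / c))"
      by (intro has_bochner_integral_mult_right lb)
    moreover have "c * (indicator {-1..1} u * (u ^ j * (1 - u\<^sup>2) powr (\<alpha> - 1/2)))
      = \<rho> u *\<^sub>R (indicator {-1..1} u * (u ^ j * 1))" for u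
      by (simp add: \<rho>_def indicator_def)
    ultimately show "has_bochner_integral lborel (\<lambda>u. \<rho> u *\<^sub>R (indicator {-1..1} u * (u ^ j * 1))) (pi_moment \<alpha> j)"
      using c by simp
  qed (use \<rho> in auto)
  moreover have "finite_measure (Pi_measure \<alpha>)"
  proof (rule finite_measureI)
    have "integrable lborel \<rho>" unfolding \<rho>_def by (intro integrable_mult_right int0)
    then have "(\<integral>\<^sup>+u. ennreal (\<rho> u) \<partial>lborel) = ennreal (integral\<^sup>L lborel \<rho>)"
      using \<rho> by (intro nn_integral_eq_integral) auto
    then show "emeasure (Pi_measure \<alpha>) (space (Pi_measure \<alpha>)) \<noteq> \<infinity>"
      by (simp add: Pi emeasure_density)
  qed
  ultimately show ?thesis
    by (auto simp: has_moments_def Pi finite_measure_def)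
qed

section \<open>Moments of the signed measures\<close>

lemma has_bochner_integral_half_even_moment:
  assumes "b > -1"
  shows "has_bochner_integral lborel (\<lambda>u::real. indicator {0..1} u * (u ^ (2 * i) * (1 - u\<^sup>2) powr b))
    (Beta (real i + 1/2) (b + 1) / 2)"
proof -
  define f where "f u = u ^ (2 * i) * (1 - u\<^sup>2) powr b" for u :: real
  have full: "has_bochner_integral lborel (\<lambda>u::real. indicator {-1..1} u * f u) (Beta (real i + 1/2) (b + 1))"
    unfolding f_def by (rule has_bochner_integral_even_moment[OF assms])
  have "integrable lborel (\<lambda>u. indicator {0..1} u * (indicator {-1..1} u * f u))"
    using full integrable_real_mult_indicator[of "{0..1}" lborel "\<lambda>u. indicator {-1..1} u * f u"]
    by (simp add: has_bochner_integral_iff mult.commute)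
  also have "(\<lambda>u. indicator {0..1} u * (indicator {-1..1} u * f u)) = (\<lambda>u. indicator {0..1} u * f u)"
    by (auto simp: indicator_def)
  finally have half: "has_bochner_integral lborel (\<lambda>u. indicator {0..1} u * f u) (\<integral>u. indicator {0..1} u * f u \<partial>lborel)"
    (is "has_bochner_integral _ _ ?I")
    by (simp add: has_bochner_integral_iff)
  have twice: "has_bochner_integral lborel (\<lambda>u. indicator {0..1} u * f u + indicator {0..1} (- u) * f (- u)) (?I + ?I)"
    by (intro has_bochner_integral_add half has_bochner_integral_uminus_arg[OF half])
  \<comment> \<open>The two halves overlap at \<open>0\<close>.\<close>
  moreover have "AE u in lborel. indicator {0..1} u * f u + indicator {0..1} (- u) * f (- u) = indicator {-1..1} u * f u"
    using AE_lborel_singleton[of "0::real"] by eventually_elim (auto simp: indicator_def f_def)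
  ultimately have "has_bochner_integral lborel (\<lambda>u. indicator {-1..1} u * f u) (?I + ?I)"
    using has_bochner_integral_cong_AE[OF twice[THEN borel_measurable_has_bochner_integral]
      full[THEN borel_measurable_has_bochner_integral]] by blast
  then have "?I = Beta (real i + 1/2) (b + 1) / 2"
    using full by (simp add: has_bochner_integral_iff)
  from half[unfolded this] show ?thesis by (simp only: f_def)
qed

text \<open>
  The function \<open>\<Pi>\<^sub>\<alpha>\<close> on \<open>[0, 1]\<close> for \<open>a = \<alpha> - 1/2\<close>, without its normalising constant.
\<close>
definition half_Pi :: "real \<Rightarrow> real \<Rightarrow> real" where
  "half_Pi a u = (LBINT w:{0..u}. (1 - w\<^sup>2) powr a)"

lemma half_Pi_measurable [measurable]: "half_Pi a \<in> borel_measurable borel"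
proof -
  have "half_Pi a = (\<lambda>u. \<integral>w. (if 0 \<le> w \<and> w \<le> u then (1 - w\<^sup>2) powr a else 0) \<partial>lborel)"
    unfolding half_Pi_def[abs_def] set_lebesgue_integral_def
    by (intro ext Bochner_Integration.integral_cong) (auto simp: indicator_def)
  then show ?thesis by simp
qed

lemma nn_integral_half_Pi:
  assumes "0 \<le> u" "u < 1"
  shows "(\<integral>\<^sup>+w. ennreal (indicator {0..u} w * (1 - w\<^sup>2) powr a) \<partial>lborel) = ennreal (half_Pi a u)"
proof -
  have "continuous_on {0..u} (\<lambda>w. (1 - w\<^sup>2) powr a)"
  proof (intro continuous_intros ballI)
    fix w assume "w \<in> {0..u}"
    then have "\<bar>w\<bar> < 1" using assms by auto
    then show "1 - w\<^sup>2 \<noteq> 0" by (auto simp: power2_eq_1_iff)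
  qed
  then have "set_integrable lborel {0..u} (\<lambda>w. (1 - w\<^sup>2) powr a)"
    by (rule borel_integrable_atLeastAtMost')
  then show ?thesis
    unfolding set_integrable_def half_Pi_def set_lebesgue_integral_def
    by (subst nn_integral_eq_integral) auto
qed

lemma half_Pi_nonneg: "half_Pi a u \<ge> 0"
  unfolding half_Pi_def set_lebesgue_integral_def by (intro integral_nonneg_AE) auto

text \<open>
  Tonelli's theorem on the triangle \<open>0 \<le> w \<le> u \<le> 1\<close>: integrating \<open>u\<^sup>j (1 - w\<^sup>2)\<^sup>a\<close> in \<open>w\<close> first gives the
  left side, in \<open>u\<close> first the right side. The new factor \<open>1 - w\<^sup>j\<^sup>+\<^sup>1\<close> tempers the
  singularity at \<open>w = 1\<close>, which yields integrability and the moments at the same time.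
\<close>
lemma nn_integral_power_half_Pi:
  "(\<integral>\<^sup>+u. ennreal (indicator {0..1} u * (u ^ j * half_Pi a u)) \<partial>lborel)
   = (\<integral>\<^sup>+w. ennreal (indicator {0..1} w * ((1 - w\<^sup>2) powr a * (1 - w ^ Suc j) / real (Suc j))) \<partial>lborel)"
proof -
  define H where "H w u = (if 0 \<le> w \<and> w \<le> u \<and> u \<le> 1 then u ^ j * (1 - w\<^sup>2) powr a else 0)" for w u :: real
  have [measurable]: "case_prod H \<in> borel_measurable (lborel \<Otimes>\<^sub>M lborel)"
    unfolding H_def[abs_def] case_prod_beta' by measurable
  have "(\<integral>\<^sup>+u. ennreal (indicator {0..1} u * (u ^ j * half_Pi a u)) \<partial>lborel)
    = (\<integral>\<^sup>+u. (\<integral>\<^sup>+w. ennreal (H w u) \<partial>lborel) \<partial>lborel)"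
  proof (rule nn_integral_cong_AE)
    \<comment> \<open>The point \<open>u = 1\<close> is left out: for \<open>a \<le> -1\<close> the integral \<open>half_Pi a 1\<close> diverges and has the default value \<open>0\<close>.\<close>
    show "AE u in lborel. ennreal (indicator {0..1} u * (u ^ j * half_Pi a u)) = (\<integral>\<^sup>+w. ennreal (H w u) \<partial>lborel)"
      using AE_lborel_singleton[of "1::real"]
    proof eventually_elim
      case (elim u)
      show ?case
      proof (cases "u \<in> {0..1}")
        case True
        then have u: "0 \<le> u" "u < 1" using elim by auto
        have "(\<integral>\<^sup>+w. ennreal (H w u) \<partial>lborel)
          = (\<integral>\<^sup>+w. ennreal (u ^ j) * ennreal (indicator {0..u} w * (1 - w\<^sup>2) powr a) \<partial>lborel)"
          using u by (intro nn_integral_cong) (auto simp: H_def indicator_def simp flip: ennreal_mult)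
        also have "\<dots> = ennreal (u ^ j) * ennreal (half_Pi a u)"
          by (subst nn_integral_cmult) (auto simp: nn_integral_half_Pi[OF u])
        finally show ?thesis using True u half_Pi_nonneg[of a u] by (simp flip: ennreal_mult)
      next
        case False
        then have "H w u = 0" for w by (auto simp: H_def)
        then show ?thesis using False by simp
      qed
    qed
  qed
  also have "\<dots> = (\<integral>\<^sup>+w. (\<integral>\<^sup>+u. ennreal (H w u) \<partial>lborel) \<partial>lborel)"
    by (rule lborel_pair.Fubini'[of "\<lambda>w u. ennreal (H w u)"]) measurable
  also have "\<dots> = (\<integral>\<^sup>+w. ennreal (indicator {0..1} w * ((1 - w\<^sup>2) powr a * (1 - w ^ Suc j) / real (Suc j))) \<partial>lborel)"
  proof (intro nn_integral_cong)
    fix w :: real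
    show "(\<integral>\<^sup>+u. ennreal (H w u) \<partial>lborel)
      = ennreal (indicator {0..1} w * ((1 - w\<^sup>2) powr a * (1 - w ^ Suc j) / real (Suc j)))"
    proof (cases "w \<in> {0..1}")
      case True
      have "has_bochner_integral lborel (\<lambda>u. u ^ j * indicator {w..1} u) ((1 - w ^ Suc j) / real (Suc j))"
        using True integral_power[of w 1 j]
          borel_integrable_atLeastAtMost'[OF continuous_on_power[OF continuous_on_id], of w 1 j]
        by (simp add: has_bochner_integral_iff set_integrable_def mult.commute)
      then have "has_bochner_integral lborel (\<lambda>u. (1 - w\<^sup>2) powr a * (u ^ j * indicator {w..1} u))
          ((1 - w\<^sup>2) powr a * ((1 - w ^ Suc j) / real (Suc j)))"
        by (rule has_bochner_integral_mult_right)
      moreover have "(1 - w\<^sup>2) powr a * (u ^ j * indicator {w..1} u) = H w u" for u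
        using True by (auto simp: H_def indicator_def)
      ultimately have "has_bochner_integral lborel (H w) ((1 - w\<^sup>2) powr a * ((1 - w ^ Suc j) / real (Suc j)))"
        by simp
      then have "(\<integral>\<^sup>+u. ennreal (H w u) \<partial>lborel) = ennreal ((1 - w\<^sup>2) powr a * ((1 - w ^ Suc j) / real (Suc j)))"
        using True by (subst nn_integral_eq_integral) (auto simp: has_bochner_integral_iff H_def)
      then show ?thesis using True by simp
    next
      case False
      then have "H w u = 0" for u by (auto simp: H_def)
      then show ?thesis using False by simp
    qed
  qed
  finally show ?thesis .
qed

text \<open>
  For \<open>j = 0\<close> the right side of Tonelli's identity is dominated by \<open>(1 - w\<^sup>2)\<^sup>a\<^sup>+\<^sup>1\<close>, with an exponent above
  \<open>-1\<close>.
\<close>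
lemma integrable_power_half_Pi:
  assumes "a > -2"
  shows "integrable lborel (\<lambda>u. indicator {0..1} u * (u ^ j * half_Pi a u))"
proof -
  have i: "integrable lborel (\<lambda>u::real. indicator {0..1} u * (1 - u\<^sup>2) powr (a + 1))"
    using has_bochner_integral_half_even_moment[of "a + 1" 0] assms by (simp add: has_bochner_integral_iff)
  have "integrable lborel (\<lambda>u. indicator {0..1} u * (u ^ 0 * half_Pi a u))"
  proof (rule integrableI_nonneg)
    have "(\<integral>\<^sup>+w. ennreal (indicator {0..1} w * ((1 - w\<^sup>2) powr a * (1 - w ^ Suc 0) / real (Suc 0))) \<partial>lborel)
      \<le> (\<integral>\<^sup>+u. ennreal (indicator {0..1} u * (1 - u\<^sup>2) powr (a + 1)) \<partial>lborel)"
    proof (intro nn_integral_mono ennreal_leI)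
      fix w :: real
      show "indicator {0..1} w * ((1 - w\<^sup>2) powr a * (1 - w ^ Suc 0) / real (Suc 0))
          \<le> indicator {0..1} w * (1 - w\<^sup>2) powr (a + 1)"
      proof (cases "w \<in> {0..1}")
        case True
        then have "(1 - w\<^sup>2) powr a * (1 - w) \<le> (1 - w\<^sup>2) powr a * (1 - w\<^sup>2)"
          by (intro mult_left_mono) (auto simp: power2_eq_square mult_left_le)
        then show ?thesis using True one_diff_square_powr_Suc[of w a] by (simp add: mult.commute)
      qed simp
    qed
    also have "\<dots> = ennreal (\<integral>u. indicator {0..1} u * (1 - u\<^sup>2) powr (a + 1) \<partial>lborel)"
      by (intro nn_integral_eq_integral i) auto
    also have "\<dots> < \<infinity>" by simp
    finally show "(\<integral>\<^sup>+u. ennreal (indicator {0..1} u * (u ^ 0 * half_Pi a u)) \<partial>lborel) < \<infinity>"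
      unfolding nn_integral_power_half_Pi .
  qed (auto simp: half_Pi_nonneg)
  then show ?thesis
    by (intro integrable_power_mult) auto
qed

lemma sum_Beta_telescope:
  fixes b :: real
  assumes "b \<notin> \<int>\<^sub>\<le>\<^sub>0"
  shows "(\<Sum>l<n. Beta (real l + 1/2) (b + 1)) = Beta (1/2) b - Beta (real n + 1/2) b"
proof (induction n)
  case (Suc n)
  then show ?case using Beta_diff[of "real n + 1/2" b] assms by (simp add: add_ac)
qed simp

text \<open>
  The factor \<open>1 - w\<^sup>2\<^sup>n\<close> is \<open>1 - w\<^sup>2\<close> times a geometric sum, so the integral is a sum of Beta values with
  second argument \<open>a + 2\<close>. It telescopes to a difference of Beta values with the (possibly negative)
  second argument \<open>a + 1\<close>.
\<close>
lemma has_bochner_integral_odd_half_Pi: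
  assumes "-2 < a" "a + 1 \<notin> \<int>\<^sub>\<le>\<^sub>0" "n > 0"
  shows "has_bochner_integral lborel (\<lambda>u. indicator {0..1} u * (u ^ (2 * n - 1) * half_Pi a u))
     ((Beta (1/2) (a + 1) - Beta (real n + 1/2) (a + 1)) / (4 * real n))"
proof -
  let ?f = "\<lambda>w::real. indicator {0..1} w * ((1 - w\<^sup>2) powr a * (1 - w ^ Suc (2 * n - 1)) / real (Suc (2 * n - 1)))"
  have n: "Suc (2 * n - 1) = 2 * n" using assms by simp
  have "has_bochner_integral lborel
      (\<lambda>w::real. (\<Sum>l<n. indicator {0..1} w * (w ^ (2 * l) * (1 - w\<^sup>2) powr (a + 1))) / real (2 * n))
      ((\<Sum>l<n. Beta (real l + 1/2) (a + 1 + 1) / 2) / real (2 * n))"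
    using assms by (intro has_bochner_integral_divide_zero has_bochner_integral_sum has_bochner_integral_half_even_moment) auto
  moreover have "(\<Sum>l<n. indicator {0..1} w * (w ^ (2 * l) * (1 - w\<^sup>2) powr (a + 1))) / real (2 * n) = ?f w" for w :: real
  proof (cases "w \<in> {0..1}")
    case True
    have "(\<Sum>l<n. w ^ (2 * l) * (1 - w\<^sup>2) powr (a + 1)) = (1 - w\<^sup>2) powr a * ((1 - w\<^sup>2) * (\<Sum>l<n. (w\<^sup>2) ^ l))"
      using True one_diff_square_powr_Suc[of w a]
      by (simp add: sum_distrib_left sum_distrib_right power_mult[symmetric] mult_ac)
    also have "(1 - w\<^sup>2) * (\<Sum>l<n. (w\<^sup>2) ^ l) = 1 - w ^ (2 * n)"
      by (simp add: one_diff_power_eq[symmetric] power_mult)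
    finally show ?thesis using True unfolding n by simp
  qed simp
  moreover have "(\<Sum>l<n. Beta (real l + 1/2) (a + 1 + 1) / 2) / real (2 * n)
     = (Beta (1/2) (a + 1) - Beta (real n + 1/2) (a + 1)) / (4 * real n)"
    using sum_Beta_telescope[OF assms(2), of n] by (simp flip: sum_divide_distrib)
  ultimately have f: "has_bochner_integral lborel ?f ((Beta (1/2) (a + 1) - Beta (real n + 1/2) (a + 1)) / (4 * real n))"
    (is "has_bochner_integral _ _ ?V")
    by simp
  have f0: "?f w \<ge> 0" for w
  proof (cases "w \<in> {0..1}")
    case True
    then have "1 - w ^ (2 * n) \<ge> 0" using power_le_one[of w "2 * n"] by simp
    then show ?thesis unfolding n by (intro mult_nonneg_nonneg divide_nonneg_nonneg) auto
  qed simp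
  have V: "?V \<ge> 0"
  proof -
    have "integral\<^sup>L lborel ?f \<ge> 0" by (intro integral_nonneg_AE AE_I2 f0)
    then show ?thesis using f by (simp only: has_bochner_integral_iff)
  qed
  have "(\<integral>\<^sup>+w. ennreal (?f w) \<partial>lborel) = ennreal ?V"
    using f nn_integral_eq_integral[of lborel ?f, OF _ AE_I2[OF f0]]
    by (simp only: has_bochner_integral_iff)
  then show ?thesis
    using V unfolding nn_integral_power_half_Pi[symmetric]
    by (intro has_bochner_integral_nn_integral) (auto simp: half_Pi_nonneg indicator_def)
qed

lemma Pi_fun_nonneg_arg:
  "u \<ge> 0 \<Longrightarrow> Pi_fun \<alpha> u = Gamma (\<alpha> + 1) / (sqrt pi * Gamma (\<alpha> + 1/2)) * half_Pi (\<alpha> - 1/2) u"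
  by (simp add: Pi_fun_def half_Pi_def interval_integral_Icc zero_ereal_def)

lemma Pi_fun_minus: "Pi_fun \<alpha> (- u) = - Pi_fun \<alpha> u"
proof -
  let ?f = "\<lambda>w::real. (1 - w\<^sup>2) powr (\<alpha> - 1/2)"
  have "(LBINT w=ereal 0..ereal (- u). ?f w) = (LBINT w=ereal u..ereal 0. ?f w)"
    using interval_integral_reflect[of "ereal 0" "ereal (- u)" ?f] by simp
  also have "\<dots> = - (LBINT w=ereal 0..ereal u. ?f w)"
    by (rule interval_integral_endpoints_reverse)
  finally show ?thesis by (simp add: Pi_fun_def)
qed

text \<open>
  Chosen so that \<open>j \<kappa>(j - 1)\<close> is the difference between the moments of \<open>d\<Pi>\<^sub>-\<^sub>1\<^sub>/\<^sub>2\<close> and the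
  sequence \<open>pi_moment \<alpha>\<close>.
\<close>
definition kappa_moment :: "real \<Rightarrow> nat \<Rightarrow> real" where
  "kappa_moment \<alpha> j = (if odd j then (1 - pi_moment \<alpha> (Suc j)) / real (Suc j) else 0)"

lemma pi_moment_minus_half: "pi_moment (-1/2) j = (if even j then 1 else 0)"
  using pochhammer_pos[of "1/2 :: real" "j div 2"] by (simp add: pi_moment_def)

lemma pi_moment_split: "pi_moment \<alpha> j = pi_moment (-1/2) j - real j * kappa_moment \<alpha> (j - 1)"
proof (cases "even j")
  case True
  then show ?thesis unfolding pi_moment_minus_half
    by (cases j) (auto simp: kappa_moment_def pi_moment_def[of \<alpha> 0] simp del: of_nat_Suc)
next
  case False
  then show ?thesis unfolding pi_moment_minus_half
    by (cases j) (auto simp: kappa_moment_def pi_moment_def)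
qed

text \<open>
  As \<open>\<Pi>\<^sub>\<alpha>\<close> is odd, its moments on \<open>[-1, 1]\<close> are twice those on \<open>[0, 1]\<close> in odd degree and \<open>0\<close> in even
  degree. The Beta values on \<open>[0, 1]\<close> become \<open>1\<close> and \<open>pi_moment \<alpha> (2n)\<close> after normalisation.
\<close>
lemma has_moments_Pi_fun:
  assumes "-1 < \<alpha>" "\<alpha> < -1/2"
  shows "has_moments lborel (Pi_fun \<alpha>) (kappa_moment \<alpha>)"
proof -
  define c where "c = Gamma (\<alpha> + 1) / (sqrt pi * Gamma (\<alpha> + 1/2))"
  define h where "h j u = indicator {0..1} u * (u ^ j * half_Pi (\<alpha> - 1/2) u)" for j u
  have full: "indicator {-1..1} u * (u ^ j * Pi_fun \<alpha> u) = c * (h j u - (-1) ^ j * h j (- u))" for j u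
  proof (cases "u > 0")
    case True
    then show ?thesis by (auto simp: h_def c_def Pi_fun_nonneg_arg indicator_def)
  next
    case False
    have "Pi_fun \<alpha> u = - (c * half_Pi (\<alpha> - 1/2) (- u))"
      using Pi_fun_minus[of \<alpha> "- u"] Pi_fun_nonneg_arg[of "- u" \<alpha>] False by (simp add: c_def)
    moreover have "u ^ j = (-1) ^ j * (- u) ^ j" by (simp flip: power_mult_distrib)
    moreover have "half_Pi (\<alpha> - 1/2) 0 = 0"
    proof -
      have "half_Pi (\<alpha> - 1/2) 0 = (LBINT w=ereal 0..ereal 0. (1 - w\<^sup>2) powr (\<alpha> - 1/2))"
        unfolding half_Pi_def by (rule interval_integral_Icc[symmetric]) simp
      then show ?thesis by simp
    qed
    ultimately show ?thesis using False by (cases "u = 0") (auto simp: h_def indicator_def)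
  qed
  have "has_bochner_integral lborel (\<lambda>u. indicator {-1..1} u * (u ^ j * Pi_fun \<alpha> u)) (kappa_moment \<alpha> j)" for j
  proof -
    define I where "I = integral\<^sup>L lborel (h j)"
    have h: "has_bochner_integral lborel (h j) I"
      using integrable_power_half_Pi[of "\<alpha> - 1/2" j] assms
      by (simp add: has_bochner_integral_iff I_def h_def[abs_def])
    have "has_bochner_integral lborel (\<lambda>u. c * (h j u - (-1) ^ j * h j (- u))) (c * (I - (-1) ^ j * I))"
      by (intro has_bochner_integral_mult_right has_bochner_integral_diff h has_bochner_integral_uminus_arg[OF h])
    moreover have "c * (I - (-1) ^ j * I) = kappa_moment \<alpha> j"
    proof (cases "even j")
      case True
      then show ?thesis by (simp add: kappa_moment_def)
    next
      case False
      then obtain i where "j = 2 * i + 1" by (elim oddE)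
      define n where "n = Suc i"
      have j: "j = 2 * n - 1" "n > 0" "Suc j = 2 * n" by (simp_all add: n_def \<open>j = 2 * i + 1\<close>)
      have ne: "\<alpha> - 1/2 + 1 \<notin> \<int>\<^sub>\<le>\<^sub>0"
      proof
        assume "\<alpha> - 1/2 + 1 \<in> \<int>\<^sub>\<le>\<^sub>0"
        then obtain k where "\<alpha> - 1/2 + 1 = - real k" by (elim nonpos_Ints_cases')
        then show False using assms by (cases k) auto
      qed
      have e: "\<alpha> - 1/2 + 1 = \<alpha> + 1/2" by simp
      have I: "I = (Beta (1/2) (\<alpha> + 1/2) - Beta (real n + 1/2) (\<alpha> + 1/2)) / (4 * real n)"
        using has_bochner_integral_odd_half_Pi[OF _ ne j(2)] h assms unfolding e
        by (simp add: h_def[abs_def] j(1) has_bochner_integral_iff)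
      have "c * Beta (real k + 1/2) (\<alpha> + 1/2) = pi_moment \<alpha> (2 * k)" for k
        using pi_moment_eq_Beta[of \<alpha> k] assms by (simp add: c_def)
      from this[of 0] this[of n] have cB: "c * Beta (1/2) (\<alpha> + 1/2) = 1" "c * Beta (real n + 1/2) (\<alpha> + 1/2) = pi_moment \<alpha> (2 * n)"
        by (simp_all add: pi_moment_def)
      have "c * (2 * I) = (c * Beta (1/2) (\<alpha> + 1/2) - c * Beta (real n + 1/2) (\<alpha> + 1/2)) / (2 * real n)"
        unfolding I using j(2) by (simp add: field_simps)
      then have "c * (2 * I) = (1 - pi_moment \<alpha> (2 * n)) / (2 * real n)"
        unfolding cB .
      then show ?thesis using False j by (simp add: kappa_moment_def)
    qed
    ultimately show ?thesis unfolding full by simp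
  qed
  then show ?thesis
    by (simp add: has_moments_def sigma_finite_lborel)
qed

section \<open>The kernels as moment series\<close>

definition even_heat_coeff :: "real \<Rightarrow> real \<Rightarrow> nat \<Rightarrow> real" where
  "even_heat_coeff \<tau> a n = exp (- \<tau> * (2 * real n * (2 * real n + 2 * a + 1))) * coeff_D a n"

text \<open>
  In all uses \<open>A u + B v\<close> is \<open>q(u, v)\<close>, \<open>F\<close> is a heat kernel and \<open>K\<close> collects the factors that do not
  depend on \<open>u\<close> and \<open>v\<close>.
\<close>
definition weighted_integral where
  "weighted_integral \<mu> w1 \<nu> w2 A B K F =
     square_integral \<mu> \<nu> (\<lambda>u v. K * F (A * u + B * v) * w1 u * w2 v)"

lemma heat_H_series:
  "heat_H a \<tau> x = (\<Sum>n. even_heat_coeff \<tau> a n * poly (jacobi_poly a a (2 * n)) x)"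
  by (simp add: heat_H_def even_heat_coeff_def poly_jacobi_poly)

lemma ultra_heat_series:
  "ultra_heat a \<tau> x 1 = (\<Sum>m. exp (- \<tau> * (real m * (real m + 2 * a + 1))) * heat_coeff a m
      * poly (jacobi_poly a a m) x)"
  unfolding jacobi_heat_def heat_coeff_def poly_jacobi_poly
  by (intro arg_cong[where f = suminf] ext) (simp add: add_ac)

lemma sums_heat_H:
  assumes "\<tau> > 0" "a > -3/2" "has_moments \<mu> w1 m1" "has_moments \<nu> w2 m2" "\<bar>A\<bar> + \<bar>B\<bar> \<le> 1"
  shows "(\<lambda>n. K * (even_heat_coeff \<tau> a n * poly_moment m1 m2 A B (jacobi_poly a a (2 * n))))
    sums weighted_integral \<mu> w1 \<nu> w2 A B K (heat_H a \<tau>)"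
proof -
  obtain c where c: "summable c" "\<And>n x. \<bar>x\<bar> \<le> 1 \<Longrightarrow>
    \<bar>even_heat_coeff \<tau> a n * poly (jacobi_poly a a (2 * n)) x\<bar> \<le> c n"
    using even_series_dominated[OF assms(1,2)] unfolding even_heat_coeff_def by blast
  show ?thesis
    unfolding weighted_integral_def heat_H_series
    by (rule square_integral_series[OF assms(3-5) c])
qed

lemma sums_ultra_heat:
  assumes "\<tau> > 0" "a > -1" "has_moments \<mu> w1 m1" "has_moments \<nu> w2 m2" "\<bar>A\<bar> + \<bar>B\<bar> \<le> 1"
  shows "(\<lambda>m. K * (exp (- \<tau> * (real m * (real m + 2 * a + 1))) * heat_coeff a m
        * poly_moment m1 m2 A B (jacobi_poly a a m)))
    sums weighted_integral \<mu> w1 \<nu> w2 A B K (\<lambda>x. ultra_heat a \<tau> x 1)"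
proof -
  obtain c where c: "summable c" "\<And>m x. \<bar>x\<bar> \<le> 1 \<Longrightarrow>
    \<bar>exp (- \<tau> * (real m * (real m + 2 * a + 1))) * heat_coeff a m * poly (jacobi_poly a a m) x\<bar> \<le> c m"
    using heat_series_dominated[OF assms(1,2)] by blast
  show ?thesis
    unfolding weighted_integral_def ultra_heat_series
    by (rule square_integral_series[OF assms(3-5) c])
qed

lemma sums_even_indices:
  fixes f :: "nat \<Rightarrow> real"
  assumes "f sums s" "\<And>m. odd m \<Longrightarrow> f m = 0"
  shows "(\<lambda>n. f (2 * n)) sums s"
  using assms by (subst sums_mono_reindex) (auto simp: strict_mono_def elim!: evenE)

lemma sums_odd_indices:
  fixes f :: "nat \<Rightarrow> real"
  assumes "f sums s" "\<And>m. even m \<Longrightarrow> f m = 0"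
  shows "(\<lambda>n. f (2 * n + 1)) sums s"
proof (subst sums_mono_reindex[of "\<lambda>n. 2 * n + 1"])
  show "f m = 0" if "m \<notin> range (\<lambda>n. 2 * n + 1)" for m
    using that assms(2) by (metis oddE rangeI)
qed (use assms in \<open>auto simp: strict_mono_def\<close>)

lemma sums_from_Suc:
  fixes f :: "nat \<Rightarrow> real"
  shows "(\<lambda>n. f (Suc n)) sums s \<Longrightarrow> f 0 = 0 \<Longrightarrow> f sums s"
  using sums_Suc_iff[of f s] by simp

lemma poly_moment_ultra_poly_odd:
  assumes "a > -1" "odd m" "\<And>i k. odd (i + k) \<Longrightarrow> m1 i * m2 k = 0"
  shows "poly_moment m1 m2 A B (jacobi_poly a a m) = 0"
proof (rule poly_moment_eq_0[of False])
  fix j :: nat assume "even j \<longleftrightarrow> \<not> False"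
  then show "coeff (jacobi_poly a a m) j = 0"
    using assms(1,2) by (intro coeff_ultra_poly_parity) auto
qed (use assms(3) in auto)

lemma poly_moment_ultra_poly_even:
  assumes "a > -1" "even m" "\<And>i k. even (i + k) \<Longrightarrow> m1 i * m2 k = 0"
  shows "poly_moment m1 m2 A B (jacobi_poly a a m) = 0"
proof (rule poly_moment_eq_0[of True])
  fix j :: nat assume "even j \<longleftrightarrow> \<not> True"
  then show "coeff (jacobi_poly a a m) j = 0"
    using assms(1,2) by (intro coeff_ultra_poly_parity) auto
qed (use assms(3) in auto)

text \<open>
  Products of moments of odd total degree vanish here, so only the even terms of \<open>G\<^sup>a(\<cdot>, 1)\<close>
  contribute, and these are \<open>a + 1\<close> times the terms of \<open>H\<^sup>a\<close>.
\<close>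
lemma sums_ultra_heat_even:
  assumes "\<tau> > 0" "a > -1" "has_moments \<mu> w1 m1" "has_moments \<nu> w2 m2" "\<bar>A\<bar> + \<bar>B\<bar> \<le> 1"
    and "\<And>i k. odd (i + k) \<Longrightarrow> m1 i * m2 k = 0"
  shows "(\<lambda>n. (a + 1) * (even_heat_coeff \<tau> a n * poly_moment m1 m2 A B (jacobi_poly a a (2 * n))))
    sums weighted_integral \<mu> w1 \<nu> w2 A B 1 (\<lambda>x. ultra_heat a \<tau> x 1)"
proof -
  have "(\<lambda>n. 1 * (exp (- \<tau> * (real (2 * n) * (real (2 * n) + 2 * a + 1))) * heat_coeff a (2 * n)
        * poly_moment m1 m2 A B (jacobi_poly a a (2 * n))))
    sums weighted_integral \<mu> w1 \<nu> w2 A B 1 (\<lambda>x. ultra_heat a \<tau> x 1)"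
    by (rule sums_even_indices[OF sums_ultra_heat[OF assms(1-5)]])
      (use poly_moment_ultra_poly_odd[OF assms(2) _ assms(6)] in simp)
  moreover have "1 * (exp (- \<tau> * (real (2 * n) * (real (2 * n) + 2 * a + 1))) * heat_coeff a (2 * n)
        * poly_moment m1 m2 A B (jacobi_poly a a (2 * n)))
      = (a + 1) * (even_heat_coeff \<tau> a n * poly_moment m1 m2 A B (jacobi_poly a a (2 * n)))" for n
    unfolding heat_coeff_even[OF assms(2)] even_heat_coeff_def by simp
  ultimately show ?thesis by (simp only:)
qed

text \<open>
  With \<open>m = 2n + 2\<close>, the exponents are related by
  \<open>m (m + 2a + 1) = (m - 1) (m - 1 + 2 (a + 1) + 1) + (2a + 2)\<close>, which accounts for the factor
  \<open>exp (- \<tau> (2a + 2))\<close>.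
\<close>
lemma even_heat_coeff_pderiv:
  assumes "a > -3/2"
  shows "smult (even_heat_coeff \<tau> a (Suc n)) (pderiv (jacobi_poly a a (2 * Suc n)))
   = smult (2 * exp (- \<tau> * (2 * a + 2))
       * (exp (- \<tau> * (real (2 * n + 1) * (real (2 * n + 1) + 2 * (a + 1) + 1))) * heat_coeff (a + 1) (2 * n + 1)))
      (jacobi_poly (a + 1) (a + 1) (2 * n + 1))"
proof -
  have P: "pderiv (jacobi_poly a a (2 * Suc n))
     = smult ((real (2 * n + 1) + 2 * a + 2) / 2) (jacobi_poly (a + 1) (a + 1) (2 * n + 1))"
    using pderiv_jacobi_poly[of a a "2 * n + 1"] by (simp add: add_ac)
  have E: "exp (- \<tau> * (2 * real (Suc n) * (2 * real (Suc n) + 2 * a + 1)))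
     = exp (- \<tau> * (2 * a + 2)) * exp (- \<tau> * (real (2 * n + 1) * (real (2 * n + 1) + 2 * (a + 1) + 1)))"
    by (simp add: algebra_simps flip: exp_add)
  have "even_heat_coeff \<tau> a (Suc n) * ((real (2 * n + 1) + 2 * a + 2) / 2)
    = exp (- \<tau> * (2 * real (Suc n) * (2 * real (Suc n) + 2 * a + 1)))
       * (coeff_D a (Suc n) * ((real (2 * n + 1) + 2 * a + 2) / 2))"
    by (simp only: even_heat_coeff_def mult.assoc)
  then show ?thesis
    unfolding P smult_smult coeff_D_odd[OF assms] E by (simp only: mult_ac)
qed

lemma heat_coeff_pderiv:
  assumes "a > -1"
  shows "smult (exp (- \<tau> * (real (Suc m) * (real (Suc m) + 2 * a + 1))) * heat_coeff a (Suc m))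
     (pderiv (jacobi_poly a a (Suc m)))
   = smult (2 * (a + 1) * exp (- \<tau> * (2 * a + 2))
       * (exp (- \<tau> * (real m * (real m + 2 * (a + 1) + 1))) * heat_coeff (a + 1) m))
      (jacobi_poly (a + 1) (a + 1) m)"
proof -
  have P: "pderiv (jacobi_poly a a (Suc m))
     = smult ((real m + 2 * a + 2) / 2) (jacobi_poly (a + 1) (a + 1) m)"
    using pderiv_jacobi_poly[of a a m] by (simp add: add_ac)
  have E: "exp (- \<tau> * (real (Suc m) * (real (Suc m) + 2 * a + 1)))
     = exp (- \<tau> * (2 * a + 2)) * exp (- \<tau> * (real m * (real m + 2 * (a + 1) + 1)))"
    by (simp add: algebra_simps flip: exp_add)
  show ?thesis
    unfolding P smult_smult mult.assoc heat_coeff_Suc[OF assms] E by (simp only: mult_ac)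
qed

text \<open>
  The moment series of the derivatives is an integral of \<open>G\<^sup>a\<^sup>+\<^sup>1(\<cdot>, 1)\<close>: derivatives of even
  polynomials are odd, and by parity the even terms of the latter integrate to \<open>0\<close>.
\<close>
lemma sums_pderiv:
  assumes "\<tau> > 0" "a > -3/2" "has_moments \<mu> w1 m1" "has_moments \<nu> w2 m2" "\<bar>A\<bar> + \<bar>B\<bar> \<le> 1"
    and parity: "\<And>i k. even (i + k) \<Longrightarrow> m1 i * m2 k = 0"
    and K': "K' = K * (2 * exp (- \<tau> * (2 * a + 2)))"
  shows "(\<lambda>n. K * (even_heat_coeff \<tau> a n * poly_moment m1 m2 A B (pderiv (jacobi_poly a a (2 * n)))))
    sums weighted_integral \<mu> w1 \<nu> w2 A B K' (\<lambda>x. ultra_heat (a + 1) \<tau> x 1)"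
proof -
  let ?f = "\<lambda>n. K * (even_heat_coeff \<tau> a n * poly_moment m1 m2 A B (pderiv (jacobi_poly a a (2 * n))))"
  have a: "a + 1 > -1" using assms by simp
  have "(\<lambda>n. K' * (exp (- \<tau> * (real (2 * n + 1) * (real (2 * n + 1) + 2 * (a + 1) + 1))) * heat_coeff (a + 1) (2 * n + 1)
        * poly_moment m1 m2 A B (jacobi_poly (a + 1) (a + 1) (2 * n + 1))))
    sums weighted_integral \<mu> w1 \<nu> w2 A B K' (\<lambda>x. ultra_heat (a + 1) \<tau> x 1)"
    by (rule sums_odd_indices[OF sums_ultra_heat[OF assms(1) a assms(3-5)]])
      (use poly_moment_ultra_poly_even[OF a _ parity] in simp)
  moreover have "?f (Suc n) = K' * (exp (- \<tau> * (real (2 * n + 1) * (real (2 * n + 1) + 2 * (a + 1) + 1))) * heat_coeff (a + 1) (2 * n + 1)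
        * poly_moment m1 m2 A B (jacobi_poly (a + 1) (a + 1) (2 * n + 1)))" for n
    using arg_cong[OF even_heat_coeff_pderiv[OF assms(2), of \<tau> n], of "\<lambda>p. K * poly_moment m1 m2 A B p"]
    unfolding poly_moment_smult K' by (simp only: mult_ac)
  ultimately have "(\<lambda>n. ?f (Suc n)) sums weighted_integral \<mu> w1 \<nu> w2 A B K' (\<lambda>x. ultra_heat (a + 1) \<tau> x 1)"
    by (simp only:)
  moreover have "pderiv (jacobi_poly a a 0) = 0"
    using degree_jacobi_poly_le[of a a 0] by (simp add: pderiv_eq_0_iff)
  then have "?f 0 = 0" by simp
  ultimately show ?thesis by (intro sums_from_Suc[of ?f])
qed

text \<open>
  The exponents \<open>2a + 2\<close> and \<open>2a + 4\<close> of the two differentiations add up to \<open>4a + 6\<close>; the second one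
  contributes the factor \<open>2 (a + 2)\<close>.
\<close>
lemma sums_pderiv_pderiv:
  assumes "\<tau> > 0" "a > -3/2" "has_moments \<mu> w1 m1" "has_moments \<nu> w2 m2" "\<bar>A\<bar> + \<bar>B\<bar> \<le> 1"
    and parity: "\<And>i k. odd (i + k) \<Longrightarrow> m1 i * m2 k = 0"
    and K': "K' = K * (4 * (a + 2) * exp (- \<tau> * (4 * a + 6)))"
  shows "(\<lambda>n. K * (even_heat_coeff \<tau> a n * poly_moment m1 m2 A B (pderiv (pderiv (jacobi_poly a a (2 * n))))))
    sums weighted_integral \<mu> w1 \<nu> w2 A B K' (\<lambda>x. ultra_heat (a + 2) \<tau> x 1)"
proof -
  let ?f = "\<lambda>n. K * (even_heat_coeff \<tau> a n * poly_moment m1 m2 A B (pderiv (pderiv (jacobi_poly a a (2 * n)))))"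
  have a: "a + 1 > -1" "a + 2 > -1" using assms by simp_all
  have aa: "a + 1 + 1 = a + 2" by simp
  have "(\<lambda>n. K' * (exp (- \<tau> * (real (2 * n) * (real (2 * n) + 2 * (a + 2) + 1))) * heat_coeff (a + 2) (2 * n)
        * poly_moment m1 m2 A B (jacobi_poly (a + 2) (a + 2) (2 * n))))
    sums weighted_integral \<mu> w1 \<nu> w2 A B K' (\<lambda>x. ultra_heat (a + 2) \<tau> x 1)"
    by (rule sums_even_indices[OF sums_ultra_heat[OF assms(1) a(2) assms(3-5)]])
      (use poly_moment_ultra_poly_odd[OF a(2) _ parity] in simp)
  moreover have "?f (Suc n) = K' * (exp (- \<tau> * (real (2 * n) * (real (2 * n) + 2 * (a + 2) + 1))) * heat_coeff (a + 2) (2 * n)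
        * poly_moment m1 m2 A B (jacobi_poly (a + 2) (a + 2) (2 * n)))" for n
  proof -
    let ?c = "2 * exp (- \<tau> * (2 * a + 2))"
    let ?e = "exp (- \<tau> * (real (2 * n + 1) * (real (2 * n + 1) + 2 * (a + 1) + 1))) * heat_coeff (a + 1) (2 * n + 1)"
    let ?c' = "2 * (a + 2) * exp (- \<tau> * (2 * (a + 1) + 2))"
    let ?e' = "exp (- \<tau> * (real (2 * n) * (real (2 * n) + 2 * (a + 2) + 1))) * heat_coeff (a + 2) (2 * n)"
    have "smult (even_heat_coeff \<tau> a (Suc n)) (pderiv (pderiv (jacobi_poly a a (2 * Suc n))))
      = smult ?c (smult ?e (pderiv (jacobi_poly (a + 1) (a + 1) (Suc (2 * n)))))"
      using arg_cong[OF even_heat_coeff_pderiv[OF assms(2), of \<tau> n], of pderiv]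
      by (simp add: pderiv_smult mult.assoc)
    also have "smult ?e (pderiv (jacobi_poly (a + 1) (a + 1) (Suc (2 * n))))
      = smult (?c' * ?e') (jacobi_poly (a + 2) (a + 2) (2 * n))"
      using heat_coeff_pderiv[OF a(1), of \<tau> "2 * n"] unfolding aa by simp
    finally have "even_heat_coeff \<tau> a (Suc n) * poly_moment m1 m2 A B (pderiv (pderiv (jacobi_poly a a (2 * Suc n))))
      = ?c * ((?c' * ?e') * poly_moment m1 m2 A B (jacobi_poly (a + 2) (a + 2) (2 * n)))"
      by (metis poly_moment_smult)
    moreover have "K' = K * (?c * ?c')"
    proof -
      have "exp (- \<tau> * (4 * a + 6)) = exp (- \<tau> * (2 * a + 2)) * exp (- \<tau> * (2 * (a + 1) + 2))"
        by (simp add: algebra_simps flip: exp_add)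
      then show ?thesis by (simp add: K')
    qed
    ultimately show ?thesis by (simp only: mult_ac)
  qed
  ultimately have "(\<lambda>n. ?f (Suc n)) sums weighted_integral \<mu> w1 \<nu> w2 A B K' (\<lambda>x. ultra_heat (a + 2) \<tau> x 1)"
    by (simp only:)
  moreover have "pderiv (jacobi_poly a a 0) = 0"
    using degree_jacobi_poly_le[of a a 0] by (simp add: pderiv_eq_0_iff)
  then have "?f 0 = 0" by simp
  ultimately show ?thesis by (intro sums_from_Suc[of ?f])
qed

lemma pi_moment_odd_sum: "odd (i + k) \<Longrightarrow> pi_moment \<alpha> i * pi_moment \<beta> k = 0"
  by (auto simp: pi_moment_def)

lemma kappa_moment_odd_sum: "odd (i + k) \<Longrightarrow> kappa_moment \<alpha> i * kappa_moment \<beta> k = 0"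
  by (auto simp: kappa_moment_def)

lemma pi_kappa_moment_even_sum:
  "even (i + k) \<Longrightarrow> pi_moment \<alpha> i * kappa_moment \<beta> k = 0"
  "even (i + k) \<Longrightarrow> kappa_moment \<alpha> i * pi_moment \<beta> k = 0"
  by (auto simp: pi_moment_def kappa_moment_def)

text \<open>
  The constant \<open>C\<close> is \<open>\<lambda> + 1\<close> when the result is expressed by \<open>G\<^sup>\<lambda>\<close>, and \<open>1\<close> when it is expressed
  by \<open>H\<^sup>\<lambda>\<close>.
\<close>
lemma jacobi_heat_normalised:
  assumes "\<alpha> > -1" "\<beta> > -1" "C \<noteq> 0"
    and "A\<^sup>2 = (1 - x) / 2 * ((1 - y) / 2)" "B\<^sup>2 = (1 + x) / 2 * ((1 + y) / 2)"
    and "a = \<alpha> + \<beta> + 1/2"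
    and sums: "(\<lambda>n. C * (even_heat_coeff (t/4) a n
       * poly_moment (pi_moment \<alpha>) (pi_moment \<beta>) A B (jacobi_poly a a (2 * n)))) sums S"
  shows "C * (jacobi_h \<alpha> \<beta> 0 * const_C0 \<alpha> \<beta> * jacobi_heat \<alpha> \<beta> t x y) = S"
proof -
  have "(\<lambda>n. even_heat_coeff (t/4) a n
       * poly_moment (pi_moment \<alpha>) (pi_moment \<beta>) A B (jacobi_poly a a (2 * n))) sums (inverse C * S)"
    using sums_mult[OF sums, of "inverse C"] assms(3) by (simp flip: mult.assoc)
  then have "jacobi_h \<alpha> \<beta> 0 * const_C0 \<alpha> \<beta> * jacobi_heat \<alpha> \<beta> t x y = inverse C * S"
    using assms unfolding even_heat_coeff_def
    by (intro jacobi_heat_eq_moment_series[OF assms(1,2,4,5)]) simp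
  then show ?thesis using assms(3) by simp
qed

section \<open>The integral representations\<close>

lemma half_angle_squares:
  "(sin (\<theta>/2) * sin (\<phi>/2))\<^sup>2 = (1 - cos \<theta>) / 2 * ((1 - cos \<phi>) / 2)"
  "(cos (\<theta>/2) * cos (\<phi>/2))\<^sup>2 = (1 + cos \<theta>) / 2 * ((1 + cos \<phi>) / 2)"
  for \<theta> \<phi> :: real
  using cos_double_sin[of "\<theta>/2"] cos_double_sin[of "\<phi>/2"] cos_double_cos[of "\<theta>/2"] cos_double_cos[of "\<phi>/2"]
  by (simp_all add: power_mult_distrib)

text \<open>
  All four factors are nonnegative on the given range, and the sum is \<open>cos ((\<theta> - \<phi>)/2)\<close>.
\<close>
lemma half_angle_product_sum_le:
  assumes "\<theta> \<in> {0..pi}" "\<phi> \<in> {0..pi}"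
  shows "\<bar>sin (\<theta>/2) * sin (\<phi>/2)\<bar> + \<bar>cos (\<theta>/2) * cos (\<phi>/2)\<bar> \<le> 1"
proof -
  have "0 \<le> sin (\<theta>/2)" "0 \<le> sin (\<phi>/2)" "0 \<le> cos (\<theta>/2)" "0 \<le> cos (\<phi>/2)"
    using assms by (auto intro!: sin_ge_zero cos_ge_zero)
  then have "\<bar>sin (\<theta>/2) * sin (\<phi>/2)\<bar> + \<bar>cos (\<theta>/2) * cos (\<phi>/2)\<bar> = cos (\<theta>/2 - \<phi>/2)"
    by (simp add: cos_diff)
  then show ?thesis by simp
qed

lemma q_arg_eq: "q_arg \<theta> \<phi> u v = sin (\<theta>/2) * sin (\<phi>/2) * u + cos (\<theta>/2) * cos (\<phi>/2) * v"
  by (simp add: q_arg_def mult_ac)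

lemma jacobi_h_over_ultra_h:
  assumes "\<alpha> + \<beta> + 3/2 > 0"
  shows "jacobi_h \<alpha> \<beta> 0 / ultra_h (\<alpha> + \<beta> + 1/2) 0 * G
    = (\<alpha> + \<beta> + 3/2) * (jacobi_h \<alpha> \<beta> 0 * const_C0 \<alpha> \<beta> * G)"
proof -
  have "1 / ultra_h (\<alpha> + \<beta> + 1/2) 0 = (\<alpha> + \<beta> + 3/2) * const_C0 \<alpha> \<beta>"
    using assms by (intro inverse_ultra_h_0) simp
  then have "jacobi_h \<alpha> \<beta> 0 * (1 / ultra_h (\<alpha> + \<beta> + 1/2) 0) * G
     = jacobi_h \<alpha> \<beta> 0 * ((\<alpha> + \<beta> + 3/2) * const_C0 \<alpha> \<beta>) * G" by (simp only:)
  then show ?thesis by (simp add: mult_ac)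
qed

theorem theorem4p3:
  fixes t \<theta> \<phi> \<alpha> \<beta> :: real
  assumes "t > 0" and "\<theta> \<in> {0..pi}" and "\<phi> \<in> {0..pi}"
  shows
    "(\<alpha> \<ge> -1/2 \<and> \<beta> \<ge> -1/2 \<longrightarrow>
       jacobi_h \<alpha> \<beta> 0 / ultra_h (\<alpha> + \<beta> + 1/2) 0 * jacobi_heat \<alpha> \<beta> t (cos \<theta>) (cos \<phi>)
       = square_integral (Pi_measure \<alpha>) (Pi_measure \<beta>)
           (\<lambda>u v. ultra_heat (\<alpha> + \<beta> + 1/2) (t/4) (q_arg \<theta> \<phi> u v) 1))
   \<and> (-1 < \<beta> \<and> \<beta> < -1/2 \<and> -1/2 \<le> \<alpha> \<longrightarrow>
       jacobi_h \<alpha> \<beta> 0 / ultra_h (\<alpha> + \<beta> + 1/2) 0 * jacobi_heat \<alpha> \<beta> t (cos \<theta>) (cos \<phi>)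
       = square_integral (Pi_measure \<alpha>) lborel
           (\<lambda>u v. -2 * (\<alpha> + \<beta> + 3/2) * exp (- t * (\<alpha> + \<beta> + 3/2) / 2)
              * cos (\<theta>/2) * cos (\<phi>/2)
              * ultra_heat (\<alpha> + \<beta> + 3/2) (t/4) (q_arg \<theta> \<phi> u v) 1 * Pi_fun \<beta> v)
       + square_integral (Pi_measure \<alpha>) (Pi_measure (-1/2))
           (\<lambda>u v. ultra_heat (\<alpha> + \<beta> + 1/2) (t/4) (q_arg \<theta> \<phi> u v) 1))
   \<and> (-1 < \<alpha> \<and> \<alpha> < -1/2 \<and> -1/2 \<le> \<beta> \<longrightarrow>
       jacobi_h \<alpha> \<beta> 0 / ultra_h (\<alpha> + \<beta> + 1/2) 0 * jacobi_heat \<alpha> \<beta> t (cos \<theta>) (cos \<phi>)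
       = square_integral lborel (Pi_measure \<beta>)
           (\<lambda>u v. -2 * (\<alpha> + \<beta> + 3/2) * exp (- t * (\<alpha> + \<beta> + 3/2) / 2)
              * sin (\<theta>/2) * sin (\<phi>/2)
              * ultra_heat (\<alpha> + \<beta> + 3/2) (t/4) (q_arg \<theta> \<phi> u v) 1 * Pi_fun \<alpha> u)
       + square_integral (Pi_measure (-1/2)) (Pi_measure \<beta>)
           (\<lambda>u v. ultra_heat (\<alpha> + \<beta> + 1/2) (t/4) (q_arg \<theta> \<phi> u v) 1))
   \<and> (-1 < \<alpha> \<and> \<alpha> < -1/2 \<and> -1 < \<beta> \<and> \<beta> < -1/2 \<and> \<alpha> + \<beta> > -3/2 \<longrightarrow>
       jacobi_h \<alpha> \<beta> 0 / ultra_h (\<alpha> + \<beta> + 1/2) 0 * jacobi_heat \<alpha> \<beta> t (cos \<theta>) (cos \<phi>)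
       = square_integral lborel lborel
           (\<lambda>u v. (\<alpha> + \<beta> + 3/2) * (\<alpha> + \<beta> + 5/2) * exp (- t * (\<alpha> + \<beta> + 2))
              * sin \<theta> * sin \<phi>
              * ultra_heat (\<alpha> + \<beta> + 5/2) (t/4) (q_arg \<theta> \<phi> u v) 1 * Pi_fun \<alpha> u * Pi_fun \<beta> v)
       + square_integral lborel (Pi_measure (-1/2))
           (\<lambda>u v. -2 * (\<alpha> + \<beta> + 3/2) * exp (- t * (\<alpha> + \<beta> + 3/2) / 2)
              * sin (\<theta>/2) * sin (\<phi>/2)
              * ultra_heat (\<alpha> + \<beta> + 3/2) (t/4) (q_arg \<theta> \<phi> u v) 1 * Pi_fun \<alpha> u)
       + square_integral (Pi_measure (-1/2)) lborel
           (\<lambda>u v. -2 * (\<alpha> + \<beta> + 3/2) * exp (- t * (\<alpha> + \<beta> + 3/2) / 2)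
              * cos (\<theta>/2) * cos (\<phi>/2)
              * ultra_heat (\<alpha> + \<beta> + 3/2) (t/4) (q_arg \<theta> \<phi> u v) 1 * Pi_fun \<beta> v)
       + square_integral (Pi_measure (-1/2)) (Pi_measure (-1/2))
           (\<lambda>u v. ultra_heat (\<alpha> + \<beta> + 1/2) (t/4) (q_arg \<theta> \<phi> u v) 1))
   \<and> (-1 < \<alpha> \<and> \<alpha> < -1/2 \<and> -1 < \<beta> \<and> \<beta> < -1/2 \<and> \<alpha> + \<beta> \<le> -3/2 \<longrightarrow>
       jacobi_h \<alpha> \<beta> 0 * const_C0 \<alpha> \<beta> * jacobi_heat \<alpha> \<beta> t (cos \<theta>) (cos \<phi>)
       = square_integral lborel lborel
           (\<lambda>u v. (\<alpha> + \<beta> + 5/2) * exp (- t * (\<alpha> + \<beta> + 2))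
              * sin \<theta> * sin \<phi>
              * ultra_heat (\<alpha> + \<beta> + 5/2) (t/4) (q_arg \<theta> \<phi> u v) 1 * Pi_fun \<alpha> u * Pi_fun \<beta> v)
       + square_integral lborel (Pi_measure (-1/2))
           (\<lambda>u v. -2 * exp (- t * (\<alpha> + \<beta> + 3/2) / 2)
              * sin (\<theta>/2) * sin (\<phi>/2)
              * ultra_heat (\<alpha> + \<beta> + 3/2) (t/4) (q_arg \<theta> \<phi> u v) 1 * Pi_fun \<alpha> u)
       + square_integral (Pi_measure (-1/2)) lborel
           (\<lambda>u v. -2 * exp (- t * (\<alpha> + \<beta> + 3/2) / 2)
              * cos (\<theta>/2) * cos (\<phi>/2)
              * ultra_heat (\<alpha> + \<beta> + 3/2) (t/4) (q_arg \<theta> \<phi> u v) 1 * Pi_fun \<beta> v)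
       + square_integral (Pi_measure (-1/2)) (Pi_measure (-1/2))
           (\<lambda>u v. heat_H (\<alpha> + \<beta> + 1/2) (t/4) (q_arg \<theta> \<phi> u v)))"
proof -
  define A where "A = sin (\<theta>/2) * sin (\<phi>/2)"
  define B where "B = cos (\<theta>/2) * cos (\<phi>/2)"
  define a where "a = \<alpha> + \<beta> + 1/2"
  define \<tau> where "\<tau> = t/4"
  let ?\<delta> = "pi_moment (-1/2)"
  let ?P = "\<lambda>n. jacobi_poly a a (2 * n)"
  let ?E = "even_heat_coeff \<tau> a"
  let ?G = "jacobi_heat \<alpha> \<beta> t (cos \<theta>) (cos \<phi>)"
  let ?T = "poly_moment (pi_moment \<alpha>) (pi_moment \<beta>) A B"
  let ?W = "\<lambda>\<mu> w1 \<nu> w2. weighted_integral \<mu> w1 \<nu> w2 A B"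
  let ?one = "\<lambda>_. 1 :: real"
  have \<tau>: "\<tau> > 0" using assms(1) by (simp add: \<tau>_def)
  have AB: "\<bar>A\<bar> + \<bar>B\<bar> \<le> 1" unfolding A_def B_def by (rule half_angle_product_sum_le[OF assms(2,3)])
  have AB2: "A\<^sup>2 = (1 - cos \<theta>) / 2 * ((1 - cos \<phi>) / 2)" "B\<^sup>2 = (1 + cos \<theta>) / 2 * ((1 + cos \<phi>) / 2)"
    unfolding A_def B_def by (rule half_angle_squares)+
  have sincos: "sin \<theta> * sin \<phi> = 4 * (A * B)"
    using sin_double[of "\<theta>/2"] sin_double[of "\<phi>/2"] by (simp add: A_def B_def)
  have q: "q_arg \<theta> \<phi> u v = A * u + B * v" for u v
    by (simp add: q_arg_eq A_def B_def)
  have \<delta>: "has_moments (Pi_measure (-1/2)) ?one ?\<delta>" by (rule has_moments_Pi_measure) simp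
  have e1: "exp (- t * (\<alpha> + \<beta> + 3/2) / 2) = exp (- \<tau> * (2 * a + 2))"
    and e2: "exp (- t * (\<alpha> + \<beta> + 2)) = exp (- \<tau> * (4 * a + 6))"
    by (simp_all add: \<tau>_def a_def field_simps)
  have shift: "\<alpha> + \<beta> + 3/2 = a + 1" "\<alpha> + \<beta> + 5/2 = a + 2"
    by (simp_all add: a_def)
  have norm1: "jacobi_h \<alpha> \<beta> 0 / ultra_h (\<alpha> + \<beta> + 1/2) 0 * ?G = S"
    if "\<alpha> > -1" "\<beta> > -1" "a > -1" "(\<lambda>n. (a + 1) * (?E n * ?T (?P n))) sums S" for S
  proof -
    have "(a + 1) * (jacobi_h \<alpha> \<beta> 0 * const_C0 \<alpha> \<beta> * ?G) = S"
      using that(3) by (intro jacobi_heat_normalised[OF that(1,2) _ AB2 a_def that(4)[unfolded \<tau>_def]]) simp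
    moreover have "\<alpha> + \<beta> + 3/2 > 0" using that(3) by (simp add: shift)
    ultimately show ?thesis by (simp only: jacobi_h_over_ultra_h shift)
  qed
  have norm2: "jacobi_h \<alpha> \<beta> 0 * const_C0 \<alpha> \<beta> * ?G = S"
    if "\<alpha> > -1" "\<beta> > -1" "(\<lambda>n. 1 * (?E n * ?T (?P n))) sums S" for S
    using jacobi_heat_normalised[OF that(1,2) _ AB2 a_def that(3)[unfolded \<tau>_def]] by simp
  have I0: "?W \<mu> ?one \<nu> ?one 1 (\<lambda>x. ultra_heat a \<tau> x 1)
      = square_integral \<mu> \<nu> (\<lambda>u v. ultra_heat (\<alpha> + \<beta> + 1/2) (t/4) (q_arg \<theta> \<phi> u v) 1)" for \<mu> \<nu>
    by (simp add: weighted_integral_def q a_def \<tau>_def)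
  have IH: "?W \<mu> ?one \<nu> ?one 1 (heat_H a \<tau>)
      = square_integral \<mu> \<nu> (\<lambda>u v. heat_H (\<alpha> + \<beta> + 1/2) (t/4) (q_arg \<theta> \<phi> u v))" for \<mu> \<nu>
    by (simp add: weighted_integral_def q a_def \<tau>_def)
  have IB: "?W \<mu> ?one \<nu> w (- c * B * (2 * exp (- \<tau> * (2 * a + 2)))) (\<lambda>x. ultra_heat (a + 1) \<tau> x 1)
      = square_integral \<mu> \<nu> (\<lambda>u v. -2 * c * exp (- t * (\<alpha> + \<beta> + 3/2) / 2)
              * cos (\<theta>/2) * cos (\<phi>/2)
              * ultra_heat (\<alpha> + \<beta> + 3/2) (t/4) (q_arg \<theta> \<phi> u v) 1 * w v)" for \<mu> \<nu> w c
    unfolding e1 unfolding weighted_integral_def q shift \<tau>_def[symmetric]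
    by (intro arg_cong[where f = "square_integral \<mu> \<nu>"] ext) (simp add: B_def mult_ac)
  have IA: "?W \<mu> w \<nu> ?one (- c * A * (2 * exp (- \<tau> * (2 * a + 2)))) (\<lambda>x. ultra_heat (a + 1) \<tau> x 1)
      = square_integral \<mu> \<nu> (\<lambda>u v. -2 * c * exp (- t * (\<alpha> + \<beta> + 3/2) / 2)
              * sin (\<theta>/2) * sin (\<phi>/2)
              * ultra_heat (\<alpha> + \<beta> + 3/2) (t/4) (q_arg \<theta> \<phi> u v) 1 * w u)" for \<mu> \<nu> w c
    unfolding e1 unfolding weighted_integral_def q shift \<tau>_def[symmetric]
    by (intro arg_cong[where f = "square_integral \<mu> \<nu>"] ext) (simp add: A_def mult_ac)
  have IAB: "?W \<mu> w \<nu> w' (c * A * B * (4 * (a + 2) * exp (- \<tau> * (4 * a + 6)))) (\<lambda>x. ultra_heat (a + 2) \<tau> x 1)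
      = square_integral \<mu> \<nu> (\<lambda>u v. c * (\<alpha> + \<beta> + 5/2) * exp (- t * (\<alpha> + \<beta> + 2))
              * sin \<theta> * sin \<phi>
              * ultra_heat (\<alpha> + \<beta> + 5/2) (t/4) (q_arg \<theta> \<phi> u v) 1 * w u * w' v)" for \<mu> \<nu> w w' c
  proof -
    have "c * (a + 2) * exp (- \<tau> * (4 * a + 6)) * sin \<theta> * sin \<phi>
        = c * (a + 2) * exp (- \<tau> * (4 * a + 6)) * (sin \<theta> * sin \<phi>)" by (simp only: mult.assoc)
    then show ?thesis
      unfolding e2 unfolding weighted_integral_def q shift \<tau>_def[symmetric]
      by (intro arg_cong[where f = "square_integral \<mu> \<nu>"] ext) (simp only: sincos, simp add: mult_ac)
  qed
  have splitB: "?T p = poly_moment (pi_moment \<alpha>) ?\<delta> A B p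
      - B * poly_moment (pi_moment \<alpha>) (kappa_moment \<beta>) A B (pderiv p)" for p
    by (rule poly_moment_split_right[OF pi_moment_split])
  have splitA: "?T p = poly_moment ?\<delta> (pi_moment \<beta>) A B p
      - A * poly_moment (kappa_moment \<alpha>) (pi_moment \<beta>) A B (pderiv p)" for p
    by (rule poly_moment_split_left[OF pi_moment_split])
  have splitAB: "?T p = poly_moment ?\<delta> ?\<delta> A B p
      - B * poly_moment ?\<delta> (kappa_moment \<beta>) A B (pderiv p)
      - A * poly_moment (kappa_moment \<alpha>) ?\<delta> A B (pderiv p)
      + A * B * poly_moment (kappa_moment \<alpha>) (kappa_moment \<beta>) A B (pderiv (pderiv p))" for p
    unfolding splitA poly_moment_split_right[OF pi_moment_split[of \<beta>], of "pi_moment (-1/2)"]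
      poly_moment_split_right[OF pi_moment_split[of \<beta>], of "kappa_moment \<alpha>"]
    by (simp add: algebra_simps)
  have case_i: "jacobi_h \<alpha> \<beta> 0 / ultra_h (\<alpha> + \<beta> + 1/2) 0 * ?G
       = square_integral (Pi_measure \<alpha>) (Pi_measure \<beta>)
           (\<lambda>u v. ultra_heat (\<alpha> + \<beta> + 1/2) (t/4) (q_arg \<theta> \<phi> u v) 1)"
    if "\<alpha> \<ge> -1/2" "\<beta> \<ge> -1/2"
    unfolding I0[symmetric]
    using that \<tau> AB by (intro norm1 sums_ultra_heat_even has_moments_Pi_measure pi_moment_odd_sum) (auto simp: a_def)
  have case_ii: "jacobi_h \<alpha> \<beta> 0 / ultra_h (\<alpha> + \<beta> + 1/2) 0 * ?G
       = square_integral (Pi_measure \<alpha>) lborel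
           (\<lambda>u v. -2 * (\<alpha> + \<beta> + 3/2) * exp (- t * (\<alpha> + \<beta> + 3/2) / 2)
              * cos (\<theta>/2) * cos (\<phi>/2)
              * ultra_heat (\<alpha> + \<beta> + 3/2) (t/4) (q_arg \<theta> \<phi> u v) 1 * Pi_fun \<beta> v)
       + square_integral (Pi_measure \<alpha>) (Pi_measure (-1/2))
           (\<lambda>u v. ultra_heat (\<alpha> + \<beta> + 1/2) (t/4) (q_arg \<theta> \<phi> u v) 1)"
    if ab: "-1 < \<beta>" "\<beta> < -1/2" "-1/2 \<le> \<alpha>"
  proof -
    have a: "a > -1" "a > -3/2" using ab by (simp_all add: a_def)
    have \<alpha>: "has_moments (Pi_measure \<alpha>) ?one (pi_moment \<alpha>)" by (rule has_moments_Pi_measure[OF ab(3)])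
    have \<beta>: "has_moments lborel (Pi_fun \<beta>) (kappa_moment \<beta>)" by (rule has_moments_Pi_fun[OF ab(1,2)])
    have "(\<lambda>n. - (a + 1) * B * (?E n * poly_moment (pi_moment \<alpha>) (kappa_moment \<beta>) A B (pderiv (?P n)))
          + (a + 1) * (?E n * poly_moment (pi_moment \<alpha>) ?\<delta> A B (?P n))) sums
        (?W (Pi_measure \<alpha>) ?one lborel (Pi_fun \<beta>) (- (a + 1) * B * (2 * exp (- \<tau> * (2 * a + 2)))) (\<lambda>x. ultra_heat (a + 1) \<tau> x 1)
         + ?W (Pi_measure \<alpha>) ?one (Pi_measure (-1/2)) ?one 1 (\<lambda>x. ultra_heat a \<tau> x 1))"
      by (intro sums_add sums_pderiv[OF \<tau> a(2) \<alpha> \<beta> AB _ refl] sums_ultra_heat_even[OF \<tau> a(1) \<alpha> \<delta> AB]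
        pi_kappa_moment_even_sum pi_moment_odd_sum)
    moreover have "- (a + 1) * B * (?E n * poly_moment (pi_moment \<alpha>) (kappa_moment \<beta>) A B (pderiv (?P n)))
          + (a + 1) * (?E n * poly_moment (pi_moment \<alpha>) ?\<delta> A B (?P n)) = (a + 1) * (?E n * ?T (?P n))" for n
      unfolding splitB by (simp add: algebra_simps)
    ultimately show ?thesis
      using ab a unfolding I0 IB by (intro norm1) (simp_all only: shift)
  qed
  have case_iii: "jacobi_h \<alpha> \<beta> 0 / ultra_h (\<alpha> + \<beta> + 1/2) 0 * ?G
       = square_integral lborel (Pi_measure \<beta>)
           (\<lambda>u v. -2 * (\<alpha> + \<beta> + 3/2) * exp (- t * (\<alpha> + \<beta> + 3/2) / 2)
              * sin (\<theta>/2) * sin (\<phi>/2)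
              * ultra_heat (\<alpha> + \<beta> + 3/2) (t/4) (q_arg \<theta> \<phi> u v) 1 * Pi_fun \<alpha> u)
       + square_integral (Pi_measure (-1/2)) (Pi_measure \<beta>)
           (\<lambda>u v. ultra_heat (\<alpha> + \<beta> + 1/2) (t/4) (q_arg \<theta> \<phi> u v) 1)"
    if ab: "-1 < \<alpha>" "\<alpha> < -1/2" "-1/2 \<le> \<beta>"
  proof -
    have a: "a > -1" "a > -3/2" using ab by (simp_all add: a_def)
    have \<beta>: "has_moments (Pi_measure \<beta>) ?one (pi_moment \<beta>)" by (rule has_moments_Pi_measure[OF ab(3)])
    have \<alpha>: "has_moments lborel (Pi_fun \<alpha>) (kappa_moment \<alpha>)" by (rule has_moments_Pi_fun[OF ab(1,2)])
    have "(\<lambda>n. - (a + 1) * A * (?E n * poly_moment (kappa_moment \<alpha>) (pi_moment \<beta>) A B (pderiv (?P n)))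
          + (a + 1) * (?E n * poly_moment ?\<delta> (pi_moment \<beta>) A B (?P n))) sums
        (?W lborel (Pi_fun \<alpha>) (Pi_measure \<beta>) ?one (- (a + 1) * A * (2 * exp (- \<tau> * (2 * a + 2)))) (\<lambda>x. ultra_heat (a + 1) \<tau> x 1)
         + ?W (Pi_measure (-1/2)) ?one (Pi_measure \<beta>) ?one 1 (\<lambda>x. ultra_heat a \<tau> x 1))"
      by (intro sums_add sums_pderiv[OF \<tau> a(2) \<alpha> \<beta> AB _ refl] sums_ultra_heat_even[OF \<tau> a(1) \<delta> \<beta> AB]
        pi_kappa_moment_even_sum pi_moment_odd_sum)
    moreover have "- (a + 1) * A * (?E n * poly_moment (kappa_moment \<alpha>) (pi_moment \<beta>) A B (pderiv (?P n)))
          + (a + 1) * (?E n * poly_moment ?\<delta> (pi_moment \<beta>) A B (?P n)) = (a + 1) * (?E n * ?T (?P n))" for n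
      unfolding splitA by (simp add: algebra_simps)
    ultimately show ?thesis
      using ab a unfolding I0 IA by (intro norm1) (simp_all only: shift)
  qed
  \<comment> \<open>The last two cases differ only in the scale \<open>C\<close> and in the kernel of the term without derivatives, whose
    integral is \<open>I\<close> below.\<close>
  let ?terms = "\<lambda>C n. C * A * B * (?E n * poly_moment (kappa_moment \<alpha>) (kappa_moment \<beta>) A B (pderiv (pderiv (?P n))))
          + - C * A * (?E n * poly_moment (kappa_moment \<alpha>) ?\<delta> A B (pderiv (?P n)))
          + - C * B * (?E n * poly_moment ?\<delta> (kappa_moment \<beta>) A B (pderiv (?P n)))
          + C * (?E n * poly_moment ?\<delta> ?\<delta> A B (?P n))"
  have terms: "?terms C n = C * (?E n * ?T (?P n))" for C n
    unfolding splitAB by (simp add: algebra_simps)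
  have sums_terms: "(\<lambda>n. C * (?E n * ?T (?P n))) sums
       (?W lborel (Pi_fun \<alpha>) lborel (Pi_fun \<beta>) (C * A * B * (4 * (a + 2) * exp (- \<tau> * (4 * a + 6)))) (\<lambda>x. ultra_heat (a + 2) \<tau> x 1)
        + ?W lborel (Pi_fun \<alpha>) (Pi_measure (-1/2)) ?one (- C * A * (2 * exp (- \<tau> * (2 * a + 2)))) (\<lambda>x. ultra_heat (a + 1) \<tau> x 1)
        + ?W (Pi_measure (-1/2)) ?one lborel (Pi_fun \<beta>) (- C * B * (2 * exp (- \<tau> * (2 * a + 2)))) (\<lambda>x. ultra_heat (a + 1) \<tau> x 1)
        + I)"
    if ab: "-1 < \<alpha>" "\<alpha> < -1/2" "-1 < \<beta>" "\<beta> < -1/2"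
      and base: "(\<lambda>n. C * (?E n * poly_moment ?\<delta> ?\<delta> A B (?P n))) sums I" for C I
  proof -
    have a: "a > -3/2" using ab by (simp add: a_def)
    have \<alpha>: "has_moments lborel (Pi_fun \<alpha>) (kappa_moment \<alpha>)" by (rule has_moments_Pi_fun[OF ab(1,2)])
    have \<beta>: "has_moments lborel (Pi_fun \<beta>) (kappa_moment \<beta>)" by (rule has_moments_Pi_fun[OF ab(3,4)])
    show ?thesis
      unfolding terms[symmetric]
      by (intro sums_add base sums_pderiv_pderiv[OF \<tau> a \<alpha> \<beta> AB _ refl] sums_pderiv[OF \<tau> a \<alpha> \<delta> AB _ refl]
        sums_pderiv[OF \<tau> a \<delta> \<beta> AB _ refl] pi_kappa_moment_even_sum kappa_moment_odd_sum)
  qed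
  have case_iv: "jacobi_h \<alpha> \<beta> 0 / ultra_h (\<alpha> + \<beta> + 1/2) 0 * ?G
       = square_integral lborel lborel
           (\<lambda>u v. (\<alpha> + \<beta> + 3/2) * (\<alpha> + \<beta> + 5/2) * exp (- t * (\<alpha> + \<beta> + 2))
              * sin \<theta> * sin \<phi>
              * ultra_heat (\<alpha> + \<beta> + 5/2) (t/4) (q_arg \<theta> \<phi> u v) 1 * Pi_fun \<alpha> u * Pi_fun \<beta> v)
       + square_integral lborel (Pi_measure (-1/2))
           (\<lambda>u v. -2 * (\<alpha> + \<beta> + 3/2) * exp (- t * (\<alpha> + \<beta> + 3/2) / 2)
              * sin (\<theta>/2) * sin (\<phi>/2)
              * ultra_heat (\<alpha> + \<beta> + 3/2) (t/4) (q_arg \<theta> \<phi> u v) 1 * Pi_fun \<alpha> u)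
       + square_integral (Pi_measure (-1/2)) lborel
           (\<lambda>u v. -2 * (\<alpha> + \<beta> + 3/2) * exp (- t * (\<alpha> + \<beta> + 3/2) / 2)
              * cos (\<theta>/2) * cos (\<phi>/2)
              * ultra_heat (\<alpha> + \<beta> + 3/2) (t/4) (q_arg \<theta> \<phi> u v) 1 * Pi_fun \<beta> v)
       + square_integral (Pi_measure (-1/2)) (Pi_measure (-1/2))
           (\<lambda>u v. ultra_heat (\<alpha> + \<beta> + 1/2) (t/4) (q_arg \<theta> \<phi> u v) 1)"
    if ab: "-1 < \<alpha>" "\<alpha> < -1/2" "-1 < \<beta>" "\<beta> < -1/2" and s: "\<alpha> + \<beta> > -3/2"
  proof -
    have a: "a > -1" using s by (simp add: a_def)
    have base: "(\<lambda>n. (a + 1) * (?E n * poly_moment ?\<delta> ?\<delta> A B (?P n))) sums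
        ?W (Pi_measure (-1/2)) ?one (Pi_measure (-1/2)) ?one 1 (\<lambda>x. ultra_heat a \<tau> x 1)"
      by (rule sums_ultra_heat_even[OF \<tau> a \<delta> \<delta> AB pi_moment_odd_sum])
    show ?thesis
      using norm1[OF ab(1,3) a sums_terms[OF ab base]] unfolding I0 IA IB IAB by (simp only: shift)
  qed
  have case_v: "jacobi_h \<alpha> \<beta> 0 * const_C0 \<alpha> \<beta> * ?G
       = square_integral lborel lborel
           (\<lambda>u v. (\<alpha> + \<beta> + 5/2) * exp (- t * (\<alpha> + \<beta> + 2))
              * sin \<theta> * sin \<phi>
              * ultra_heat (\<alpha> + \<beta> + 5/2) (t/4) (q_arg \<theta> \<phi> u v) 1 * Pi_fun \<alpha> u * Pi_fun \<beta> v)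
       + square_integral lborel (Pi_measure (-1/2))
           (\<lambda>u v. -2 * exp (- t * (\<alpha> + \<beta> + 3/2) / 2)
              * sin (\<theta>/2) * sin (\<phi>/2)
              * ultra_heat (\<alpha> + \<beta> + 3/2) (t/4) (q_arg \<theta> \<phi> u v) 1 * Pi_fun \<alpha> u)
       + square_integral (Pi_measure (-1/2)) lborel
           (\<lambda>u v. -2 * exp (- t * (\<alpha> + \<beta> + 3/2) / 2)
              * cos (\<theta>/2) * cos (\<phi>/2)
              * ultra_heat (\<alpha> + \<beta> + 3/2) (t/4) (q_arg \<theta> \<phi> u v) 1 * Pi_fun \<beta> v)
       + square_integral (Pi_measure (-1/2)) (Pi_measure (-1/2))
           (\<lambda>u v. heat_H (\<alpha> + \<beta> + 1/2) (t/4) (q_arg \<theta> \<phi> u v))"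
    if ab: "-1 < \<alpha>" "\<alpha> < -1/2" "-1 < \<beta>" "\<beta> < -1/2"
  proof -
    have a: "a > -3/2" using ab by (simp add: a_def)
    have base: "(\<lambda>n. 1 * (?E n * poly_moment ?\<delta> ?\<delta> A B (?P n))) sums
        ?W (Pi_measure (-1/2)) ?one (Pi_measure (-1/2)) ?one 1 (heat_H a \<tau>)"
      by (rule sums_heat_H[OF \<tau> a \<delta> \<delta> AB])
    show ?thesis
      using norm2[OF ab(1,3) sums_terms[OF ab base]] unfolding IH IA IB IAB by (simp only: mult_1 mult_1_right)
  qed
  show ?thesis
    by (intro conjI impI; elim conjE) (rule case_i case_ii case_iii case_iv case_v; assumption)+
qed

end
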